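(* Let $f\in\mathbb{Z}[x_1,\dots,x_n]$ be a polynomial of degree $d\ge1$ whose real zero set is smooth, and let $I\subseteq\mathbb{R}^n$ be an axis-aligned $n$-dimensional cube whose corners have integral coordinates. Let $\tau=\lg H$ be the maximum bit-size of the coefficients of $f$ and of the coordinates of the corners of $I$, where $H$ is the maximum absolute value of these integers. The overall bit-complexity of the modified Plantinga–Vegter (PV) algorithm on input $(f,I)$ is $$2^{O\left(n^3\,2^{24n}\,d^{12n+1}\,(d+\tau+n\lg d)\right)}\ \widetilde{O}_B\!\left(2^{26n}\,d^{14n+2}\,(d+\tau)\right).$$
   Context: $\lg=\log_2$. $O_B$ denotes bit-complexity and $\widetilde{O}_B$ means that logarithmic factors of the dominant term are ignored. The real zero set of $f$ is smooth if there is no $x\in\mathbb{R}^n$ with $f(x)=0$ and $\nabla f(x)=0$. Standard centered form: for a polynomial $F\in\mathbb{R}[z_1,\dots,z_N]$ of total degree $D$ and an axis-aligned $N$-dimensional cube $Q$ (product of $N$ closed intervals of common width $w>0$) with midpoint $m$, $$\square F(Q)=F(m)+\left(\sum_{1\le|\alpha|\le D}\frac{|\partial^\alpha F(m)|}{\alpha!}\left(\frac{w}{2}\right)^{|\alpha|}\right)[-1,1].$$ Tests: let $g(x_1,\dots,x_n,y_1,\dots,y_n)=\langle\nabla f(x_1,\dots,x_n),\nabla f(y_1,\dots,y_n)\rangle$. For an axis-aligned cube $J\subseteq\mathbb{R}^n$: $C_0(J)$ is True iff $0\notin\square f(J)$; $C_1(J)$ is True iff $0\notin\square g(J\times J)$.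 The tests are evaluated by computing the coefficients of the Taylor shifts $f(x+m)$ and $g((x,y)+(m,m))$, where $m$ is the midpoint of $J$. Modified PV algorithm (main subdivision): start with $P=\{I\}$; as long as some $J\in P$ satisfies neither $C_0(J)$ nor $C_1(J)$, replace $J$ in $P$ by the $2^n$ congruent subcubes obtained by bisecting each side of $J$. The bit-complexity is that of carrying out all the tests during this subdivision. *)

theory Defs
  imports Complex_Main "HOL-Library.Poly_Mapping" "HOL-Library.While_Combinator"
begin

section \<open>Polynomials, centered forms and the subdivision\<close>

text \<open>
  A polynomial is a finitely supported map from exponent vectors to coefficients; a polynomial
  in \<open>n\<close> variables uses only the variables with index below \<open>n\<close>. Points of \<open>n\<close>-space are real
  lists of length \<open>n\<close>.
\<close>

type_synonym 'a mpoly = "(nat \<Rightarrow>\<^sub>0 nat) \<Rightarrow>\<^sub>0 'a"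

definition mvars :: "'a::zero mpoly \<Rightarrow> nat set" where
  "mvars F = (\<Union>\<alpha>\<in>Poly_Mapping.keys F. Poly_Mapping.keys \<alpha>)"

definition mdeg :: "(nat \<Rightarrow>\<^sub>0 nat) \<Rightarrow> nat" where
  "mdeg \<alpha> = (\<Sum>i\<in>Poly_Mapping.keys \<alpha>. Poly_Mapping.lookup \<alpha> i)"

definition mfact :: "(nat \<Rightarrow>\<^sub>0 nat) \<Rightarrow> nat" where
  "mfact \<alpha> = (\<Prod>i\<in>Poly_Mapping.keys \<alpha>. fact (Poly_Mapping.lookup \<alpha> i))"

definition total_degree :: "'a::zero mpoly \<Rightarrow> nat" where
  "total_degree F = Max (insert 0 (mdeg ` Poly_Mapping.keys F))"

definition real_mpoly :: "int mpoly \<Rightarrow> real mpoly" where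
  "real_mpoly f = Poly_Mapping.map real_of_int f"

definition peval :: "'a::comm_semiring_1 mpoly \<Rightarrow> 'a list \<Rightarrow> 'a" where
  "peval F x = (\<Sum>\<alpha>\<in>Poly_Mapping.keys F. Poly_Mapping.lookup F \<alpha> * (\<Prod>i\<in>Poly_Mapping.keys \<alpha>. (x ! i) ^ Poly_Mapping.lookup \<alpha> i))"

text \<open>
  Monomials not containing the variable get the factor \<open>0\<close>, so truncated subtraction of
  exponents is harmless.
\<close>

definition pd :: "nat \<Rightarrow> 'a::comm_semiring_1 mpoly \<Rightarrow> 'a mpoly" where
  "pd i F = (\<Sum>\<alpha>\<in>Poly_Mapping.keys F.
     Poly_Mapping.single (\<alpha> - Poly_Mapping.single i 1) (of_nat (Poly_Mapping.lookup \<alpha> i) * Poly_Mapping.lookup F \<alpha>))"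

definition mixed_pd :: "(nat \<Rightarrow>\<^sub>0 nat) \<Rightarrow> 'a::comm_semiring_1 mpoly \<Rightarrow> 'a mpoly" where
  "mixed_pd \<alpha> F = fold (\<lambda>i. pd i ^^ Poly_Mapping.lookup \<alpha> i) (sorted_list_of_set (Poly_Mapping.keys \<alpha>)) F"

text \<open>\<open>x\<^sub>i\<close> becomes \<open>x\<^bsub>n+i\<^esub>\<close>; for \<open>f\<close> in \<open>n\<close> variables this is \<open>f(y)\<close> as a polynomial in \<open>(x, y)\<close>.\<close>

definition shift_vars :: "nat \<Rightarrow> 'a::comm_semiring_1 mpoly \<Rightarrow> 'a mpoly" where
  "shift_vars n F = (\<Sum>\<alpha>\<in>Poly_Mapping.keys F.
     Poly_Mapping.single (\<Sum>i\<in>Poly_Mapping.keys \<alpha>. Poly_Mapping.single (n + i) (Poly_Mapping.lookup \<alpha> i)) (Poly_Mapping.lookup F \<alpha>))"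

definition grad_prod :: "nat \<Rightarrow> 'a::comm_semiring_1 mpoly \<Rightarrow> 'a mpoly" where
  "grad_prod n f = (\<Sum>i<n. pd i f * shift_vars n (pd i f))"

definition smooth_real_zero_set :: "nat \<Rightarrow> real mpoly \<Rightarrow> bool" where
  "smooth_real_zero_set n f \<longleftrightarrow>
     \<not> (\<exists>x. length x = n \<and> peval f x = 0 \<and> (\<forall>i<n. peval (pd i f) x = 0))"

text \<open>The cube \<open>(a, w)\<close> is the product of the intervals \<open>[a ! i, a ! i + w]\<close>.\<close>

type_synonym cube = "real list \<times> real"

definition midpoint :: "cube \<Rightarrow> real list" where
  "midpoint Q = map (\<lambda>t. t + snd Q / 2) (fst Q)"

definition centered_form :: "real mpoly \<Rightarrow> cube \<Rightarrow> real set" where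
  "centered_form F Q =
     (let m = midpoint Q;
          r = (\<Sum>\<alpha> | Poly_Mapping.keys \<alpha> \<subseteq> {..<length (fst Q)} \<and> 1 \<le> mdeg \<alpha> \<and> mdeg \<alpha> \<le> total_degree F.
                 \<bar>peval (mixed_pd \<alpha> F) m\<bar> / real (mfact \<alpha>) * (snd Q / 2) ^ mdeg \<alpha>)
      in {peval F m - r .. peval F m + r})"

definition C0 :: "real mpoly \<Rightarrow> cube \<Rightarrow> bool" where
  "C0 f J \<longleftrightarrow> 0 \<notin> centered_form f J"

definition C1 :: "real mpoly \<Rightarrow> cube \<Rightarrow> bool" where
  "C1 f J \<longleftrightarrow> 0 \<notin> centered_form (grad_prod (length (fst J)) f) (fst J @ fst J, snd J)"

definition bisect :: "cube \<Rightarrow> cube set" where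
  "bisect J = {(b, snd J / 2) | b. length b = length (fst J) \<and>
     (\<forall>i<length b. b ! i \<in> {fst J ! i, fst J ! i + snd J / 2})}"

definition pv_step :: "real mpoly \<Rightarrow> cube set \<Rightarrow> cube set \<Rightarrow> bool" where
  "pv_step f P P' \<longleftrightarrow> (\<exists>J\<in>P. \<not> C0 f J \<and> \<not> C1 f J \<and> P' = P - {J} \<union> bisect J)"

definition pv_result :: "real mpoly \<Rightarrow> cube \<Rightarrow> cube set \<Rightarrow> bool" where
  "pv_result f I P \<longleftrightarrow> (pv_step f)\<^sup>*\<^sup>* {I} P \<and> (\<forall>J\<in>P. C0 f J \<or> C1 f J)"

text \<open>
  The largest absolute value of a coefficient of \<open>f\<close> or of a corner coordinate of the cube
  \<open>(a, w)\<close>; each coordinate of a corner is \<open>a ! i\<close> or \<open>a ! i + w\<close>.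
\<close>

definition input_height :: "int mpoly \<Rightarrow> int list \<Rightarrow> int \<Rightarrow> int" where
  "input_height f a w =
     Max (abs ` (Poly_Mapping.lookup f ` Poly_Mapping.keys f \<union> set a \<union> (\<lambda>t. t + w) ` set a))"


section \<open>Bit-level implementation\<close>

text \<open>
  The subdivision is carried out by a functional program whose data are built from single bits.
  Natural numbers are bit lists, least significant bit first, and operations on single bits are
  the only arithmetic primitives. Exponents of dyadic numbers are kept in unary. Multiplication
  is the schoolbook one.

  In \<open>bit_add\<close> and \<open>bit_sub\<close> the first argument is the carry or borrow; \<open>bit_sub\<close> requires the
  minuend not to be smaller than the subtrahend plus borrow. The first argument of
  \<open>bit_less\<close> is the result of comparing the less significant bits already read.
\<close>

fun bit_add :: "bool \<Rightarrow> bool list \<Rightarrow> bool list \<Rightarrow> bool list" where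
  "bit_add c [] [] = (if c then [True] else [])"
| "bit_add c [] (y # ys) = (y \<noteq> c) # bit_add (y \<and> c) [] ys"
| "bit_add c (x # xs) [] = (x \<noteq> c) # bit_add (x \<and> c) xs []"
| "bit_add c (x # xs) (y # ys) = (x \<noteq> (y \<noteq> c)) # bit_add (if x = y then x else c) xs ys"

fun bit_sub :: "bool \<Rightarrow> bool list \<Rightarrow> bool list \<Rightarrow> bool list" where
  "bit_sub c [] ys = []"
| "bit_sub c (x # xs) [] = (x \<noteq> c) # bit_sub (\<not> x \<and> c) xs []"
| "bit_sub c (x # xs) (y # ys) = (x \<noteq> (y \<noteq> c)) # bit_sub (if x = y then c else y) xs ys"

fun bit_less :: "bool \<Rightarrow> bool list \<Rightarrow> bool list \<Rightarrow> bool" where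
  "bit_less c [] [] = c"
| "bit_less c [] (y # ys) = bit_less (c \<or> y) [] ys"
| "bit_less c (x # xs) [] = bit_less (c \<and> \<not> x) xs []"
| "bit_less c (x # xs) (y # ys) = bit_less (if x = y then c else y) xs ys"

fun bit_mult :: "bool list \<Rightarrow> bool list \<Rightarrow> bool list" where
  "bit_mult [] ys = []"
| "bit_mult (x # xs) ys =
     (if x then bit_add False ys (False # bit_mult xs ys) else False # bit_mult xs ys)"

text \<open>
  \<open>align e e' xs ys\<close> brings \<open>xs / 2 ^ e\<close> and \<open>ys / 2 ^ e'\<close> to the common denominator
  \<open>2 ^ max e e'\<close> and also returns this maximum.
\<close>

fun align :: "nat \<Rightarrow> nat \<Rightarrow> bool list \<Rightarrow> bool list \<Rightarrow> bool list \<times> bool list \<times> nat" where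
  "align 0 0 xs ys = (xs, ys, 0)"
| "align 0 (Suc e') xs ys = (case align 0 e' (False # xs) ys of (xs', ys', k) \<Rightarrow> (xs', ys', Suc k))"
| "align (Suc e) 0 xs ys = (case align e 0 xs (False # ys) of (xs', ys', k) \<Rightarrow> (xs', ys', Suc k))"
| "align (Suc e) (Suc e') xs ys = (case align e e' xs ys of (xs', ys', k) \<Rightarrow> (xs', ys', Suc k))"

fun add_exp :: "nat \<Rightarrow> nat \<Rightarrow> nat" where
  "add_exp 0 e' = e'"
| "add_exp (Suc e) e' = Suc (add_exp e e')"

text \<open>\<open>Dyadic s xs e\<close> is \<open>xs / 2 ^ e\<close>, with a minus sign if \<open>s\<close>.\<close>

datatype dyadic = Dyadic bool "bool list" nat

fun dy_add :: "dyadic \<Rightarrow> dyadic \<Rightarrow> dyadic" where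
  "dy_add (Dyadic s xs e) (Dyadic t ys e') =
     (case align e e' xs ys of (xs', ys', k) \<Rightarrow>
        if s = t then Dyadic s (bit_add False xs' ys') k
        else if bit_less False xs' ys' then Dyadic t (bit_sub False ys' xs') k
        else Dyadic s (bit_sub False xs' ys') k)"

fun dy_mult :: "dyadic \<Rightarrow> dyadic \<Rightarrow> dyadic" where
  "dy_mult (Dyadic s xs e) (Dyadic t ys e') = Dyadic (s \<noteq> t) (bit_mult xs ys) (add_exp e e')"

fun dy_half :: "dyadic \<Rightarrow> dyadic" where
  "dy_half (Dyadic s xs e) = Dyadic s xs (Suc e)"

fun dy_abs :: "dyadic \<Rightarrow> dyadic" where
  "dy_abs (Dyadic s xs e) = Dyadic False xs e"

fun dy_abs_less :: "dyadic \<Rightarrow> dyadic \<Rightarrow> bool" where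
  "dy_abs_less (Dyadic s xs e) (Dyadic t ys e') =
     (case align e e' xs ys of (xs', ys', k) \<Rightarrow> bit_less False xs' ys')"

text \<open>
  Recursive Horner representation: over the variables \<open>x\<^sub>i, x\<^bsub>i+1\<^esub>, \<dots>\<close> the term \<open>Horner p q\<close>
  stands for \<open>p + x\<^sub>i * q\<close>, where \<open>p\<close> is over \<open>x\<^bsub>i+1\<^esub>, \<dots>\<close> and \<open>q\<close> is over \<open>x\<^sub>i, x\<^bsub>i+1\<^esub>, \<dots>\<close>.
  \<open>Zero\<close> is the zero polynomial over any list of variables, \<open>Coeff\<close> occurs when no variable is
  left. The last equation of \<open>h_add\<close> is relevant only for \<open>q = Zero\<close>.
\<close>

datatype horner = Coeff dyadic | Zero | Horner horner horner

fun h_add :: "horner \<Rightarrow> horner \<Rightarrow> horner" where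
  "h_add Zero q = q"
| "h_add (Coeff a) (Coeff b) = Coeff (dy_add a b)"
| "h_add (Horner p p') (Horner q q') = Horner (h_add p q) (h_add p' q')"
| "h_add p q = p"

fun h_smult :: "dyadic \<Rightarrow> horner \<Rightarrow> horner" where
  "h_smult c (Coeff a) = Coeff (dy_mult c a)"
| "h_smult c Zero = Zero"
| "h_smult c (Horner p q) = Horner (h_smult c p) (h_smult c q)"

fun h_deriv :: "nat \<Rightarrow> horner \<Rightarrow> horner" where
  "h_deriv i (Coeff a) = Zero"
| "h_deriv i Zero = Zero"
| "h_deriv 0 (Horner p q) = h_add q (Horner Zero (h_deriv 0 q))"
| "h_deriv (Suc i) (Horner p q) = Horner (h_deriv i p) (h_deriv (Suc i) q)"

text \<open>The product of a polynomial in \<open>x\<close> and a polynomial in \<open>y\<close>, as a polynomial in \<open>(x, y)\<close>.\<close>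

fun h_tensor :: "horner \<Rightarrow> horner \<Rightarrow> horner" where
  "h_tensor (Coeff a) q = h_smult a q"
| "h_tensor Zero q = Zero"
| "h_tensor (Horner p p') q = Horner (h_tensor p q) (h_tensor p' q)"

fun h_grad_prod :: "nat \<Rightarrow> horner \<Rightarrow> horner" where
  "h_grad_prod 0 p = Zero"
| "h_grad_prod (Suc i) p = (let q = h_deriv i p in h_add (h_grad_prod i p) (h_tensor q q))"

fun taylor_shift :: "dyadic list \<Rightarrow> horner \<Rightarrow> horner" where
  "taylor_shift ms (Coeff a) = Coeff a"
| "taylor_shift ms Zero = Zero"
| "taylor_shift [] (Horner p q) = Horner p q"
| "taylor_shift (m # ms) (Horner p q) =
     (let r = taylor_shift (m # ms) q in h_add (Horner (taylor_shift ms p) r) (h_smult m r))"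

fun h_const :: "horner \<Rightarrow> dyadic" where
  "h_const (Coeff a) = a"
| "h_const Zero = Dyadic False [] 0"
| "h_const (Horner p q) = h_const p"

text \<open>
  \<open>h_abs_eval u p\<close> is the sum of \<open>\<bar>c\<^sub>\<alpha>\<bar> * u ^ \<bar>\<alpha>\<bar>\<close> over all coefficients \<open>c\<^sub>\<alpha>\<close> of \<open>p\<close>, including
  the constant one. Hence \<open>0\<close> lies outside the centered form iff the value at \<open>u = w / 2\<close> for
  the shifted polynomial is smaller than twice the absolute value of the constant coefficient.
\<close>

fun h_abs_eval :: "dyadic \<Rightarrow> horner \<Rightarrow> dyadic" where
  "h_abs_eval u (Coeff a) = dy_abs a"
| "h_abs_eval u Zero = Dyadic False [] 0"
| "h_abs_eval u (Horner p q) = dy_add (h_abs_eval u p) (dy_mult u (h_abs_eval u q))"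

fun centered_test :: "dyadic \<Rightarrow> dyadic list \<Rightarrow> horner \<Rightarrow> bool" where
  "centered_test u ms p =
     (let t = taylor_shift ms p; c = h_const t in dy_abs_less (h_abs_eval u t) (dy_add c c))"

fun translate :: "dyadic \<Rightarrow> dyadic list \<Rightarrow> dyadic list" where
  "translate h [] = []"
| "translate h (a # as) = dy_add a h # translate h as"

type_synonym dcube = "dyadic list \<times> dyadic"

fun accepted :: "horner \<Rightarrow> horner \<Rightarrow> dcube \<Rightarrow> bool" where
  "accepted p g (as, w) =
     (let h = dy_half w; m = translate h as;
          c0 = centered_test h m p; c1 = centered_test h (m @ m) g in c0 \<or> c1)"

fun cons_all :: "'a \<Rightarrow> 'a list list \<Rightarrow> 'a list list" where
  "cons_all a [] = []"
| "cons_all a (xs # xss) = (a # xs) # cons_all a xss"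

fun subcorners :: "dyadic \<Rightarrow> dyadic list \<Rightarrow> dyadic list list" where
  "subcorners h [] = [[]]"
| "subcorners h (a # as) =
     (let r = subcorners h as in cons_all a r @ cons_all (dy_add a h) r)"

fun with_width :: "dyadic \<Rightarrow> dyadic list list \<Rightarrow> dcube list" where
  "with_width h [] = []"
| "with_width h (as # ass) = (as, h) # with_width h ass"

fun subcubes :: "dcube \<Rightarrow> dcube list" where
  "subcubes (as, w) = (let h = dy_half w in with_width h (subcorners h as))"

fun pv_process :: "horner \<Rightarrow> horner \<Rightarrow> dcube list \<times> dcube list
    \<Rightarrow> dcube list \<times> dcube list" where
  "pv_process p g ([], fin) = ([], fin)"
| "pv_process p g (J # todo, fin) =
     (if accepted p g J then (todo, J # fin) else (subcubes J @ todo, fin))"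

section \<open>Running time\<close>

text \<open>
  Number of elementary steps of the program, following the conventions of
  \<open>HOL-Library.Time_Commands\<close>: every function call costs one step plus the cost of the calls it
  makes; constructors, pattern matching, conditionals and operations on single bits are free.
  Non-recursive functions are charged for the call as well.
  As all numbers are bit lists and all exponents are unary, a step handles boundedly many bits.
\<close>

fun T_append :: "'a list \<Rightarrow> 'a list \<Rightarrow> nat" where
  "T_append [] ys = 1"
| "T_append (x # xs) ys = T_append xs ys + 1"

fun T_bit_add :: "bool \<Rightarrow> bool list \<Rightarrow> bool list \<Rightarrow> nat" where
  "T_bit_add c [] [] = 1"
| "T_bit_add c [] (y # ys) = T_bit_add (y \<and> c) [] ys + 1"
| "T_bit_add c (x # xs) [] = T_bit_add (x \<and> c) xs [] + 1"
| "T_bit_add c (x # xs) (y # ys) = T_bit_add (if x = y then x else c) xs ys + 1"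

fun T_bit_sub :: "bool \<Rightarrow> bool list \<Rightarrow> bool list \<Rightarrow> nat" where
  "T_bit_sub c [] ys = 1"
| "T_bit_sub c (x # xs) [] = T_bit_sub (\<not> x \<and> c) xs [] + 1"
| "T_bit_sub c (x # xs) (y # ys) = T_bit_sub (if x = y then c else y) xs ys + 1"

fun T_bit_less :: "bool \<Rightarrow> bool list \<Rightarrow> bool list \<Rightarrow> nat" where
  "T_bit_less c [] [] = 1"
| "T_bit_less c [] (y # ys) = T_bit_less (c \<or> y) [] ys + 1"
| "T_bit_less c (x # xs) [] = T_bit_less (c \<and> \<not> x) xs [] + 1"
| "T_bit_less c (x # xs) (y # ys) = T_bit_less (if x = y then c else y) xs ys + 1"

fun T_bit_mult :: "bool list \<Rightarrow> bool list \<Rightarrow> nat" where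
  "T_bit_mult [] ys = 1"
| "T_bit_mult (x # xs) ys = T_bit_mult xs ys +
     (if x then T_bit_add False ys (False # bit_mult xs ys) else 0) + 1"

fun T_align :: "nat \<Rightarrow> nat \<Rightarrow> bool list \<Rightarrow> bool list \<Rightarrow> nat" where
  "T_align 0 0 xs ys = 1"
| "T_align 0 (Suc e') xs ys = T_align 0 e' (False # xs) ys + 1"
| "T_align (Suc e) 0 xs ys = T_align e 0 xs (False # ys) + 1"
| "T_align (Suc e) (Suc e') xs ys = T_align e e' xs ys + 1"

fun T_add_exp :: "nat \<Rightarrow> nat \<Rightarrow> nat" where
  "T_add_exp 0 e' = 1"
| "T_add_exp (Suc e) e' = T_add_exp e e' + 1"

fun T_dy_add :: "dyadic \<Rightarrow> dyadic \<Rightarrow> nat" where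
  "T_dy_add (Dyadic s xs e) (Dyadic t ys e') = T_align e e' xs ys +
     (case align e e' xs ys of (xs', ys', k) \<Rightarrow>
        if s = t then T_bit_add False xs' ys'
        else T_bit_less False xs' ys' +
          (if bit_less False xs' ys' then T_bit_sub False ys' xs'
           else T_bit_sub False xs' ys')) + 1"

fun T_dy_mult :: "dyadic \<Rightarrow> dyadic \<Rightarrow> nat" where
  "T_dy_mult (Dyadic s xs e) (Dyadic t ys e') = T_bit_mult xs ys + T_add_exp e e' + 1"

fun T_dy_half :: "dyadic \<Rightarrow> nat" where
  "T_dy_half (Dyadic s xs e) = 1"

fun T_dy_abs :: "dyadic \<Rightarrow> nat" where
  "T_dy_abs (Dyadic s xs e) = 1"

fun T_dy_abs_less :: "dyadic \<Rightarrow> dyadic \<Rightarrow> nat" where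
  "T_dy_abs_less (Dyadic s xs e) (Dyadic t ys e') = T_align e e' xs ys +
     (case align e e' xs ys of (xs', ys', k) \<Rightarrow> T_bit_less False xs' ys') + 1"

fun T_h_add :: "horner \<Rightarrow> horner \<Rightarrow> nat" where
  "T_h_add Zero q = 1"
| "T_h_add (Coeff a) (Coeff b) = T_dy_add a b + 1"
| "T_h_add (Horner p p') (Horner q q') = T_h_add p q + T_h_add p' q' + 1"
| "T_h_add p q = 1"

fun T_h_smult :: "dyadic \<Rightarrow> horner \<Rightarrow> nat" where
  "T_h_smult c (Coeff a) = T_dy_mult c a + 1"
| "T_h_smult c Zero = 1"
| "T_h_smult c (Horner p q) = T_h_smult c p + T_h_smult c q + 1"

fun T_h_deriv :: "nat \<Rightarrow> horner \<Rightarrow> nat" where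
  "T_h_deriv i (Coeff a) = 1"
| "T_h_deriv i Zero = 1"
| "T_h_deriv 0 (Horner p q) = T_h_deriv 0 q + T_h_add q (Horner Zero (h_deriv 0 q)) + 1"
| "T_h_deriv (Suc i) (Horner p q) = T_h_deriv i p + T_h_deriv (Suc i) q + 1"

fun T_h_tensor :: "horner \<Rightarrow> horner \<Rightarrow> nat" where
  "T_h_tensor (Coeff a) q = T_h_smult a q + 1"
| "T_h_tensor Zero q = 1"
| "T_h_tensor (Horner p p') q = T_h_tensor p q + T_h_tensor p' q + 1"

fun T_h_grad_prod :: "nat \<Rightarrow> horner \<Rightarrow> nat" where
  "T_h_grad_prod 0 p = 1"
| "T_h_grad_prod (Suc i) p = T_h_deriv i p +
     (let q = h_deriv i p in
        T_h_grad_prod i p + T_h_tensor q q + T_h_add (h_grad_prod i p) (h_tensor q q)) + 1"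

fun T_taylor_shift :: "dyadic list \<Rightarrow> horner \<Rightarrow> nat" where
  "T_taylor_shift ms (Coeff a) = 1"
| "T_taylor_shift ms Zero = 1"
| "T_taylor_shift [] (Horner p q) = 1"
| "T_taylor_shift (m # ms) (Horner p q) = T_taylor_shift (m # ms) q +
     (let r = taylor_shift (m # ms) q in
        T_taylor_shift ms p + T_h_smult m r +
        T_h_add (Horner (taylor_shift ms p) r) (h_smult m r)) + 1"

fun T_h_const :: "horner \<Rightarrow> nat" where
  "T_h_const (Coeff a) = 1"
| "T_h_const Zero = 1"
| "T_h_const (Horner p q) = T_h_const p + 1"

fun T_h_abs_eval :: "dyadic \<Rightarrow> horner \<Rightarrow> nat" where
  "T_h_abs_eval u (Coeff a) = T_dy_abs a + 1"
| "T_h_abs_eval u Zero = 1"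
| "T_h_abs_eval u (Horner p q) = T_h_abs_eval u p + T_h_abs_eval u q +
     T_dy_mult u (h_abs_eval u q) +
     T_dy_add (h_abs_eval u p) (dy_mult u (h_abs_eval u q)) + 1"

fun T_centered_test :: "dyadic \<Rightarrow> dyadic list \<Rightarrow> horner \<Rightarrow> nat" where
  "T_centered_test u ms p = T_taylor_shift ms p +
     (let t = taylor_shift ms p; c = h_const t in
        T_h_const t + T_h_abs_eval u t + T_dy_add c c +
        T_dy_abs_less (h_abs_eval u t) (dy_add c c)) + 1"

fun T_translate :: "dyadic \<Rightarrow> dyadic list \<Rightarrow> nat" where
  "T_translate h [] = 1"
| "T_translate h (a # as) = T_dy_add a h + T_translate h as + 1"

fun T_accepted :: "horner \<Rightarrow> horner \<Rightarrow> dcube \<Rightarrow> nat" where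
  "T_accepted p g (as, w) = T_dy_half w +
     (let h = dy_half w; m = translate h as in
        T_translate h as + T_centered_test h m p +
        T_append m m + T_centered_test h (m @ m) g) + 1"

fun T_cons_all :: "'a \<Rightarrow> 'a list list \<Rightarrow> nat" where
  "T_cons_all a [] = 1"
| "T_cons_all a (xs # xss) = T_cons_all a xss + 1"

fun T_subcorners :: "dyadic \<Rightarrow> dyadic list \<Rightarrow> nat" where
  "T_subcorners h [] = 1"
| "T_subcorners h (a # as) = T_subcorners h as +
     (let r = subcorners h as in
        T_cons_all a r + T_dy_add a h + T_cons_all (dy_add a h) r +
        T_append (cons_all a r) (cons_all (dy_add a h) r)) + 1"

fun T_with_width :: "dyadic \<Rightarrow> dyadic list list \<Rightarrow> nat" where
  "T_with_width h [] = 1"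
| "T_with_width h (as # ass) = T_with_width h ass + 1"

fun T_subcubes :: "dcube \<Rightarrow> nat" where
  "T_subcubes (as, w) = T_dy_half w +
     (let h = dy_half w in T_subcorners h as + T_with_width h (subcorners h as)) + 1"

fun T_pv_process :: "horner \<Rightarrow> horner \<Rightarrow> dcube list \<times> dcube list \<Rightarrow> nat" where
  "T_pv_process p g ([], fin) = 1"
| "T_pv_process p g (J # todo, fin) = T_accepted p g J +
     (if accepted p g J then 0 else T_subcubes J + T_append (subcubes J) todo) + 1"


section \<open>The complete run\<close>

fun bits_of_nat :: "nat \<Rightarrow> bool list" where
  "bits_of_nat k = (if k = 0 then [] else odd k # bits_of_nat (k div 2))"

declare bits_of_nat.simps [simp del]

definition dy_of_int :: "int \<Rightarrow> dyadic" where
  "dy_of_int z = Dyadic (z < 0) (bits_of_nat (nat \<bar>z\<bar>)) 0"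

definition dy_val :: "dyadic \<Rightarrow> real" where
  "dy_val x = (case x of Dyadic s xs e \<Rightarrow>
     (if s then - 1 else 1) * horner_sum of_bool 2 xs / 2 ^ e)"

definition dcube_val :: "dcube \<Rightarrow> cube" where
  "dcube_val J = (map dy_val (fst J), dy_val (snd J))"

text \<open>
  Dense encoding with all exponents up to \<open>d\<close> in each of the listed variables; \<open>\<alpha>\<close> collects the
  exponents of the variables already treated.
\<close>

fun dense :: "int mpoly \<Rightarrow> nat \<Rightarrow> (nat \<Rightarrow>\<^sub>0 nat) \<Rightarrow> nat list \<Rightarrow> horner" where
  "dense f d \<alpha> [] = Coeff (dy_of_int (Poly_Mapping.lookup f \<alpha>))"
| "dense f d \<alpha> (i # is) =
     foldr Horner (map (\<lambda>j. dense f d (\<alpha> + Poly_Mapping.single i j) is) [0..<Suc d]) Zero"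

text \<open>
  Runs the program on the encoded input, computing \<open>g\<close> once at the start, and returns the final
  list of cubes together with the total number of steps; \<open>None\<close> means nontermination. The order
  in which cubes are processed affects neither the resulting cubes nor the tests performed.
\<close>

definition pv_loop :: "nat \<Rightarrow> horner \<Rightarrow> dcube \<Rightarrow> (dcube list \<times> nat) option" where
  "pv_loop n p I =
     (let g = h_grad_prod n p in
      map_option (\<lambda>((todo, fin), t). (fin, t))
        (while_option (\<lambda>((todo, fin), t). todo \<noteq> [])
           (\<lambda>(s, t). (pv_process p g s, t + T_pv_process p g s))
           (([I], []), T_h_grad_prod n p)))"

definition modified_pv :: "nat \<Rightarrow> int mpoly \<Rightarrow> int list \<Rightarrow> int \<Rightarrow> (dcube list \<times> nat) option" where
  "modified_pv n f a w =
     pv_loop n (dense f (total_degree f) 0 [0..<n]) (map dy_of_int a, dy_of_int w)"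

end

theory Submission
  imports Defs "HOL-Analysis.Function_Topology" "Jordan_Normal_Form.Char_Poly"
begin

text \<open>
  The factor \<open>2\<^bsup>O(\<dots>)\<^esup>\<close> of the bound absorbs every cost that is polynomial in the number of processed
  cubes, so what matters is the depth of the subdivision. If both tests reject a cube of width \<open>v\<close>,
  then at its midpoint \<open>Q = f\<^sup>2 + \<bar>\<nabla>f\<bar>\<^sup>2\<close> is at most \<open>v\<close> times a constant of size \<open>2\<^bsup>O(nd(d + \<tau>))\<^esup>\<close>,
  while \<open>Q\<close> is positive because the real zero set is smooth. It remains to bound the minimum of \<open>Q\<close> on
  the initial cube from below.

  Adding \<open>(x\<^sub>0\<^bsup>D+2\<^esup> + \<dots>) / (s (D + 2))\<close> to \<open>Q\<close>, where \<open>D = 2 d\<close>, gives a minimizer at which every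
  \<open>x\<^sub>i\<close> is an integer or satisfies \<open>x\<^sub>i\<^bsup>D+1\<^esup> = - s \<partial>\<^sub>iQ\<close>. These relations express all monomials by the
  at most \<open>(D + 1)\<^sup>n\<close> ones with exponents at most \<open>D\<close>, with coefficients in \<open>\<int>[s]\<close>, so that the value of \<open>Q\<close> is
  a root of the characteristic polynomial of a matrix over \<open>\<int>[s]\<close>. As \<open>s \<rightarrow> \<infinity>\<close> these values
  tend to the minimum, which is therefore a root of the integer polynomial formed by the top
  coefficients in \<open>s\<close>; and a positive root of an integer polynomial is at least the inverse of the sum
  of the absolute values of its coefficients.
\<close>

section \<open>Polynomials as finitely supported maps\<close>

text \<open>The obstacle is that \<open>Q\<close> may attain its minimum on an infinite set, so that
  vanishing partial derivatives alone need not define a finite-dimensional quotient ring. After the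
  perturbation every relation has a pure power of one variable on the left and only terms of smaller
  degree on the right. Hence rewriting terminates, whatever the shape of \<open>f\<close>. How close
  a perturbed minimum is to the true one never has to be estimated; only the limit counts. The
  characteristic polynomial has coefficient norm at most \<open>(N * B) ^ N\<close> with
  \<open>N = (2 * d + 1) ^ n\<close>, where \<open>B\<close> has \<open>O(n^2 * d * t)\<close> bits
  and \<open>t\<close> stands for \<open>d\<close> plus the bit-size of the input. So a constant
  times \<open>n^2 * d * N * t\<close> is a depth \<open>L\<close> at which every cube is accepted.
  At most \<open>2 ^ ((n + 1) * L)\<close> cubes are then processed, which explains the
  \<open>n^3\<close> in the exponent, and \<open>(2 * d + 1) ^ n \<le> (4 * d) ^ n\<close> stays far
  below \<open>2 ^ (24 * n) * d ^ (12 * n)\<close>. This room is the reason why numerical constants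
  are nowhere optimized.\<close>

abbreviation coef :: "('a \<Rightarrow>\<^sub>0 'b::zero) \<Rightarrow> 'a \<Rightarrow> 'b" where "coef \<equiv> Poly_Mapping.lookup"
abbreviation supp :: "('a \<Rightarrow>\<^sub>0 'b::zero) \<Rightarrow> 'a set" where "supp \<equiv> Poly_Mapping.keys"
abbreviation sgl :: "'a \<Rightarrow> 'b \<Rightarrow> ('a \<Rightarrow>\<^sub>0 'b::zero)" where "sgl \<equiv> Poly_Mapping.single"

definition mpow :: "(nat \<Rightarrow> 'b::comm_semiring_1) \<Rightarrow> (nat \<Rightarrow>\<^sub>0 nat) \<Rightarrow> 'b" where
  "mpow x \<alpha> = (\<Prod>i\<in>supp \<alpha>. x i ^ coef \<alpha> i)"

text \<open>The coefficient map \<open>\<phi>\<close> makes this serve several purposes: evaluation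
  at a point (identity or \<open>real_of_int\<close>), substitution of polynomials for the variables
  (\<open>Cst\<close>), and evaluation of coefficients from \<open>\<int>[s]\<close> at a real
  \<open>s\<close> (\<open>zev s\<close>). All these maps are semiring homomorphisms, so the
  evaluation laws are proved once.\<close>

definition subst :: "('a::zero \<Rightarrow> 'b::comm_semiring_1) \<Rightarrow> (nat \<Rightarrow> 'b) \<Rightarrow> 'a mpoly \<Rightarrow> 'b" where
  "subst \<phi> x F = (\<Sum>\<alpha>\<in>supp F. \<phi> (coef F \<alpha>) * mpow x \<alpha>)"

abbreviation Cst :: "'a::zero \<Rightarrow> 'a mpoly" where "Cst \<equiv> sgl 0"
definition Var :: "nat \<Rightarrow> 'a::comm_semiring_1 mpoly" where "Var i = sgl (sgl i (Suc 0)) 1"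

lemma Var_mult_single: "Var i * sgl \<alpha> c = sgl (\<alpha> + sgl i (Suc 0)) c"
  by (simp add: Var_def mult_single add.commute)

lemma poly_mapping_sum_single: "F = (\<Sum>\<alpha>\<in>supp F. sgl \<alpha> (coef F \<alpha>))"
  by (rule poly_mapping_eqI) (simp add: lookup_sum lookup_single when_def in_keys_iff)

lemma mpow_superset:
  assumes "finite S" "supp \<alpha> \<subseteq> S"
  shows "mpow x \<alpha> = (\<Prod>i\<in>S. x i ^ coef \<alpha> i)"
  unfolding mpow_def by (rule prod.mono_neutral_left) (use assms in \<open>auto simp: in_keys_iff\<close>)

lemma mpow_0 [simp]: "mpow x 0 = 1"
  by (simp add: mpow_def)

lemma mpow_add: "mpow x (\<alpha> + \<beta>) = mpow x \<alpha> * mpow x \<beta>"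
proof -
  let ?S = "supp \<alpha> \<union> supp \<beta>"
  have "mpow x (\<alpha> + \<beta>) = (\<Prod>i\<in>?S. x i ^ coef (\<alpha> + \<beta>) i)"
    by (rule mpow_superset) (auto simp: keys_add)
  also have "\<dots> = (\<Prod>i\<in>?S. x i ^ coef \<alpha> i) * (\<Prod>i\<in>?S. x i ^ coef \<beta> i)"
    by (simp add: lookup_add power_add prod.distrib)
  finally show ?thesis
    by (simp flip: mpow_superset)
qed

lemma mpow_single [simp]: "mpow x (sgl i k) = x i ^ k"
  by (cases "k = 0") (simp_all add: mpow_def)

lemma mpow_cong: "(\<And>i. i \<in> supp \<alpha> \<Longrightarrow> x i = y i) \<Longrightarrow> mpow x \<alpha> = mpow y \<alpha>"
  by (auto simp: mpow_def intro!: prod.cong)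

lemma mdeg_superset: "finite S \<Longrightarrow> supp \<alpha> \<subseteq> S \<Longrightarrow> mdeg \<alpha> = (\<Sum>i\<in>S. coef \<alpha> i)"
  unfolding mdeg_def by (rule sum.mono_neutral_left) (auto simp: in_keys_iff)

lemma mdeg_add: "mdeg (\<alpha> + \<beta>) = mdeg \<alpha> + mdeg \<beta>"
proof -
  let ?S = "supp \<alpha> \<union> supp \<beta>"
  have "mdeg (\<alpha> + \<beta>) = (\<Sum>i\<in>?S. coef (\<alpha> + \<beta>) i)"
    by (rule mdeg_superset) (auto simp: keys_add)
  also have "\<dots> = (\<Sum>i\<in>?S. coef \<alpha> i) + (\<Sum>i\<in>?S. coef \<beta> i)"
    by (simp add: lookup_add sum.distrib)
  finally show ?thesis
    by (simp flip: mdeg_superset)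
qed

lemma mdeg_0 [simp]: "mdeg 0 = 0"
  by (simp add: mdeg_def)

lemma mdeg_single [simp]: "mdeg (sgl i k) = k"
  by (cases "k = 0") (simp_all add: mdeg_def)

lemma mdeg_eq_0_iff [simp]: "mdeg \<alpha> = 0 \<longleftrightarrow> \<alpha> = 0"
proof
  assume "mdeg \<alpha> = 0"
  then have "\<forall>i\<in>supp \<alpha>. coef \<alpha> i = 0"
    by (simp add: mdeg_def)
  then show "\<alpha> = 0"
    by (intro poly_mapping_eqI) (metis in_keys_iff lookup_zero)
qed simp

lemma coef_le_mdeg: "coef \<alpha> i \<le> mdeg \<alpha>"
proof (cases "i \<in> supp \<alpha>")
  case True
  then show ?thesis
    unfolding mdeg_def by (intro member_le_sum) auto
qed (simp add: in_keys_iff)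

lemma minus_single_add:
  fixes \<alpha> :: "nat \<Rightarrow>\<^sub>0 nat"
  assumes "k \<le> coef \<alpha> i"
  shows "\<alpha> - sgl i k + sgl i k = \<alpha>"
  by (rule poly_mapping_eqI) (use assms in \<open>auto simp: lookup_add lookup_minus lookup_single when_def\<close>)

lemma mdeg_minus_single: "k \<le> coef \<alpha> i \<Longrightarrow> mdeg (\<alpha> - sgl i k) = mdeg \<alpha> - k"
  using mdeg_add[of "\<alpha> - sgl i k" "sgl i k"] by (simp add: minus_single_add)

lemma monomial_induct [case_names zero var]:
  assumes "P 0" "\<And>i \<alpha>. P \<alpha> \<Longrightarrow> P (\<alpha> + sgl i (Suc 0))"
  shows "P (\<alpha> :: nat \<Rightarrow>\<^sub>0 nat)"
proof (induction "mdeg \<alpha>" arbitrary: \<alpha>)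
  case 0
  then show ?case
    using assms(1) by simp
next
  case (Suc k)
  then have "supp \<alpha> \<noteq> {}"
    by (auto simp: mdeg_def)
  then obtain i where "i \<in> supp \<alpha>"
    by blast
  then have i: "Suc 0 \<le> coef \<alpha> i"
    by (simp add: in_keys_iff)
  have "P (\<alpha> - sgl i (Suc 0))"
    using Suc(2) i by (intro Suc(1)) (simp add: mdeg_minus_single)
  then have "P (\<alpha> - sgl i (Suc 0) + sgl i (Suc 0))"
    by (rule assms(2))
  then show ?case
    by (simp only: minus_single_add[OF i])
qed

text \<open>Constants, sums and multiplication by one variable generate all polynomials. An identity
  between additive operations such as \<open>pd\<close>, \<open>shift\<close> and evaluation is
  thereby reduced to their rules for \<open>Var i * F\<close>.\<close>

lemma mpoly_induct [case_names const add var]: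
  assumes "\<And>c. P (Cst c)" "\<And>F G. P F \<Longrightarrow> P G \<Longrightarrow> P (F + G)" "\<And>i F. P F \<Longrightarrow> P (Var i * F)"
  shows "P (F :: 'a::comm_semiring_1 mpoly)"
proof -
  have single: "P (sgl \<alpha> c)" for \<alpha> c
  proof (induction \<alpha> rule: monomial_induct)
    case (var i \<alpha>)
    then have "P (Var i * sgl \<alpha> c)"
      by (rule assms(3))
    then show ?case
      by (simp add: Var_mult_single)
  qed (rule assms(1))
  have "P (\<Sum>\<alpha>\<in>S. sgl \<alpha> (coef F \<alpha>))" if "finite S" for S
    using that by induction (use assms(1)[of 0] in \<open>auto intro: assms(2) single\<close>)
  from this[of "supp F"] show ?thesis
    by (simp flip: poly_mapping_sum_single)
qed

context comm_semiring_hom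
begin

lemma subst_superset:
  "finite S \<Longrightarrow> supp F \<subseteq> S \<Longrightarrow> subst hom x F = (\<Sum>\<alpha>\<in>S. hom (coef F \<alpha>) * mpow x \<alpha>)"
  unfolding subst_def by (rule sum.mono_neutral_left) (auto simp: in_keys_iff)

lemma subst_0 [simp]: "subst hom x 0 = 0"
  by (simp add: subst_def)

lemma subst_add: "subst hom x (F + G) = subst hom x F + subst hom x G"
proof -
  let ?S = "supp F \<union> supp G"
  have "subst hom x (F + G) = (\<Sum>\<alpha>\<in>?S. hom (coef (F + G) \<alpha>) * mpow x \<alpha>)"
    by (rule subst_superset) (auto simp: keys_add)
  also have "\<dots> = (\<Sum>\<alpha>\<in>?S. hom (coef F \<alpha>) * mpow x \<alpha>) + (\<Sum>\<alpha>\<in>?S. hom (coef G \<alpha>) * mpow x \<alpha>)"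
    by (simp add: lookup_add hom_add distrib_right sum.distrib)
  finally show ?thesis
    by (simp flip: subst_superset)
qed

lemma subst_single [simp]: "subst hom x (sgl \<alpha> c) = hom c * mpow x \<alpha>"
  by (cases "c = 0") (simp_all add: subst_def)

lemma subst_Var [simp]: "subst hom x (Var i) = x i"
  by (simp add: Var_def)

lemma subst_sum: "subst hom x (sum F S) = (\<Sum>s\<in>S. subst hom x (F s))"
  by (induction S rule: infinite_finite_induct) (simp_all add: subst_add)

lemma subst_mult: "subst hom x (F * G) = subst hom x F * subst hom x G"
proof -
  have single: "subst hom x (sgl \<alpha> c * G) = subst hom x (sgl \<alpha> c) * subst hom x G" for \<alpha> c
  proof -
    have "sgl \<alpha> c * G = sgl \<alpha> c * (\<Sum>\<beta>\<in>supp G. sgl \<beta> (coef G \<beta>))"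
      by (simp flip: poly_mapping_sum_single)
    also have "\<dots> = (\<Sum>\<beta>\<in>supp G. sgl (\<alpha> + \<beta>) (c * coef G \<beta>))"
      by (simp add: sum_distrib_left mult_single)
    finally have "subst hom x (sgl \<alpha> c * G) = (\<Sum>\<beta>\<in>supp G. hom (c * coef G \<beta>) * mpow x (\<alpha> + \<beta>))"
      by (simp add: subst_sum)
    then show ?thesis
      by (simp add: subst_def[of _ _ G] sum_distrib_left hom_mult mpow_add mult_ac)
  qed
  have "F * G = (\<Sum>\<alpha>\<in>supp F. sgl \<alpha> (coef F \<alpha>)) * G"
    by (simp flip: poly_mapping_sum_single)
  then have "subst hom x (F * G) = (\<Sum>\<alpha>\<in>supp F. subst hom x (sgl \<alpha> (coef F \<alpha>) * G))"
    by (simp add: sum_distrib_right subst_sum)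
  also have "\<dots> = subst hom x F * subst hom x G"
    by (simp add: single subst_def[of _ _ F] sum_distrib_right)
  finally show ?thesis .
qed

lemma subst_cong:
  "(\<And>i. i \<in> mvars F \<Longrightarrow> x i = y i) \<Longrightarrow> subst hom x F = subst hom y F"
  unfolding subst_def
  by (intro sum.cong arg_cong[where f = "(*) _"] mpow_cong refl) (auto simp: mvars_def)

end

lemma comm_semiring_hom_ident: "comm_semiring_hom (\<lambda>x :: 'a::comm_semiring_1. x)"
  by standard simp_all

lemma comm_semiring_hom_Cst: "comm_semiring_hom (Cst :: 'a::comm_semiring_1 \<Rightarrow> 'a mpoly)"
  by standard (simp_all add: single_add mult_single)

lemmas subst_ident_simps [simp] =
  comm_semiring_hom.subst_0[OF comm_semiring_hom_ident]
  comm_semiring_hom.subst_single[OF comm_semiring_hom_ident]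
  comm_semiring_hom.subst_add[OF comm_semiring_hom_ident]
  comm_semiring_hom.subst_Var[OF comm_semiring_hom_ident]
  comm_semiring_hom.subst_mult[OF comm_semiring_hom_ident]

lemmas subst_Cst_simps [simp] =
  comm_semiring_hom.subst_0[OF comm_semiring_hom_Cst]
  comm_semiring_hom.subst_single[OF comm_semiring_hom_Cst]
  comm_semiring_hom.subst_add[OF comm_semiring_hom_Cst]
  comm_semiring_hom.subst_Var[OF comm_semiring_hom_Cst]
  comm_semiring_hom.subst_mult[OF comm_semiring_hom_Cst]

lemma peval_eq_subst: "peval F x = subst (\<lambda>c. c) (\<lambda>i. x ! i) F"
  by (simp add: peval_def subst_def mpow_def)

lemma coef_real_mpoly [simp]: "coef (real_mpoly f) \<alpha> = real_of_int (coef f \<alpha>)"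
  by (simp add: real_mpoly_def Poly_Mapping.map.rep_eq when_def)

lemma supp_real_mpoly [simp]: "supp (real_mpoly f) = supp f"
  by (auto simp: in_keys_iff)

section \<open>Partial derivatives, shifts and Taylor coefficients\<close>

lemma coef_Var_mult:
  "coef (Var i * F) \<alpha> = (if 0 < coef \<alpha> i then coef F (\<alpha> - sgl i (Suc 0)) else 0)"
proof -
  have "Var i * F = Var i * (\<Sum>\<beta>\<in>supp F. sgl \<beta> (coef F \<beta>))"
    by (simp flip: poly_mapping_sum_single)
  also have "\<dots> = (\<Sum>\<beta>\<in>supp F. sgl (\<beta> + sgl i (Suc 0)) (coef F \<beta>))"
    by (simp add: sum_distrib_left Var_mult_single)
  finally have *: "coef (Var i * F) \<alpha> = (\<Sum>\<beta>\<in>supp F. if \<beta> + sgl i (Suc 0) = \<alpha> then coef F \<beta> else 0)"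
    by (simp add: lookup_sum lookup_single when_def)
  show ?thesis
  proof (cases "0 < coef \<alpha> i")
    case True
    have "\<beta> + sgl i (Suc 0) = \<alpha> \<longleftrightarrow> \<beta> = \<alpha> - sgl i (Suc 0)" for \<beta>
      using minus_single_add[of "Suc 0" \<alpha> i] True by auto
    then show ?thesis
      using True * by (simp add: in_keys_iff)
  next
    case False
    then have "\<beta> + sgl i (Suc 0) \<noteq> \<alpha>" for \<beta>
      by (auto simp: lookup_add)
    then show ?thesis
      using False * by simp
  qed
qed

lemma coef_pd: "coef (pd i F) \<alpha> = of_nat (Suc (coef \<alpha> i)) * coef F (\<alpha> + sgl i (Suc 0))"
proof -
  have "coef (pd i F) \<alpha> =
      (\<Sum>\<beta>\<in>supp F. if \<beta> - sgl i (Suc 0) = \<alpha> then of_nat (coef \<beta> i) * coef F \<beta> else 0)"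
    by (simp add: pd_def lookup_sum lookup_single when_def)
  also have "\<dots> = (\<Sum>\<beta>\<in>supp F. if \<beta> = \<alpha> + sgl i (Suc 0) then of_nat (coef \<beta> i) * coef F \<beta> else 0)"
  proof (rule sum.cong[OF refl])
    fix \<beta>
    show "(if \<beta> - sgl i (Suc 0) = \<alpha> then of_nat (coef \<beta> i) * coef F \<beta> else 0) =
      (if \<beta> = \<alpha> + sgl i (Suc 0) then of_nat (coef \<beta> i) * coef F \<beta> else 0)"
    proof (cases "coef \<beta> i = 0")
      case False
      then show ?thesis
        using minus_single_add[of "Suc 0" \<beta> i] by (metis Suc_leI add_diff_cancel_right' neq0_conv)
    qed auto
  qed
  also have "\<dots> = of_nat (Suc (coef \<alpha> i)) * coef F (\<alpha> + sgl i (Suc 0))"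
    by (simp add: in_keys_iff lookup_add)
  finally show ?thesis .
qed

lemma pd_add: "pd i (F + G) = pd i F + pd i G"
  by (rule poly_mapping_eqI) (simp add: coef_pd lookup_add distrib_left)

lemma pd_0 [simp]: "pd i 0 = 0"
  by (simp add: pd_def)

lemma pd_Cst [simp]: "pd i (Cst c) = 0"
proof (rule poly_mapping_eqI)
  fix \<alpha> :: "nat \<Rightarrow>\<^sub>0 nat"
  have "\<alpha> + sgl i (Suc 0) \<noteq> 0"
    by (auto simp: lookup_add dest: arg_cong[where f = "\<lambda>\<gamma>. coef \<gamma> i"])
  then have "coef (Cst c) (\<alpha> + sgl i (Suc 0)) = 0"
    by (simp add: lookup_single_not_eq)
  then show "coef (pd i (Cst c)) \<alpha> = coef 0 \<alpha>"
    by (simp add: coef_pd)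
qed

lemma pd_Var_mult: "pd i (Var j * F) = (if i = j then F else 0) + Var j * pd i F"
proof (rule poly_mapping_eqI)
  fix \<alpha> :: "nat \<Rightarrow>\<^sub>0 nat"
  show "coef (pd i (Var j * F)) \<alpha> = coef ((if i = j then F else 0) + Var j * pd i F) \<alpha>"
  proof (cases "i = j")
    case [simp]: True
    show ?thesis
    proof (cases "0 < coef \<alpha> i")
      case True
      then show ?thesis
        by (simp add: coef_pd coef_Var_mult lookup_add lookup_minus minus_single_add distrib_right)
    qed (simp add: coef_pd coef_Var_mult lookup_add)
  next
    case False
    have "\<alpha> + sgl i (Suc 0) - sgl j (Suc 0) = \<alpha> - sgl j (Suc 0) + sgl i (Suc 0)" if "0 < coef \<alpha> j"
      by (rule poly_mapping_eqI)
        (use False that in \<open>auto simp: lookup_add lookup_minus lookup_single when_def\<close>)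
    with False show ?thesis
      by (simp add: coef_pd coef_Var_mult lookup_add lookup_minus lookup_single_not_eq)
  qed
qed

lemma pd_Cst_mult: "pd i (Cst c * F) = Cst c * pd i F"
proof (induction F rule: mpoly_induct)
  case (var j F)
  have "Cst c * (Var j * F) = Var j * (Cst c * F)"
    by (simp add: mult_ac)
  then show ?case
    by (simp only: pd_Var_mult var) (simp add: algebra_simps)
qed (simp_all add: mult_single pd_add distrib_left)

definition shift :: "(nat \<Rightarrow> 'a::comm_semiring_1) \<Rightarrow> 'a mpoly \<Rightarrow> 'a mpoly" where
  "shift m = subst Cst (\<lambda>i. Var i + Cst (m i))"

lemma shift_simps [simp]:
  "shift m 0 = 0" "shift m (F + G) = shift m F + shift m G" "shift m (F * G) = shift m F * shift m G"
  "shift m (Cst c) = Cst c" "shift m (Var i) = Var i + Cst (m i)"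
  unfolding shift_def by simp_all

lemma pd_shift: "pd i (shift m F) = shift m (pd i F)"
proof (induction F rule: mpoly_induct)
  case (var j F)
  have "pd i (shift m (Var j * F)) = pd i (Var j * shift m F) + pd i (Cst (m j) * shift m F)"
    by (simp add: pd_add distrib_right)
  then show ?case
    by (simp add: var pd_Var_mult pd_Cst_mult distrib_right add.assoc)
qed (simp_all add: pd_add)

lemma coef_mult_0:
  fixes F G :: "'a::comm_semiring_1 mpoly"
  shows "coef (F * G) 0 = coef F 0 * coef G 0"
proof (induction F rule: mpoly_induct)
  case (const c)
  show ?case
  proof (induction G rule: mpoly_induct)
    case (var j F)
    have "Cst c * (Var j * F) = Var j * (Cst c * F)"
      by (simp add: mult_ac)
    then show ?case
      by (simp only: coef_Var_mult) simp
  qed (simp_all add: mult_single lookup_add distrib_left)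
next
  case (var j F)
  have "Var j * F * G = Var j * (F * G)"
    by (simp add: mult_ac)
  then show ?case
    by (simp only: coef_Var_mult) simp
qed (simp_all add: lookup_add distrib_right)

lemma coef_shift_0:
  fixes F :: "'a::comm_semiring_1 mpoly"
  shows "coef (shift (\<lambda>i. x ! i) F) 0 = peval F x"
  unfolding peval_eq_subst
proof (induction F rule: mpoly_induct)
  case (var i F)
  have "coef (Var i * Cst 1 :: 'a mpoly) 0 = 0" for i
    by (simp only: coef_Var_mult) simp
  with var show ?case
    by (simp add: coef_mult_0 lookup_add)
qed (simp_all add: lookup_add)

lemma coef_pd_power:
  "coef ((pd i ^^ k) F) \<alpha> = of_nat (\<Prod>j=1..k. coef \<alpha> i + j) * coef F (\<alpha> + sgl i k)"
proof (induction k arbitrary: \<alpha>)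
  case (Suc k)
  have "\<alpha> + sgl i (Suc 0) + sgl i k = \<alpha> + sgl i (Suc k)"
    by (simp add: add.assoc flip: single_add)
  moreover have "(\<Prod>j=1..Suc k. coef \<alpha> i + j) = Suc (coef \<alpha> i) * (\<Prod>j=1..k. coef (\<alpha> + sgl i (Suc 0)) i + j)"
    by (simp add: lookup_add prod.atLeast_Suc_atMost prod.shift_bounds_cl_Suc_ivl del: prod.cl_ivl_Suc)
  ultimately show ?case
    by (simp only: funpow.simps comp_apply coef_pd Suc of_nat_mult) (simp add: algebra_simps)
qed simp

text \<open>Differentiating \<open>k\<close> times in a variable with exponent \<open>0\<close> in
  the resulting monomial gives the factor \<open>k!\<close>. Distinctness ensures that the exponents
  contributed by the other variables leave this one at \<open>0\<close>.\<close>

lemma coef_fold_pd: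
  assumes "distinct is" "\<And>i. i \<in> set is \<Longrightarrow> coef \<beta> i = 0"
  shows "coef (fold (\<lambda>i. pd i ^^ coef \<alpha> i) is F) \<beta> =
    of_nat (\<Prod>i\<in>set is. fact (coef \<alpha> i)) * coef F (\<beta> + (\<Sum>i\<in>set is. sgl i (coef \<alpha> i)))"
  using assms
proof (induction "is" arbitrary: F)
  case (Cons i "is")
  let ?\<gamma> = "\<Sum>j\<in>set is. sgl j (coef \<alpha> j)"
  have "coef ?\<gamma> i = 0"
    using Cons.prems(1) by (auto simp: lookup_sum lookup_single when_def)
  then have "coef (\<beta> + ?\<gamma>) i = 0"
    using Cons.prems(2) by (simp add: lookup_add)
  then have "coef ((pd i ^^ coef \<alpha> i) F) (\<beta> + ?\<gamma>) =
      of_nat (fact (coef \<alpha> i)) * coef F (\<beta> + ?\<gamma> + sgl i (coef \<alpha> i))"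
    by (simp only: coef_pd_power) (simp add: fact_prod)
  with Cons show ?case
    by (simp add: algebra_simps)
qed simp

lemma coef_mixed_pd_0: "coef (mixed_pd \<alpha> F) 0 = of_nat (mfact \<alpha>) * coef F \<alpha>"
  unfolding mixed_pd_def mfact_def
  by (subst coef_fold_pd) (simp_all flip: poly_mapping_sum_single)

lemma mixed_pd_shift: "mixed_pd \<alpha> (shift m F) = shift m (mixed_pd \<alpha> F)"
proof -
  have *: "(pd i ^^ k) (shift m F) = shift m ((pd i ^^ k) F)" for i k F
    by (induction k) (simp_all add: pd_shift)
  have "fold (\<lambda>i. pd i ^^ coef \<alpha> i) is (shift m F) = shift m (fold (\<lambda>i. pd i ^^ coef \<alpha> i) is F)" for "is"
    by (induction "is" arbitrary: F) (simp_all add: *)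
  then show ?thesis
    by (simp add: mixed_pd_def)
qed

text \<open>Derivatives commute with the shift, so the derivative at \<open>x\<close> is that of the
  shifted polynomial at the origin, where only the monomial \<open>\<alpha>\<close> survives. This
  links the centered form, which is defined by derivatives, with the program, which computes a
  Taylor shift.\<close>

theorem taylor_coefficient:
  "peval (mixed_pd \<alpha> F) x = of_nat (mfact \<alpha>) * coef (shift (\<lambda>i. x ! i) F) \<alpha>"
  by (simp flip: coef_shift_0 mixed_pd_shift add: coef_mixed_pd_0)

lemma mfact_pos: "0 < mfact \<alpha>"
  unfolding mfact_def by (intro prod_pos) auto

section \<open>Degree bounds and sets of occurring variables\<close>

definition deg_le :: "nat \<Rightarrow> 'a::zero mpoly \<Rightarrow> bool" where
  "deg_le D F \<longleftrightarrow> (\<forall>\<alpha>\<in>supp F. mdeg \<alpha> \<le> D)"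

lemma supp_mult_subset: "\<gamma> \<in> supp (F * G) \<Longrightarrow> \<exists>\<alpha>\<in>supp F. \<exists>\<beta>\<in>supp G. \<gamma> = \<alpha> + (\<beta> :: nat \<Rightarrow>\<^sub>0 nat)"
  using keys_mult[of F G] by blast

lemma deg_le_intros:
  "deg_le D 0" "deg_le D (Cst c)" "deg_le D F \<Longrightarrow> deg_le D G \<Longrightarrow> deg_le D (F + G)"
  "deg_le D F \<Longrightarrow> deg_le E G \<Longrightarrow> deg_le (D + E) (F * G)"
proof -
  show "deg_le D F \<Longrightarrow> deg_le D G \<Longrightarrow> deg_le D (F + G)"
    using keys_add[of F G] by (auto simp: deg_le_def)
  show "deg_le D F \<Longrightarrow> deg_le E G \<Longrightarrow> deg_le (D + E) (F * G)"
    unfolding deg_le_def by (force dest!: supp_mult_subset simp: mdeg_add intro: add_mono)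
qed (auto simp: deg_le_def split: if_splits)

lemma deg_le_sum:
  fixes F :: "_ \<Rightarrow> 'a::semiring_0 mpoly"
  shows "(\<And>s. s \<in> S \<Longrightarrow> deg_le D (F s)) \<Longrightarrow> deg_le D (sum F S)"
  by (induction S rule: infinite_finite_induct) (simp_all add: deg_le_intros)

lemma deg_le_pd: "deg_le D F \<Longrightarrow> deg_le (D - 1) (pd i F)"
proof (unfold deg_le_def, safe)
  fix \<alpha> assume D: "\<forall>\<alpha>\<in>supp F. mdeg \<alpha> \<le> D" and "\<alpha> \<in> supp (pd i F)"
  then have "coef F (\<alpha> + sgl i (Suc 0)) \<noteq> 0"
    by (auto simp: in_keys_iff coef_pd)
  then have "mdeg (\<alpha> + sgl i (Suc 0)) \<le> D"
    using D by (auto simp: in_keys_iff)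
  then show "mdeg \<alpha> \<le> D - 1"
    by (simp add: mdeg_add)
qed

lemma mdeg_le_total_degree: "\<alpha> \<in> supp F \<Longrightarrow> mdeg \<alpha> \<le> total_degree F"
  unfolding total_degree_def by (intro Max_ge) auto

lemma deg_le_total_degree: "deg_le (total_degree F) F"
  by (simp add: deg_le_def mdeg_le_total_degree)

lemma deg_le_mpow:
  fixes y :: "nat \<Rightarrow> 'a::comm_semiring_1 mpoly"
  assumes "\<And>i. deg_le 1 (y i)"
  shows "deg_le (mdeg \<alpha>) (mpow y \<alpha>)"
proof (induction \<alpha> rule: monomial_induct)
  case zero
  then show ?case
    using deg_le_intros(2)[of 0 "1 :: 'a"] by (simp only: single_one mpow_0 mdeg_0)
next
  case (var i \<alpha>)
  then show ?case
    using deg_le_intros(4)[OF var assms[of i]] by (simp add: mpow_add mdeg_add)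
qed

lemma deg_le_mono: "deg_le D F \<Longrightarrow> D \<le> E \<Longrightarrow> deg_le E F"
  by (auto simp: deg_le_def)

lemma deg_le_shift:
  assumes "deg_le D F"
  shows "deg_le D (shift m F)"
  unfolding shift_def subst_def
proof (rule deg_le_sum)
  fix \<alpha> assume \<alpha>: "\<alpha> \<in> supp F"
  have *: "deg_le 1 (Var i + Cst (m i))" for i
    by (intro deg_le_intros) (simp add: deg_le_def Var_def)
  have "deg_le (0 + mdeg \<alpha>) (Cst (coef F \<alpha>) * mpow (\<lambda>i. Var i + Cst (m i)) \<alpha>)"
    by (rule deg_le_intros(4)[OF deg_le_intros(2) deg_le_mpow[OF *]])
  then show "deg_le D (Cst (coef F \<alpha>) * mpow (\<lambda>i. Var i + Cst (m i)) \<alpha>)"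
    by (rule deg_le_mono) (use assms \<alpha> in \<open>simp add: deg_le_def\<close>)
qed

lemma mvars_add: "mvars (F + G) \<subseteq> mvars F \<union> mvars G"
  using keys_add[of F G] by (auto simp: mvars_def)

lemma mvars_mult: "mvars (F * G) \<subseteq> mvars F \<union> mvars G"
  unfolding mvars_def using keys_add by (fastforce dest!: supp_mult_subset)

lemma mvars_0 [simp]: "mvars 0 = {}"
  by (simp add: mvars_def)

lemma mvars_Cst [simp]: "mvars (Cst c) = {}"
  by (simp add: mvars_def)

lemma mvars_Var [simp]: "mvars (Var i :: 'a::comm_semiring_1 mpoly) = {i}"
  by (simp add: mvars_def Var_def)

lemma mvars_sum: "mvars (sum F S) \<subseteq> (\<Union>s\<in>S. mvars (F s))"
proof (induction S rule: infinite_finite_induct)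
  case (insert s S)
  then show ?case
    using mvars_add[of "F s" "sum F S"] by auto
qed auto

lemma mvars_pd: "mvars (pd i F) \<subseteq> mvars F"
proof
  fix j assume "j \<in> mvars (pd i F)"
  then obtain \<alpha> where "\<alpha> \<in> supp (pd i F)" "coef \<alpha> j \<noteq> 0"
    by (auto simp: mvars_def in_keys_iff)
  then have "\<alpha> + sgl i (Suc 0) \<in> supp F" "coef (\<alpha> + sgl i (Suc 0)) j \<noteq> 0"
    by (auto simp: in_keys_iff coef_pd lookup_add)
  then show "j \<in> mvars F"
    unfolding mvars_def by (metis UN_I in_keys_iff)
qed

section \<open>The arithmetic of the program\<close>

abbreviation bval :: "bool list \<Rightarrow> nat" where "bval \<equiv> horner_sum of_bool 2"

lemma bval_bit_add: "bval (bit_add c xs ys) = of_bool c + bval xs + bval ys"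
  by (induction c xs ys rule: bit_add.induct) auto

lemma bval_bit_sub:
  "of_bool c + bval ys \<le> bval xs \<Longrightarrow> bval (bit_sub c xs ys) + of_bool c + bval ys = bval xs"
proof (induction c xs ys rule: bit_sub.induct)
  case (3 c x xs y ys)
  then show ?case
    by (cases x; cases y; cases c) simp_all
qed (auto split: if_splits)

lemma bit_less_iff:
  "bit_less c xs ys \<longleftrightarrow> bval xs < bval ys \<or> c \<and> bval xs = bval ys"
  by (induction c xs ys rule: bit_less.induct) (auto split: if_splits)

lemma bval_bit_mult: "bval (bit_mult xs ys) = bval xs * bval ys"
  by (induction xs) (simp_all add: bval_bit_add algebra_simps)

lemma bval_bits_of_nat: "bval (bits_of_nat k) = k"
  by (induction k rule: bits_of_nat.induct) (subst bits_of_nat.simps, auto)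

lemma align_correct:
  "align e e' xs ys = (xs', ys', k) \<Longrightarrow>
    k = max e e' \<and> bval xs' = bval xs * 2 ^ (k - e) \<and> bval ys' = bval ys * 2 ^ (k - e')"
  by (induction e e' xs ys arbitrary: xs' ys' k rule: align.induct) (auto split: prod.splits)

lemma add_exp_eq: "add_exp e e' = e + e'"
  by (induction e e' rule: add_exp.induct) auto

lemma of_nat_bval: "(horner_sum of_bool 2 xs :: real) = real (bval xs)"
  by (induction xs) auto

lemma dy_val_Dyadic: "dy_val (Dyadic s xs e) = (if s then - 1 else 1) * real (bval xs) / 2 ^ e"
  by (simp add: dy_val_def of_nat_bval)

lemma align_real:
  assumes "align e e' xs ys = (xs', ys', k)"
  shows "real (bval xs) / 2 ^ e = real (bval xs') / 2 ^ k"
    and "real (bval ys) / 2 ^ e' = real (bval ys') / 2 ^ k"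
proof -
  have *: "real a / 2 ^ e = real (a * 2 ^ (k - e)) / 2 ^ k" if "e \<le> k" for a e
    using that by (simp add: field_simps flip: power_add)
  show "real (bval xs) / 2 ^ e = real (bval xs') / 2 ^ k"
    "real (bval ys) / 2 ^ e' = real (bval ys') / 2 ^ k"
    using align_correct[OF assms] *[of e "bval xs"] *[of e' "bval ys"] by simp_all
qed

lemma dy_val_add [simp]: "dy_val (dy_add a b) = dy_val a + dy_val b"
proof (cases a; cases b)
  fix s xs e t ys e' assume ab: "a = Dyadic s xs e" "b = Dyadic t ys e'"
  obtain xs' ys' k where al: "align e e' xs ys = (xs', ys', k)"
    by (metis prod_cases3)
  have sub: "real (bval (bit_sub False us vs)) = real (bval us) - real (bval vs)" if "bval vs \<le> bval us" for us vs
    using bval_bit_sub[of False vs us] that by simp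
  show ?thesis
    using sub[of ys' xs'] sub[of xs' ys']
    by (auto simp: ab al dy_val_Dyadic align_real[OF al] bval_bit_add bit_less_iff diff_divide_distrib
        add_divide_distrib)
qed

lemma dy_val_mult [simp]: "dy_val (dy_mult a b) = dy_val a * dy_val b"
  by (cases a; cases b) (simp add: dy_val_Dyadic bval_bit_mult add_exp_eq power_add)

lemma dy_val_half [simp]: "dy_val (dy_half a) = dy_val a / 2"
  by (cases a) (simp add: dy_val_Dyadic)

lemma dy_val_abs [simp]: "dy_val (dy_abs a) = \<bar>dy_val a\<bar>"
  by (cases a) (simp add: dy_val_Dyadic)

lemma dy_abs_less_iff: "dy_abs_less a b \<longleftrightarrow> \<bar>dy_val a\<bar> < \<bar>dy_val b\<bar>"
proof (cases a; cases b)
  fix s xs e t ys e' assume ab: "a = Dyadic s xs e" "b = Dyadic t ys e'"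
  obtain xs' ys' k where al: "align e e' xs ys = (xs', ys', k)"
    by (metis prod_cases3)
  have "\<bar>dy_val a\<bar> = real (bval xs') / 2 ^ k" "\<bar>dy_val b\<bar> = real (bval ys') / 2 ^ k"
    by (simp_all add: ab dy_val_Dyadic align_real[OF al] abs_mult)
  then show ?thesis
    by (simp add: ab al bit_less_iff divide_less_cancel)
qed

lemma dy_val_of_int [simp]: "dy_val (dy_of_int z) = real_of_int z"
  by (simp add: dy_of_int_def dy_val_Dyadic bval_bits_of_nat)

lemma dy_val_Nil [simp]: "dy_val (Dyadic s [] e) = 0"
  by (simp add: dy_val_Dyadic)

subsection \<open>Horner representation\<close>

fun hpoly :: "nat \<Rightarrow> horner \<Rightarrow> real mpoly" where
  "hpoly i (Coeff a) = Cst (dy_val a)"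
| "hpoly i Zero = 0"
| "hpoly i (Horner p q) = hpoly (Suc i) p + Var i * hpoly i q"

text \<open>\<open>k\<close> is the number of variables left. Coefficients occur only for
  \<open>k = 0\<close>, so two terms other than \<open>Zero\<close> with the same \<open>k\<close>
  have the same outermost constructor, as \<open>h_add\<close> presupposes.\<close>

fun hwf :: "nat \<Rightarrow> horner \<Rightarrow> bool" where
  "hwf k (Coeff a) \<longleftrightarrow> k = 0"
| "hwf k Zero \<longleftrightarrow> True"
| "hwf 0 (Horner p q) \<longleftrightarrow> False"
| "hwf (Suc k) (Horner p q) \<longleftrightarrow> hwf k p \<and> hwf (Suc k) q"

lemma h_add_correct:
  "hwf k p \<Longrightarrow> hwf k q \<Longrightarrow> hwf k (h_add p q) \<and> hpoly i (h_add p q) = hpoly i p + hpoly i q"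
proof (induction p q arbitrary: k i rule: h_add.induct)
  case (3 p p' q q')
  then show ?case
    by (cases k) (auto simp: algebra_simps)
qed (auto simp: single_add elim: hwf.elims)

lemma h_smult_correct:
  "hwf k p \<Longrightarrow> hwf k (h_smult c p) \<and> hpoly i (h_smult c p) = Cst (dy_val c) * hpoly i p"
  by (induction p arbitrary: i rule: hwf.induct) (auto simp: mult_single algebra_simps)

lemma supp_hpoly:
  "hwf k p \<Longrightarrow> \<alpha> \<in> supp (hpoly i p) \<Longrightarrow> supp \<alpha> \<subseteq> {i..<i + k}"
proof (induction p arbitrary: i \<alpha> rule: hwf.induct)
  case (4 k p q)
  have "\<alpha> \<in> supp (hpoly (Suc i) p) \<or> \<alpha> \<in> supp (Var i * hpoly i q)"
    using 4(4) keys_add by fastforce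
  then show ?case
  proof
    assume "\<alpha> \<in> supp (hpoly (Suc i) p)"
    then show ?thesis
      using 4(1)[of \<alpha> "Suc i"] 4(3) by auto
  next
    assume "\<alpha> \<in> supp (Var i * hpoly i q)"
    then have \<alpha>: "0 < coef \<alpha> i" "\<alpha> - sgl i (Suc 0) \<in> supp (hpoly i q)"
      by (auto simp: in_keys_iff coef_Var_mult split: if_splits)
    then have "supp (\<alpha> - sgl i (Suc 0)) \<subseteq> {i..<i + Suc k}"
      using 4(2,3) by simp
    moreover have "supp \<alpha> \<subseteq> supp (\<alpha> - sgl i (Suc 0)) \<union> {i}"
      by (auto simp: in_keys_iff lookup_minus lookup_single when_def split: if_splits)
    ultimately show ?thesis
      by auto
  qed
qed (auto split: if_splits)

lemma pd_eq_0: "i \<notin> mvars F \<Longrightarrow> pd i F = 0"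
proof (rule poly_mapping_eqI)
  fix \<alpha> assume "i \<notin> mvars F"
  moreover have "i \<in> supp (\<alpha> + sgl i (Suc 0))"
    by (simp add: in_keys_iff lookup_add)
  ultimately have "coef F (\<alpha> + sgl i (Suc 0)) = 0"
    unfolding mvars_def by (meson UN_I in_keys_iff)
  then show "coef (pd i F) \<alpha> = coef 0 \<alpha>"
    by (simp add: coef_pd)
qed

lemma mvars_hpoly: "hwf k p \<Longrightarrow> mvars (hpoly i p) \<subseteq> {i..<i + k}"
  using supp_hpoly unfolding mvars_def by blast

text \<open>In \<open>p + x * q\<close> the part \<open>p\<close> is free of \<open>x\<close>, so
  the derivative by \<open>x\<close> is \<open>q + x * q'\<close>. Repeated additions thus produce
  the factors that come from the exponents.\<close>

lemma h_deriv_correct: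
  "hwf k p \<Longrightarrow> j < k \<Longrightarrow> hwf k (h_deriv j p) \<and> hpoly i (h_deriv j p) = pd (i + j) (hpoly i p)"
proof (induction j p arbitrary: k i rule: h_deriv.induct)
  case (3 p q)
  then obtain k' where k: "k = Suc k'"
    by (cases k) auto
  then have wf: "hwf k' p" "hwf k q"
    using 3(2) by auto
  have "pd i (hpoly (Suc i) p) = 0"
    using mvars_hpoly[OF wf(1), of "Suc i"] by (intro pd_eq_0) auto
  moreover have "hwf k (Horner Zero (h_deriv 0 q))"
    using 3(1)[OF wf(2)] k by auto
  note h_add_correct[OF wf(2) this, of i]
  ultimately show ?case
    using 3(1)[OF wf(2), of i] k by (simp add: pd_add pd_Var_mult)
next
  case (4 j p q)
  then obtain k' where k: "k = Suc k'"
    by (cases k) auto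
  then have wf: "hwf k' p" "hwf k q"
    using 4(3) by auto
  show ?case
    using 4(1)[OF wf(1), of "Suc i"] 4(2)[OF wf(2), of i] 4(4) k
    by (simp add: pd_add pd_Var_mult)
qed auto

lemma h_tensor_correct:
  "hwf k p \<Longrightarrow> hwf l q \<Longrightarrow>
    hwf (k + l) (h_tensor p q) \<and> hpoly i (h_tensor p q) = hpoly i p * hpoly (i + k) q"
proof (induction p arbitrary: i rule: hwf.induct)
  case (4 k p q')
  then show ?case
    by (auto simp: algebra_simps)
qed (use h_smult_correct[of l q] in auto)

lemma shift_vars_simps:
  "shift_vars n F = subst Cst (\<lambda>i. Var (n + i)) F"
proof -
  have *: "mpow (\<lambda>i. Var (n + i) :: 'a mpoly) \<alpha> = sgl (\<Sum>i\<in>supp \<alpha>. sgl (n + i) (coef \<alpha> i)) 1" for \<alpha>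
  proof -
    have "(Var j :: 'a mpoly) ^ k = sgl (sgl j k) 1" for j k
      by (induction k) (simp_all add: Var_mult_single add.commute flip: single_add)
    moreover have "(\<Prod>i\<in>S. sgl (f i) 1) = (sgl (\<Sum>i\<in>S. f i) 1 :: 'a mpoly)" for f :: "nat \<Rightarrow> nat \<Rightarrow>\<^sub>0 nat" and S
      by (induction S rule: infinite_finite_induct) (simp_all add: mult_single)
    ultimately show ?thesis
      by (simp add: mpow_def)
  qed
  show ?thesis
    by (simp add: shift_vars_def subst_def * mult_single)
qed

text \<open>Horner terms do not store variable indices. Renumbering all variables only changes the
  starting index of \<open>hpoly\<close>, which is why the program has no counterpart of
  \<open>shift_vars\<close>.\<close>

lemma shift_vars_hpoly: "shift_vars n (hpoly i p) = hpoly (n + i) p"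
  by (induction p arbitrary: i) (simp_all add: shift_vars_simps)

lemma h_grad_prod_correct:
  assumes "hwf n p" "m \<le> n"
  shows "hwf (n + n) (h_grad_prod m p) \<and>
    hpoly 0 (h_grad_prod m p) = (\<Sum>i<m. pd i (hpoly 0 p) * shift_vars n (pd i (hpoly 0 p)))"
  using assms(2)
proof (induction m)
  case (Suc m)
  define q where "q = h_deriv m p"
  have q: "hwf n q" "hpoly 0 q = pd m (hpoly 0 p)"
    using h_deriv_correct[OF assms(1), of m 0] Suc.prems by (auto simp: q_def)
  have "shift_vars n (hpoly 0 q) = hpoly n q"
    by (simp add: shift_vars_hpoly)
  moreover have "hwf (n + n) (h_tensor q q)" "hpoly 0 (h_tensor q q) = hpoly 0 q * hpoly n q"
    using h_tensor_correct[OF q(1) q(1), of 0] by auto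
  ultimately show ?case
    using h_add_correct[of "n + n" "h_grad_prod m p" "h_tensor q q" 0] Suc
    by (simp add: Let_def q(2) flip: q_def)
qed simp

text \<open>Writing \<open>p'\<close> and \<open>q'\<close> for the shifted parts,
  \<open>p + x * q\<close> becomes \<open>p' + (x + m) * q' = (p' + x * q') + m * q'\<close>, and
  the last sum is what the program forms.\<close>

lemma taylor_shift_correct:
  assumes "hwf (length ms) p" "\<And>j. j < length ms \<Longrightarrow> y (i + j) = dy_val (ms ! j)"
  shows "hwf (length ms) (taylor_shift ms p) \<and> hpoly i (taylor_shift ms p) = shift y (hpoly i p)"
  using assms
proof (induction ms p arbitrary: i rule: taylor_shift.induct)
  case (4 m ms p q)
  define r where "r = taylor_shift (m # ms) q"
  have r: "hwf (Suc (length ms)) r" "hpoly i r = shift y (hpoly i q)"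
    using 4(1)[of i] 4(3,4) by (auto simp: r_def)
  have p: "hwf (length ms) (taylor_shift ms p)"
    "hpoly (Suc i) (taylor_shift ms p) = shift y (hpoly (Suc i) p)"
    using 4(2)[OF r_def, of "Suc i"] 4(3) 4(4)[of "Suc _"] by auto
  have "hwf (Suc (length ms)) (Horner (taylor_shift ms p) r)" "hwf (Suc (length ms)) (h_smult m r)"
    using p(1) r(1) h_smult_correct by auto
  note h_add_correct[OF this, of i]
  then show ?case
    using r p 4(4)[of 0] h_smult_correct[OF r(1), of m i]
    by (simp add: Let_def algebra_simps flip: r_def)
qed auto

section \<open>Sums of absolute values of coefficients, for the radius of the centered form\<close>

definition asum :: "real \<Rightarrow> real mpoly \<Rightarrow> real" where
  "asum u F = (\<Sum>\<alpha>\<in>supp F. \<bar>coef F \<alpha>\<bar> * u ^ mdeg \<alpha>)"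

lemma asum_superset:
  "finite S \<Longrightarrow> supp F \<subseteq> S \<Longrightarrow> asum u F = (\<Sum>\<alpha>\<in>S. \<bar>coef F \<alpha>\<bar> * u ^ mdeg \<alpha>)"
  unfolding asum_def by (rule sum.mono_neutral_left) (auto simp: in_keys_iff)

text \<open>Without common monomials nothing can cancel. It is applied to \<open>p + x * q\<close>,
  where \<open>p\<close> is free of \<open>x\<close> and every monomial of \<open>x * q\<close>
  contains it.\<close>

lemma asum_disjoint:
  assumes "supp F \<inter> supp G = {}"
  shows "asum u (F + G) = asum u F + asum u G"
proof -
  have part: "(\<Sum>\<alpha>\<in>supp A. \<bar>coef (A + B) \<alpha>\<bar> * u ^ mdeg \<alpha>) = asum u A"
    if "supp A \<inter> supp B = {}" for A B
    unfolding asum_def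
  proof (rule sum.cong[OF refl])
    fix \<alpha> assume "\<alpha> \<in> supp A"
    then have "coef B \<alpha> = 0"
      using that by (auto simp: in_keys_iff)
    then show "\<bar>coef (A + B) \<alpha>\<bar> * u ^ mdeg \<alpha> = \<bar>coef A \<alpha>\<bar> * u ^ mdeg \<alpha>"
      by (simp add: lookup_add)
  qed
  have "asum u (F + G) = (\<Sum>\<alpha>\<in>supp F \<union> supp G. \<bar>coef (F + G) \<alpha>\<bar> * u ^ mdeg \<alpha>)"
    by (rule asum_superset) (auto simp: keys_add)
  also have "\<dots> = (\<Sum>\<alpha>\<in>supp F. \<bar>coef (F + G) \<alpha>\<bar> * u ^ mdeg \<alpha>) + (\<Sum>\<alpha>\<in>supp G. \<bar>coef (G + F) \<alpha>\<bar> * u ^ mdeg \<alpha>)"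
    by (subst sum.union_disjoint) (use assms in \<open>auto simp: add.commute\<close>)
  finally show ?thesis
    using part[of F G] part[of G F] assms by auto
qed

lemma supp_Var_mult: "supp (Var i * F :: 'a::comm_semiring_1 mpoly) = (\<lambda>\<alpha>. \<alpha> + sgl i (Suc 0)) ` supp F"
proof (intro Set.set_eqI iffI)
  fix \<alpha> assume "\<alpha> \<in> supp (Var i * F)"
  then have "Suc 0 \<le> coef \<alpha> i" "\<alpha> - sgl i (Suc 0) \<in> supp F"
    by (auto simp: in_keys_iff coef_Var_mult split: if_splits)
  then show "\<alpha> \<in> (\<lambda>\<alpha>. \<alpha> + sgl i (Suc 0)) ` supp F"
    by (metis image_eqI minus_single_add)
qed (auto simp: in_keys_iff coef_Var_mult lookup_add)

lemma asum_Var_mult: "asum u (Var i * F) = u * asum u F"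
proof -
  have "asum u (Var i * F) = (\<Sum>\<alpha>\<in>supp F. \<bar>coef (Var i * F) (\<alpha> + sgl i (Suc 0))\<bar> * u ^ mdeg (\<alpha> + sgl i (Suc 0)))"
    unfolding asum_def supp_Var_mult by (subst sum.reindex) (auto intro: inj_onI)
  then show ?thesis
    by (simp add: asum_def coef_Var_mult lookup_add mdeg_add sum_distrib_left mult.left_commute)
qed

lemma h_abs_eval_correct:
  "hwf k p \<Longrightarrow> dy_val (h_abs_eval u p) = asum (dy_val u) (hpoly i p)"
proof (induction p arbitrary: i rule: hwf.induct)
  case (1 k a)
  then show ?case
    by (cases "dy_val a = 0") (simp_all add: asum_def)
next
  case (4 k p q)
  have "supp (hpoly (Suc i) p) \<inter> supp (Var i * hpoly i q) = {}"
  proof (rule ccontr)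
    assume "supp (hpoly (Suc i) p) \<inter> supp (Var i * hpoly i q) \<noteq> {}"
    then obtain \<alpha> where "\<alpha> + sgl i (Suc 0) \<in> supp (hpoly (Suc i) p)"
      unfolding supp_Var_mult by blast
    then have "supp (\<alpha> + sgl i (Suc 0)) \<subseteq> {Suc i..<Suc i + k}"
      using 4(3) by (intro supp_hpoly) auto
    moreover have "i \<in> supp (\<alpha> + sgl i (Suc 0))"
      by (simp add: in_keys_iff lookup_add)
    ultimately show False
      by auto
  qed
  with 4 show ?case
    by (simp add: asum_disjoint asum_Var_mult)
qed (simp_all add: asum_def)

lemma h_const_correct: "hwf k p \<Longrightarrow> dy_val (h_const p) = coef (hpoly i p) 0"
  by (induction p arbitrary: i rule: hwf.induct) (auto simp: lookup_add coef_Var_mult)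

section \<open>The tests\<close>

lemma finite_monomials: "finite {\<alpha>. supp \<alpha> \<subseteq> {..<n} \<and> mdeg \<alpha> \<le> D}"
proof -
  have "coef ` {\<alpha>. supp \<alpha> \<subseteq> {..<n} \<and> mdeg \<alpha> \<le> D} \<subseteq>
      {g. \<forall>i. (i \<in> {..<n} \<longrightarrow> g i \<in> {..D}) \<and> (i \<notin> {..<n} \<longrightarrow> g i = 0)}"
    using coef_le_mdeg by (auto simp: in_keys_iff intro: order_trans)
  then have "finite (coef ` {\<alpha>. supp \<alpha> \<subseteq> {..<n} \<and> mdeg \<alpha> \<le> D})"
    by (rule finite_subset) (intro finite_set_of_finite_funs finite_lessThan finite_atMost)
  then show ?thesis
    by (rule finite_imageD) (auto intro!: inj_onI poly_mapping_eqI)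
qed

text \<open>By \<open>taylor_coefficient\<close> the radius is the weighted sum over the nonconstant
  coefficients of \<open>t\<close>, that is, \<open>asum\<close> minus the absolute value of the
  constant coefficient. The centre is this constant coefficient, and \<open>0\<close> lies outside
  iff the radius is smaller than its absolute value.\<close>

lemma centered_form_iff:
  assumes "mvars F \<subseteq> {..<length (fst Q)}"
  defines "t \<equiv> shift (\<lambda>i. midpoint Q ! i) F"
  shows "0 \<notin> centered_form F Q \<longleftrightarrow> asum (snd Q / 2) t < 2 * \<bar>coef t 0\<bar>"
    and "mvars t \<subseteq> {..<length (fst Q)}"
proof -
  let ?n = "length (fst Q)" and ?h = "snd Q / 2"
  let ?S = "{\<alpha>. supp \<alpha> \<subseteq> {..<?n} \<and> 1 \<le> mdeg \<alpha> \<and> mdeg \<alpha> \<le> total_degree F}"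
  define r where "r = (\<Sum>\<alpha>\<in>?S. \<bar>peval (mixed_pd \<alpha> F) (midpoint Q)\<bar> / real (mfact \<alpha>) * ?h ^ mdeg \<alpha>)"
  have "mvars (mpow (\<lambda>i. Var i + Cst (midpoint Q ! i) :: real mpoly) \<alpha>) \<subseteq> {..<?n}" if "supp \<alpha> \<subseteq> {..<?n}" for \<alpha>
    using that
  proof (induction \<alpha> rule: monomial_induct)
    case zero
    then show ?case
      by (simp flip: single_one)
  next
    case (var i \<alpha>)
    have "supp (\<alpha> + sgl i (Suc 0)) = insert i (supp \<alpha>)"
      by (auto simp: in_keys_iff lookup_add lookup_single when_def split: if_splits)
    then show ?case
      using var mvars_mult[of "mpow (\<lambda>i. Var i + Cst (midpoint Q ! i)) \<alpha>" "Var i + Cst (midpoint Q ! i)"]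
        mvars_add[of "Var i :: real mpoly" "Cst (midpoint Q ! i)"]
      by (auto simp: mpow_add)
  qed
  moreover have "supp \<alpha> \<subseteq> {..<?n}" if "\<alpha> \<in> supp F" for \<alpha>
    using assms(1) that by (auto simp: mvars_def)
  ultimately show vt: "mvars t \<subseteq> {..<?n}"
    unfolding t_def shift_def subst_def
    by (intro order.trans[OF mvars_sum] UN_least order.trans[OF mvars_mult]) auto
  \<comment> \<open>The sum in the centered form stops at the degree of \<open>F\<close>; it still
    covers all of \<open>t\<close> because shifting does not raise the degree.\<close>
  have "supp t \<subseteq> insert 0 ?S"
  proof
    fix \<alpha> assume \<alpha>: "\<alpha> \<in> supp t"
    then have "mdeg \<alpha> \<le> total_degree F"
      using deg_le_shift[OF deg_le_total_degree[of F]] unfolding t_def deg_le_def by blast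
    moreover have "supp \<alpha> \<subseteq> {..<?n}"
      using vt \<alpha> by (auto simp: mvars_def)
    ultimately show "\<alpha> \<in> insert 0 ?S"
      by (cases "mdeg \<alpha>") auto
  qed
  moreover have fin: "finite ?S"
    by (rule finite_subset[OF _ finite_monomials[of ?n "total_degree F"]]) auto
  moreover have "0 \<notin> ?S"
    by simp
  ultimately have "asum ?h t = \<bar>coef t 0\<bar> + (\<Sum>\<alpha>\<in>?S. \<bar>coef t \<alpha>\<bar> * ?h ^ mdeg \<alpha>)"
    by (subst asum_superset[of "insert 0 ?S"]) (auto simp del: One_nat_def)
  also have "(\<Sum>\<alpha>\<in>?S. \<bar>coef t \<alpha>\<bar> * ?h ^ mdeg \<alpha>) = r"
    unfolding r_def t_def taylor_coefficient
    by (intro sum.cong) (use mfact_pos in \<open>auto simp: abs_mult\<close>)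
  finally have "asum ?h t = \<bar>coef t 0\<bar> + r" .
  moreover have "centered_form F Q = {coef t 0 - r .. coef t 0 + r}"
    by (simp add: centered_form_def r_def t_def coef_shift_0 Let_def)
  ultimately show "0 \<notin> centered_form F Q \<longleftrightarrow> asum ?h t < 2 * \<bar>coef t 0\<bar>"
    by auto
qed

lemma centered_test_correct:
  assumes "hwf (length ms) p" "length (fst Q) = length ms"
    and "map dy_val ms = midpoint Q" "dy_val u = snd Q / 2" "0 \<le> dy_val u"
  shows "centered_test u ms p \<longleftrightarrow> 0 \<notin> centered_form (hpoly 0 p) Q"
proof -
  let ?F = "hpoly 0 p"
  define t where "t = taylor_shift ms p"
  have "midpoint Q ! j = dy_val (ms ! j)" if "j < length ms" for j
    using that by (simp flip: assms(3))
  then have t: "hwf (length ms) t" "hpoly 0 t = shift (\<lambda>i. midpoint Q ! i) ?F"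
    using taylor_shift_correct[OF assms(1), where i = 0 and y = "\<lambda>i. midpoint Q ! i"] by (simp_all add: t_def)
  have "mvars ?F \<subseteq> {..<length (fst Q)}"
    using mvars_hpoly[OF assms(1), of 0] assms(2) by auto
  moreover have "0 \<le> asum (dy_val u) (hpoly 0 t)"
    using assms(5) unfolding asum_def by (intro sum_nonneg) auto
  ultimately show ?thesis
    using h_abs_eval_correct[OF t(1), of u 0] h_const_correct[OF t(1), of 0]
    by (simp add: centered_form_iff(1) t assms(4) abs_mult dy_abs_less_iff Let_def flip: t_def)
qed

section \<open>The dense encoding of the input polynomial\<close>

lemma hpoly_foldr:
  "hpoly i (foldr Horner ps Zero) = (\<Sum>j<length ps. Var i ^ j * hpoly (Suc i) (ps ! j))"
  by (induction ps) (simp_all add: sum.lessThan_Suc_shift sum_distrib_left mult.assoc del: sum.lessThan_Suc)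

lemma hwf_foldr: "(\<And>p. p \<in> set ps \<Longrightarrow> hwf k p) \<Longrightarrow> hwf (Suc k) (foldr Horner ps Zero)"
  by (induction ps) auto

lemma coef_Var_power_mult:
  "coef (Var i ^ k * F) \<gamma> = (if k \<le> coef \<gamma> i then coef F (\<gamma> - sgl i k) else 0)"
proof (induction k arbitrary: \<gamma>)
  case (Suc k)
  have "\<gamma> - sgl i (Suc 0) - sgl i k = \<gamma> - sgl i (Suc k)"
    by (rule poly_mapping_eqI) (simp add: lookup_minus lookup_single when_def)
  then show ?case
    using Suc by (auto simp: mult.assoc coef_Var_mult lookup_minus)
qed simp

lemma hwf_dense: "hwf (length is) (dense f d \<alpha> is)"
  by (induction f d \<alpha> "is" rule: dense.induct) (auto simp del: upt_Suc intro!: hwf_foldr)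

text \<open>The encoding truncates monomials with an exponent above \<open>d\<close>, hence the case
  distinction. In \<open>hpoly_dense\<close> the bound is the total degree and nothing is cut
  off.\<close>

lemma coef_dense:
  "i \<le> n \<Longrightarrow> coef (hpoly i (dense f d \<alpha> [i..<n])) \<gamma> =
    (if supp \<gamma> \<subseteq> {i..<n} \<and> (\<forall>j. coef \<gamma> j \<le> d) then real_of_int (coef f (\<alpha> + \<gamma>)) else 0)"
proof (induction "n - i" arbitrary: i \<alpha> \<gamma>)
  case 0
  then show ?case
    by (cases "\<gamma> = 0") (auto simp: lookup_single_not_eq simp del: single_of_int)
next
  case (Suc k)
  then have in_: "i < n" "[i..<n] = i # [Suc i..<n]"
    by (simp_all add: upt_conv_Cons)
  define G where "G j = hpoly (Suc i) (dense f d (\<alpha> + sgl i j) [Suc i..<n])" for j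
  define \<gamma>' where "\<gamma>' = \<gamma> - sgl i (coef \<gamma> i)"
  have G: "coef (G j) \<delta> = (if supp \<delta> \<subseteq> {Suc i..<n} \<and> (\<forall>j. coef \<delta> j \<le> d) then real_of_int (coef f (\<alpha> + sgl i j + \<delta>)) else 0)" for j \<delta>
    unfolding G_def using Suc(2) in_(1) by (intro Suc(1)) auto
  have \<gamma>: "\<gamma> = sgl i (coef \<gamma> i) + \<gamma>'"
    unfolding \<gamma>'_def using minus_single_add[of "coef \<gamma> i" \<gamma> i] by (simp add: add.commute)
  have "coef (hpoly i (dense f d \<alpha> [i..<n])) \<gamma> =
      (\<Sum>j<Suc d. coef (Var i ^ j * G j) \<gamma>)"
    by (simp add: in_ hpoly_foldr lookup_sum G_def del: upt_Suc sum.lessThan_Suc)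
  also have "\<dots> = (\<Sum>j<Suc d. if j \<le> coef \<gamma> i then coef (G j) (\<gamma> - sgl i j) else 0)"
    by (simp only: coef_Var_power_mult)
  \<comment> \<open>\<open>G j\<close> is free of the variable \<open>i\<close>, so only the power
    \<open>j = coef \<gamma> i\<close> leaves an exponent vector that can occur in it.\<close>
  also have "\<dots> = (\<Sum>j<Suc d. if j = coef \<gamma> i then coef (G j) \<gamma>' else 0)"
  proof (rule sum.cong[OF refl])
    fix j
    have "coef (G j) (\<gamma> - sgl i j) = 0" if "j < coef \<gamma> i"
    proof -
      have "i \<in> supp (\<gamma> - sgl i j)"
        using that by (simp add: in_keys_iff lookup_minus)
      then show ?thesis
        unfolding G by auto
    qed
    then show "(if j \<le> coef \<gamma> i then coef (G j) (\<gamma> - sgl i j) else 0) = (if j = coef \<gamma> i then coef (G j) \<gamma>' else 0)"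
      by (auto simp: \<gamma>'_def)
  qed
  also have "\<dots> = (if coef \<gamma> i \<le> d then coef (G (coef \<gamma> i)) \<gamma>' else 0)"
    by (simp del: sum.lessThan_Suc add: less_Suc_eq_le)
  also have "\<dots> = (if supp \<gamma> \<subseteq> {i..<n} \<and> (\<forall>j. coef \<gamma> j \<le> d) then real_of_int (coef f (\<alpha> + \<gamma>)) else 0)"
  proof -
    have \<gamma>': "coef \<gamma>' j = (if j = i then 0 else coef \<gamma> j)" for j
      by (simp add: \<gamma>'_def lookup_minus lookup_single when_def)
    then have "supp \<gamma>' = supp \<gamma> - {i}"
      by (auto simp: in_keys_iff split: if_splits)
    moreover have "{i..<n} = insert i {Suc i..<n}"
      using in_(1) by auto
    ultimately have "supp \<gamma>' \<subseteq> {Suc i..<n} \<longleftrightarrow> supp \<gamma> \<subseteq> {i..<n}"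
      by (simp add: subset_insert_iff)
    moreover have "coef \<gamma> i \<le> d \<and> (\<forall>j. coef \<gamma>' j \<le> d) \<longleftrightarrow> (\<forall>j. coef \<gamma> j \<le> d)"
      by (auto simp: \<gamma>')
    moreover have "\<alpha> + \<gamma> = \<alpha> + sgl i (coef \<gamma> i) + \<gamma>'"
      by (subst \<gamma>) (simp add: add.assoc)
    ultimately show ?thesis
      by (auto simp: G)
  qed
  finally show ?case .
qed

lemma hpoly_dense:
  assumes "mvars f \<subseteq> {..<n}"
  shows "hpoly 0 (dense f (total_degree f) 0 [0..<n]) = real_mpoly f"
proof (rule poly_mapping_eqI)
  fix \<gamma>
  have "supp \<gamma> \<subseteq> {..<n}" "\<forall>j. coef \<gamma> j \<le> total_degree f" if "\<gamma> \<in> supp f"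
    using that assms order_trans[OF coef_le_mdeg mdeg_le_total_degree[OF that]] by (auto simp: mvars_def)
  then show "coef (hpoly 0 (dense f (total_degree f) 0 [0..<n])) \<gamma> = coef (real_mpoly f) \<gamma>"
    by (subst coef_dense) (auto simp: lessThan_atLeast0 in_keys_iff)
qed

lemma map_dy_val_translate: "map dy_val (translate h as) = map (\<lambda>a. dy_val a + dy_val h) as"
  by (induction as) auto

lemma length_translate [simp]: "length (translate h as) = length as"
  by (induction as) auto

lemma grad_prod_hpoly:
  assumes "hwf n p"
  shows "hwf (n + n) (h_grad_prod n p)" "hpoly 0 (h_grad_prod n p) = grad_prod n (hpoly 0 p)"
  using h_grad_prod_correct[OF assms order_refl] by (auto simp: grad_prod_def)

theorem accepted_correct:
  assumes "hwf n p" "length (fst J) = n" "g = h_grad_prod n p" "0 \<le> dy_val (snd J)"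
  shows "accepted p g J \<longleftrightarrow> C0 (hpoly 0 p) (dcube_val J) \<or> C1 (hpoly 0 p) (dcube_val J)"
proof (cases J)
  case (Pair as w)
  define m where "m = translate (dy_half w) as"
  have m: "map dy_val m = midpoint (dcube_val J)" "length m = n"
    using assms(2) by (simp_all add: m_def map_dy_val_translate midpoint_def dcube_val_def Pair)
  have "centered_test (dy_half w) m p \<longleftrightarrow> C0 (hpoly 0 p) (dcube_val J)"
    unfolding C0_def using assms m by (intro centered_test_correct) (auto simp: dcube_val_def Pair)
  moreover have "centered_test (dy_half w) (m @ m) g \<longleftrightarrow> C1 (hpoly 0 p) (dcube_val J)"
    unfolding C1_def using assms m grad_prod_hpoly[OF assms(1)]
    by (subst centered_test_correct[where Q = "(map dy_val as @ map dy_val as, dy_val w)"])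
       (auto simp: dcube_val_def Pair midpoint_def)
  ultimately show ?thesis
    by (simp add: Pair m_def Let_def)
qed

section \<open>Elimination\<close>

text \<open>Submultiplicative seminorms. The axioms are inherited by the sum of the norms of the
  coefficients of a polynomial (\<open>ring_norm_poly\<close>), which yields norms on
  \<open>\<int>\<close>, \<open>\<int>[s]\<close> and polynomials over \<open>\<int>[s]\<close> from
  one construction. Inequalities are enough since only upper bounds are propagated.\<close>

locale ring_norm =
  fixes N :: "'a::comm_ring_1 \<Rightarrow> real"
  assumes norm_0 [simp]: "N 0 = 0" and norm_1: "N 1 \<le> 1" and norm_nonneg [simp]: "0 \<le> N a"
    and norm_minus: "N (- a) \<le> N a"
    and norm_add: "N (a + b) \<le> N a + N b" and norm_mult: "N (a * b) \<le> N a * N b"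
begin

lemma norm_sum: "N (sum f S) \<le> (\<Sum>s\<in>S. N (f s))"
proof (induction S rule: infinite_finite_induct)
  case (insert s S)
  then show ?case
    using norm_add[of "f s" "sum f S"] by simp
qed auto

lemma norm_prod: "N (prod f S) \<le> (\<Prod>s\<in>S. N (f s))"
proof (induction S rule: infinite_finite_induct)
  case (insert s S)
  have "N (f s * prod f S) \<le> N (f s) * N (prod f S)"
    by (rule norm_mult)
  also have "\<dots> \<le> N (f s) * (\<Prod>s\<in>S. N (f s))"
    by (intro mult_left_mono insert) simp
  finally show ?case
    using insert by simp
qed (auto simp: norm_1)

text \<open>Leibniz formula: \<open>n!\<close> products of \<open>n\<close> entries each, and
  \<open>norm_minus\<close> takes care of the signs.\<close>

lemma norm_det:
  assumes A: "A \<in> carrier_mat n n" and B: "\<And>i j. i < n \<Longrightarrow> j < n \<Longrightarrow> N (A $$ (i, j)) \<le> B"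
  shows "N (det A) \<le> fact n * B ^ n"
proof -
  let ?P = "{p. p permutes {0..<n}}"
  have "N (signof p * (\<Prod>i = 0..<n. A $$ (i, p i))) \<le> B ^ n" if "p \<in> ?P" for p
  proof -
    have "N (\<Prod>i = 0..<n. A $$ (i, p i)) \<le> (\<Prod>i = 0..<n. N (A $$ (i, p i)))"
      by (rule norm_prod)
    also have "\<dots> \<le> (\<Prod>i = 0..<n. B)"
      using that by (intro prod_mono conjI B norm_nonneg) (auto simp: permutes_in_image)
    also have "\<dots> = B ^ n"
      by simp
    finally have "N (\<Prod>i = 0..<n. A $$ (i, p i)) \<le> B ^ n" .
    then have le: "N x \<le> B ^ n \<and> N (- x) \<le> B ^ n" if "x = (\<Prod>i = 0..<n. A $$ (i, p i))" for x
      using norm_minus[of x] that by auto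
    have "signof p = (1 :: 'a) \<or> signof p = (- 1 :: 'a)"
      by (simp add: sign_def)
    then show ?thesis
      using le by auto
  qed
  then have "(\<Sum>p\<in>?P. N (signof p * (\<Prod>i = 0..<n. A $$ (i, p i)))) \<le> of_nat (card ?P) * B ^ n"
    by (rule sum_bounded_above)
  moreover have "card ?P = fact n"
    by (rule card_permutations) auto
  moreover have "N (det A) \<le> (\<Sum>p\<in>?P. N (signof p * (\<Prod>i = 0..<n. A $$ (i, p i))))"
    using A norm_sum[of _ ?P] by (simp add: det_def)
  ultimately show ?thesis
    by simp
qed

end

definition poly_norm :: "('a::zero \<Rightarrow> real) \<Rightarrow> 'a poly \<Rightarrow> real" where
  "poly_norm N p = (\<Sum>i\<le>Polynomial.degree p. N (coeff p i))"

context ring_norm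
begin

lemma poly_norm_superset: "Polynomial.degree p \<le> m \<Longrightarrow> poly_norm N p = (\<Sum>i\<le>m. N (coeff p i))"
  unfolding poly_norm_def by (rule sum.mono_neutral_left) (auto simp: coeff_eq_0)

lemma poly_norm_pCons [simp]: "poly_norm N (pCons a p) = N a + poly_norm N p"
proof -
  have "poly_norm N (pCons a p) = (\<Sum>i\<le>Suc (Polynomial.degree p). N (coeff (pCons a p) i))"
    by (rule poly_norm_superset) (rule degree_pCons_le)
  then show ?thesis
    by (simp add: poly_norm_def sum.atMost_Suc_shift del: sum.atMost_Suc)
qed

lemma poly_norm_0 [simp]: "poly_norm N 0 = 0"
  by (simp add: poly_norm_def)

lemma poly_norm_nonneg: "0 \<le> poly_norm N p"
  by (simp add: poly_norm_def sum_nonneg)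

lemma poly_norm_add: "poly_norm N (p + q) \<le> poly_norm N p + poly_norm N q"
proof -
  let ?m = "max (Polynomial.degree p) (Polynomial.degree q)"
  have "poly_norm N (p + q) = (\<Sum>i\<le>?m. N (coeff (p + q) i))"
    by (rule poly_norm_superset) (rule degree_add_le_max)
  also have "\<dots> \<le> (\<Sum>i\<le>?m. N (coeff p i) + N (coeff q i))"
    by (intro sum_mono) (simp add: norm_add)
  also have "\<dots> = poly_norm N p + poly_norm N q"
    using poly_norm_superset[of p ?m] poly_norm_superset[of q ?m] by (simp add: sum.distrib)
  finally show ?thesis .
qed

lemma poly_norm_smult: "poly_norm N (Polynomial.smult c p) \<le> N c * poly_norm N p"
proof -
  have "poly_norm N (Polynomial.smult c p) = (\<Sum>i\<le>Polynomial.degree p. N (c * coeff p i))"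
    by (subst poly_norm_superset[OF degree_smult_le]) simp
  also have "\<dots> \<le> (\<Sum>i\<le>Polynomial.degree p. N c * N (coeff p i))"
    by (intro sum_mono norm_mult)
  finally show ?thesis
    by (simp add: poly_norm_def sum_distrib_left)
qed

lemma poly_norm_mult: "poly_norm N (p * q) \<le> poly_norm N p * poly_norm N q"
proof (induction p)
  case (pCons a p)
  have "poly_norm N (pCons a p * q) \<le> poly_norm N (Polynomial.smult a q) + poly_norm N (p * q)"
    using poly_norm_add[of "Polynomial.smult a q" "pCons 0 (p * q)"] by simp
  also have "\<dots> \<le> N a * poly_norm N q + poly_norm N p * poly_norm N q"
    by (intro add_mono poly_norm_smult pCons)
  finally show ?case
    by (simp add: distrib_right)
qed simp

lemma ring_norm_poly: "ring_norm (poly_norm N)"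
proof
  show "poly_norm N 1 \<le> 1"
    using norm_1 by (simp add: one_pCons)
  show "poly_norm N (- p) \<le> poly_norm N p" for p
    unfolding poly_norm_def by (simp add: sum_mono norm_minus)
qed (simp_all add: poly_norm_nonneg poly_norm_add poly_norm_mult)

end

abbreviation "zsubst \<equiv> subst real_of_int"

abbreviation zabs :: "int \<Rightarrow> real" where "zabs \<equiv> \<lambda>z. \<bar>real_of_int z\<bar>"

lemma ring_norm_int: "ring_norm zabs"
  by standard (auto simp: abs_mult)

abbreviation pnorm :: "int poly \<Rightarrow> real" where "pnorm \<equiv> poly_norm zabs"

interpretation pnorm: ring_norm pnorm
  by (rule ring_norm.ring_norm_poly[OF ring_norm_int])

interpretation ppnorm: ring_norm "poly_norm pnorm"
  by (rule pnorm.ring_norm_poly)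

definition mnorm :: "('a::zero \<Rightarrow> real) \<Rightarrow> 'a mpoly \<Rightarrow> real" where
  "mnorm N F = (\<Sum>\<alpha>\<in>supp F. N (coef F \<alpha>))"

context ring_norm
begin

lemma mnorm_superset: "finite S \<Longrightarrow> supp F \<subseteq> S \<Longrightarrow> mnorm N F = (\<Sum>\<alpha>\<in>S. N (coef F \<alpha>))"
  unfolding mnorm_def by (rule sum.mono_neutral_left) (auto simp: in_keys_iff)

lemma mnorm_nonneg [simp]: "0 \<le> mnorm N F"
  by (simp add: mnorm_def sum_nonneg)

lemma mnorm_single [simp]: "mnorm N (sgl \<alpha> c) = N c"
  by (simp add: mnorm_def)

lemma mnorm_0 [simp]: "mnorm N 0 = 0"
  by (simp add: mnorm_def)

lemma mnorm_add: "mnorm N (F + G) \<le> mnorm N F + mnorm N G"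
proof -
  let ?S = "supp F \<union> supp G"
  have "mnorm N (F + G) = (\<Sum>\<alpha>\<in>?S. N (coef (F + G) \<alpha>))"
    by (rule mnorm_superset) (auto simp: keys_add)
  also have "\<dots> \<le> (\<Sum>\<alpha>\<in>?S. N (coef F \<alpha>) + N (coef G \<alpha>))"
    by (intro sum_mono) (simp add: lookup_add norm_add)
  also have "\<dots> = mnorm N F + mnorm N G"
    by (simp add: sum.distrib flip: mnorm_superset)
  finally show ?thesis .
qed

lemma mnorm_sum: "mnorm N (sum F S) \<le> (\<Sum>s\<in>S. mnorm N (F s))"
proof (induction S rule: infinite_finite_induct)
  case (insert s S)
  then show ?case
    using mnorm_add[of "F s" "sum F S"] by simp
qed auto

lemma mnorm_single_mult: "mnorm N (sgl \<beta> c * F) \<le> N c * mnorm N F"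
proof -
  have "sgl \<beta> c * F = sgl \<beta> c * (\<Sum>\<alpha>\<in>supp F. sgl \<alpha> (coef F \<alpha>))"
    by (simp flip: poly_mapping_sum_single)
  also have "\<dots> = (\<Sum>\<alpha>\<in>supp F. sgl (\<beta> + \<alpha>) (c * coef F \<alpha>))"
    by (simp add: sum_distrib_left mult_single)
  finally have "mnorm N (sgl \<beta> c * F) \<le> (\<Sum>\<alpha>\<in>supp F. mnorm N (sgl (\<beta> + \<alpha>) (c * coef F \<alpha>)))"
    by (simp only: mnorm_sum)
  also have "\<dots> \<le> (\<Sum>\<alpha>\<in>supp F. N c * N (coef F \<alpha>))"
    by (intro sum_mono) (simp add: norm_mult)
  finally show ?thesis
    by (simp add: mnorm_def sum_distrib_left)
qed

lemma mnorm_mult: "mnorm N (F * G) \<le> mnorm N F * mnorm N G"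
proof -
  have "F * G = (\<Sum>\<alpha>\<in>supp F. sgl \<alpha> (coef F \<alpha>)) * G"
    by (simp flip: poly_mapping_sum_single)
  then have "mnorm N (F * G) \<le> (\<Sum>\<alpha>\<in>supp F. mnorm N (sgl \<alpha> (coef F \<alpha>) * G))"
    by (simp add: sum_distrib_right mnorm_sum)
  also have "\<dots> \<le> (\<Sum>\<alpha>\<in>supp F. N (coef F \<alpha>) * mnorm N G)"
    by (intro sum_mono mnorm_single_mult)
  finally show ?thesis
    by (simp add: mnorm_def[of N F] sum_distrib_right)
qed

end

definition zev :: "real \<Rightarrow> int poly \<Rightarrow> real" where
  "zev s p = poly (of_int_poly p) s"

lemma zev_const: "zev s [:c:] = real_of_int c"
  by (simp add: zev_def hom_distribs)

lemma comm_ring_hom_zev: "comm_ring_hom (zev s)"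
  by standard (simp_all add: zev_def hom_distribs)

lemma comm_semiring_hom_zev: "comm_semiring_hom (zev s)"
  by standard (simp_all add: zev_def hom_distribs)

lemmas zev_subst =
  comm_semiring_hom.subst_0[OF comm_semiring_hom_zev]
  comm_semiring_hom.subst_single[OF comm_semiring_hom_zev]
  comm_semiring_hom.subst_add[OF comm_semiring_hom_zev]
  comm_semiring_hom.subst_sum[OF comm_semiring_hom_zev]
  comm_semiring_hom.subst_mult[OF comm_semiring_hom_zev]

section \<open>Reduction of monomials to bounded exponents, and the characteristic
  polynomial\<close>

definition expbox :: "nat \<Rightarrow> (nat \<Rightarrow> nat) \<Rightarrow> (nat \<Rightarrow>\<^sub>0 nat) set" where
  "expbox n k = {\<alpha>. supp \<alpha> \<subseteq> {..<n} \<and> (\<forall>i<n. coef \<alpha> i < k i)}"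

lemma expbox_mdeg: "\<alpha> \<in> expbox n k \<Longrightarrow> (\<And>i. i < n \<Longrightarrow> k i \<le> K) \<Longrightarrow> mdeg \<alpha> \<le> n * K"
proof -
  assume \<alpha>: "\<alpha> \<in> expbox n k" and K: "\<And>i. i < n \<Longrightarrow> k i \<le> K"
  have "mdeg \<alpha> = (\<Sum>i<n. coef \<alpha> i)"
    using \<alpha> by (intro mdeg_superset) (auto simp: expbox_def)
  also have "\<dots> \<le> of_nat (card {..<n}) * K"
    using \<alpha> K by (intro sum_bounded_above) (force simp: expbox_def intro: less_imp_le order.strict_trans2)
  finally show ?thesis
    by simp
qed

lemma card_expbox:
  assumes "\<And>i. i < n \<Longrightarrow> k i \<le> K"
  shows "finite (expbox n k)" "card (expbox n k) \<le> K ^ n"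
proof -
  let ?r = "\<lambda>\<alpha>. restrict (coef \<alpha>) {..<n}" and ?X = "{..<n} \<rightarrow>\<^sub>E {..<K}"
  have inj: "inj_on ?r (expbox n k)"
  proof (rule inj_onI, rule poly_mapping_eqI)
    fix \<alpha> \<beta> i assume *: "\<alpha> \<in> expbox n k" "\<beta> \<in> expbox n k" "?r \<alpha> = ?r \<beta>"
    show "coef \<alpha> i = coef \<beta> i"
    proof (cases "i < n")
      case True
      then show ?thesis
        using fun_cong[OF *(3), of i] by simp
    next
      case False
      then have "i \<notin> supp \<alpha>" "i \<notin> supp \<beta>"
        using *(1,2) by (auto simp: expbox_def)
      then show ?thesis
        by (simp add: in_keys_iff)
    qed
  qed
  have sub: "?r ` expbox n k \<subseteq> ?X"
  proof -
    have "coef \<alpha> i < K" if "\<alpha> \<in> expbox n k" "i < n" for \<alpha> i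
      using assms[OF that(2)] that by (auto simp: expbox_def)
    then show ?thesis
      by (auto simp: restrict_def PiE_def extensional_def)
  qed
  have fin: "finite ?X"
    by (intro finite_PiE) auto
  then show "finite (expbox n k)"
    using inj sub by (meson finite_imageD finite_subset)
  have "card (expbox n k) \<le> card ?X"
    using inj sub fin by (rule card_inj_on_le)
  then show "card (expbox n k) \<le> K ^ n"
    by (simp add: card_PiE)
qed

lemma supp_Cst_mult: "supp (Cst c * F :: 'a::comm_semiring_1 mpoly) \<subseteq> supp F"
  by (auto dest!: supp_mult_subset split: if_splits)

text \<open>Induction on the total degree. If an exponent reaches \<open>k i\<close>, the factor
  \<open>x i ^ k i\<close> is replaced by \<open>R i\<close>, whose degree is below
  \<open>k i\<close>. All resulting monomials have smaller degree, so this ends, and each round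
  multiplies the norm by at most \<open>C\<close>. The rewriting does not look at \<open>s\<close>
  and \<open>x\<close>, so one \<open>G\<close> serves all solutions.\<close>

lemma monomial_reduction:
  assumes C: "1 \<le> C"
    and R: "\<And>i \<alpha>. i < n \<Longrightarrow> \<alpha> \<in> supp (R i) \<Longrightarrow> supp \<alpha> \<subseteq> {..<n} \<and> mdeg \<alpha> < k i"
    and RC: "\<And>i. i < n \<Longrightarrow> mnorm pnorm (R i) \<le> C"
    and sol: "\<And>s x i. (s, x) \<in> Sol \<Longrightarrow> i < n \<Longrightarrow> x i ^ k i = subst (zev s) x (R i)"
    and \<beta>: "supp \<beta> \<subseteq> {..<n}"
  shows "\<exists>G. supp G \<subseteq> expbox n k \<and> mnorm pnorm G \<le> C ^ mdeg \<beta> \<and>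
    (\<forall>(s, x) \<in> Sol. mpow x \<beta> = subst (zev s) x G)"
  using \<beta>
proof (induction "mdeg \<beta>" arbitrary: \<beta> rule: less_induct)
  case less
  show ?case
  proof (cases "\<beta> \<in> expbox n k")
    case True
    have "pnorm 1 \<le> C ^ mdeg \<beta>"
      using pnorm.norm_1 one_le_power[OF C] by (rule order_trans)
    then show ?thesis
      using True by (intro exI[of _ "sgl \<beta> 1"]) (auto simp: zev_subst zev_def hom_distribs)
  next
    case False
    then obtain i where i: "i < n" "k i \<le> coef \<beta> i"
      using less.prems by (auto simp: expbox_def not_less)
    define \<delta> where "\<delta> = \<beta> - sgl i (k i)"
    have \<beta>_eq: "\<beta> = \<delta> + sgl i (k i)"
      using minus_single_add[OF i(2)] by (simp add: \<delta>_def)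
    have \<delta>: "supp \<delta> \<subseteq> {..<n}"
    proof -
      have "supp \<delta> \<subseteq> supp \<beta>"
        unfolding \<delta>_def by (auto simp: in_keys_iff lookup_minus)
      then show ?thesis
        using less.prems by simp
    qed
    have "\<exists>G. supp G \<subseteq> expbox n k \<and> mnorm pnorm G \<le> C ^ mdeg (\<delta> + \<alpha>) \<and>
        (\<forall>(s, x) \<in> Sol. mpow x (\<delta> + \<alpha>) = subst (zev s) x G)" if "\<alpha> \<in> supp (R i)" for \<alpha>
    proof (rule less.hyps)
      show "mdeg (\<delta> + \<alpha>) < mdeg \<beta>"
        using R[OF i(1) that] by (simp add: \<beta>_eq mdeg_add)
      show "supp (\<delta> + \<alpha>) \<subseteq> {..<n}"
        using R[OF i(1) that] \<delta> keys_add[of \<delta> \<alpha>] by blast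
    qed
    then obtain G where G: "\<And>\<alpha>. \<alpha> \<in> supp (R i) \<Longrightarrow> supp (G \<alpha>) \<subseteq> expbox n k"
      "\<And>\<alpha>. \<alpha> \<in> supp (R i) \<Longrightarrow> mnorm pnorm (G \<alpha>) \<le> C ^ mdeg (\<delta> + \<alpha>)"
      "\<And>\<alpha> s x. \<alpha> \<in> supp (R i) \<Longrightarrow> (s, x) \<in> Sol \<Longrightarrow> mpow x (\<delta> + \<alpha>) = subst (zev s) x (G \<alpha>)"
      by (auto simp: Ball_def split_paired_all dest!: choice) metis
    let ?H = "\<Sum>\<alpha>\<in>supp (R i). Cst (coef (R i) \<alpha>) * G \<alpha>"
    have "supp ?H \<subseteq> expbox n k"
      using G(1) supp_Cst_mult keys_sum[of "\<lambda>\<alpha>. Cst (coef (R i) \<alpha>) * G \<alpha>" "supp (R i)"] by blast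
    moreover have "mnorm pnorm ?H \<le> C ^ mdeg \<beta>"
    proof -
      have "mnorm pnorm ?H \<le> (\<Sum>\<alpha>\<in>supp (R i). mnorm pnorm (Cst (coef (R i) \<alpha>) * G \<alpha>))"
        by (rule pnorm.mnorm_sum)
      also have "\<dots> \<le> (\<Sum>\<alpha>\<in>supp (R i). pnorm (coef (R i) \<alpha>) * C ^ (mdeg \<beta> - 1))"
      proof (rule sum_mono)
        fix \<alpha> assume \<alpha>: "\<alpha> \<in> supp (R i)"
        have "mnorm pnorm (G \<alpha>) \<le> C ^ mdeg (\<delta> + \<alpha>)"
          by (rule G(2)[OF \<alpha>])
        also have "mdeg (\<delta> + \<alpha>) \<le> mdeg \<beta> - 1"
          using R[OF i(1) \<alpha>] unfolding \<beta>_eq mdeg_add mdeg_single by linarith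
        then have "C ^ mdeg (\<delta> + \<alpha>) \<le> C ^ (mdeg \<beta> - 1)"
          by (intro power_increasing C)
        finally have "pnorm (coef (R i) \<alpha>) * mnorm pnorm (G \<alpha>) \<le> pnorm (coef (R i) \<alpha>) * C ^ (mdeg \<beta> - 1)"
          by (intro mult_left_mono) simp_all
        then show "mnorm pnorm (Cst (coef (R i) \<alpha>) * G \<alpha>) \<le> pnorm (coef (R i) \<alpha>) * C ^ (mdeg \<beta> - 1)"
          using pnorm.mnorm_single_mult order_trans by blast
      qed
      also have "\<dots> = mnorm pnorm (R i) * C ^ (mdeg \<beta> - 1)"
        by (simp add: mnorm_def sum_distrib_right)
      also have "\<dots> \<le> C * C ^ (mdeg \<beta> - 1)"
        using C by (intro mult_right_mono RC i(1)) simp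
      finally have *: "mnorm pnorm ?H \<le> C * C ^ (mdeg \<beta> - 1)" .
      show ?thesis
      \<comment> \<open>Only a nonzero \<open>R i\<close> guarantees \<open>0 < k i\<close>, hence
        \<open>0 < mdeg \<beta>\<close>, so that the truncated \<open>mdeg \<beta> - 1\<close> is
        harmless. For \<open>R i = 0\<close> the sum is empty.\<close>
      proof (cases "supp (R i) = {}")
        case True
        then show ?thesis
          using C by simp
      next
        case False
        then have "0 < mdeg \<beta>"
          using R[OF i(1)] by (force simp: \<beta>_eq mdeg_add)
        then show ?thesis
          using * by (simp flip: power_Suc)
      qed
    qed
    moreover have "mpow x \<beta> = subst (zev s) x ?H" if sx: "(s, x) \<in> Sol" for s x
    proof -
      have "mpow x \<beta> = mpow x \<delta> * subst (zev s) x (R i)"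
        by (simp add: \<beta>_eq mpow_add sol[OF sx i(1)])
      also have "\<dots> = (\<Sum>\<alpha>\<in>supp (R i). zev s (coef (R i) \<alpha>) * mpow x (\<delta> + \<alpha>))"
        by (simp add: subst_def mpow_add sum_distrib_left mult_ac)
      also have "\<dots> = subst (zev s) x ?H"
        using G(3)[OF _ sx] by (simp add: zev_subst)
      finally show ?thesis .
    qed
    ultimately show ?thesis
      by blast
  qed
qed

text \<open>On the diagonal the variable of the characteristic polynomial adds \<open>1\<close> to
  the norm of an entry; the rest is \<open>norm_det\<close>.\<close>

lemma char_poly_norm:
  assumes A: "A \<in> carrier_mat n n" and B: "\<And>i j. i < n \<Longrightarrow> j < n \<Longrightarrow> pnorm (A $$ (i, j)) \<le> B"
  shows "poly_norm pnorm (char_poly A) \<le> fact n * (1 + B) ^ n"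
  unfolding char_poly_def
proof (rule ppnorm.norm_det)
  show "char_poly_matrix A \<in> carrier_mat n n"
    using A by simp
  fix i j assume ij: "i < n" "j < n"
  have "poly_norm pnorm [:- (A $$ (i, j)):] \<le> B"
    using B[OF ij] pnorm.norm_minus[of "A $$ (i, j)"] by simp
  moreover have "poly_norm pnorm [:0, 1:] \<le> 1"
    using pnorm.norm_1 by simp
  moreover have "poly_norm pnorm ([:0, 1:] + [:- (A $$ (i, j)):]) \<le> poly_norm pnorm [:0, 1:] + poly_norm pnorm [:- (A $$ (i, j)):]"
    by (rule pnorm.poly_norm_add)
  moreover have "0 \<le> B"
    using B[OF ij] pnorm.norm_nonneg order_trans by blast
  ultimately show "poly_norm pnorm (char_poly_matrix A $$ (i, j)) \<le> 1 + B"
    using A ij by (cases "i = j") (auto simp: char_poly_matrix_def)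
qed

text \<open>Modulo the relations, \<open>Q\<close> times a monomial of the box is a combination of
  box monomials; let \<open>A\<close> be the matrix of these combinations. At a solution
  \<open>(s, x)\<close> the vector of the values of the box monomials is an eigenvector of
  \<open>A\<close> evaluated at \<open>s\<close>, with the value of \<open>Q\<close> as eigenvalue.
  So the characteristic polynomial of \<open>A\<close> is a suitable \<open>\<Phi>\<close>; it is
  monic, hence nonzero, and does not depend on the solution.\<close>

lemma elimination:
  fixes Q :: "int mpoly"
  assumes C: "1 \<le> C"
    and R: "\<And>i \<alpha>. i < n \<Longrightarrow> \<alpha> \<in> supp (R i) \<Longrightarrow> supp \<alpha> \<subseteq> {..<n} \<and> mdeg \<alpha> < k i"
    and RC: "\<And>i. i < n \<Longrightarrow> mnorm pnorm (R i) \<le> C"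
    and K: "\<And>i. i < n \<Longrightarrow> 0 < k i \<and> k i \<le> K"
    and sol: "\<And>s x i. (s, x) \<in> Sol \<Longrightarrow> i < n \<Longrightarrow> x i ^ k i = subst (zev s) x (R i)"
    and Q: "mvars Q \<subseteq> {..<n}" "deg_le D Q"
  defines "B \<equiv> 1 + mnorm zabs Q * C ^ (n * K + D)"
  shows "\<exists>\<Phi>. \<Phi> \<noteq> 0 \<and> poly_norm pnorm \<Phi> \<le> (real (K ^ n) * B) ^ (K ^ n) \<and>
    (\<forall>(s, x) \<in> Sol. poly (map_poly (zev s) \<Phi>) (zsubst x Q) = 0)"
proof -
  let ?E = "expbox n k" and ?q = "mnorm zabs Q"
  have fin: "finite ?E" and card: "card ?E \<le> K ^ n"
    using card_expbox[of n k K] K by auto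
  obtain es where es: "set es = ?E" "distinct es"
    using finite_distinct_list[OF fin] by blast
  define N where "N = length es"
  have N: "N \<le> K ^ n"
    using card es distinct_card[OF es(2)] by (simp add: N_def)
  have zero_in: "0 \<in> ?E"
    using K by (auto simp: expbox_def)
  have "\<forall>\<alpha>\<in>?E. \<exists>G. supp G \<subseteq> ?E \<and> mnorm pnorm G \<le> ?q * C ^ (n * K + D) \<and>
      (\<forall>(s, x) \<in> Sol. zsubst x Q * mpow x \<alpha> = subst (zev s) x G)"
  proof
    fix \<alpha> assume \<alpha>: "\<alpha> \<in> ?E"
    have "\<forall>\<gamma>\<in>supp Q. \<exists>G. supp G \<subseteq> ?E \<and> mnorm pnorm G \<le> C ^ mdeg (\<gamma> + \<alpha>) \<and>
      (\<forall>(s, x) \<in> Sol. mpow x (\<gamma> + \<alpha>) = subst (zev s) x G)"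
    proof
      fix \<gamma> assume "\<gamma> \<in> supp Q"
      then have "supp (\<gamma> + \<alpha>) \<subseteq> {..<n}"
        using Q(1) \<alpha> keys_add[of \<gamma> \<alpha>] by (fastforce simp: expbox_def mvars_def)
      then show "\<exists>G. supp G \<subseteq> ?E \<and> mnorm pnorm G \<le> C ^ mdeg (\<gamma> + \<alpha>) \<and>
          (\<forall>(s, x) \<in> Sol. mpow x (\<gamma> + \<alpha>) = subst (zev s) x G)"
        by (intro monomial_reduction[OF C, where R = R]) (use R RC sol in auto)
    qed
    then obtain G where G: "\<And>\<gamma>. \<gamma> \<in> supp Q \<Longrightarrow> supp (G \<gamma>) \<subseteq> ?E"
      "\<And>\<gamma>. \<gamma> \<in> supp Q \<Longrightarrow> mnorm pnorm (G \<gamma>) \<le> C ^ mdeg (\<gamma> + \<alpha>)"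
      "\<And>\<gamma> s x. \<gamma> \<in> supp Q \<Longrightarrow> (s, x) \<in> Sol \<Longrightarrow> mpow x (\<gamma> + \<alpha>) = subst (zev s) x (G \<gamma>)"
      by (auto simp: Ball_def split_paired_all dest!: choice) metis
    let ?H = "\<Sum>\<gamma>\<in>supp Q. Cst [:coef Q \<gamma>:] * G \<gamma>"
    have "supp ?H \<subseteq> ?E"
      using G(1) supp_Cst_mult keys_sum[of "\<lambda>\<gamma>. Cst [:coef Q \<gamma>:] * G \<gamma>" "supp Q"] by blast
    moreover have "mnorm pnorm ?H \<le> ?q * C ^ (n * K + D)"
    proof -
      have "mnorm pnorm ?H \<le> (\<Sum>\<gamma>\<in>supp Q. mnorm pnorm (Cst [:coef Q \<gamma>:] * G \<gamma>))"
        by (rule pnorm.mnorm_sum)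
      also have "\<dots> \<le> (\<Sum>\<gamma>\<in>supp Q. \<bar>real_of_int (coef Q \<gamma>)\<bar> * C ^ (n * K + D))"
      proof (rule sum_mono)
        fix \<gamma> assume \<gamma>: "\<gamma> \<in> supp Q"
        \<comment> \<open>The exponent \<open>n * K + D\<close> bounds the degree of the product of
          a monomial of \<open>Q\<close> and a box monomial, and reduction multiplies the norm by at
          most \<open>C\<close> per degree.\<close>
        have "mdeg \<gamma> \<le> D" "mdeg \<alpha> \<le> n * K"
          using Q(2) \<gamma> K expbox_mdeg[OF \<alpha>] by (auto simp: deg_le_def)
        then have "C ^ mdeg (\<gamma> + \<alpha>) \<le> C ^ (n * K + D)"
          by (intro power_increasing C) (simp add: mdeg_add)
        then have "\<bar>real_of_int (coef Q \<gamma>)\<bar> * mnorm pnorm (G \<gamma>) \<le> \<bar>real_of_int (coef Q \<gamma>)\<bar> * C ^ (n * K + D)"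
          using G(2)[OF \<gamma>] by (intro mult_left_mono) auto
        then show "mnorm pnorm (Cst [:coef Q \<gamma>:] * G \<gamma>) \<le> \<bar>real_of_int (coef Q \<gamma>)\<bar> * C ^ (n * K + D)"
          using pnorm.mnorm_single_mult[of 0 "[:coef Q \<gamma>:]" "G \<gamma>"]
          by (simp add: ring_norm.poly_norm_pCons[OF ring_norm_int] ring_norm.poly_norm_0[OF ring_norm_int])
      qed
      also have "\<dots> = ?q * C ^ (n * K + D)"
        by (simp add: mnorm_def sum_distrib_right)
      finally show ?thesis .
    qed
    moreover have "zsubst x Q * mpow x \<alpha> = subst (zev s) x ?H" if sx: "(s, x) \<in> Sol" for s x
    proof -
      have "zsubst x Q * mpow x \<alpha> = (\<Sum>\<gamma>\<in>supp Q. real_of_int (coef Q \<gamma>) * mpow x (\<gamma> + \<alpha>))"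
        by (simp add: subst_def mpow_add sum_distrib_right mult.assoc)
      also have "\<dots> = subst (zev s) x ?H"
        using G(3)[OF _ sx] by (simp add: zev_subst zev_const)
      finally show ?thesis .
    qed
    ultimately show "\<exists>G. supp G \<subseteq> ?E \<and> mnorm pnorm G \<le> ?q * C ^ (n * K + D) \<and>
        (\<forall>(s, x) \<in> Sol. zsubst x Q * mpow x \<alpha> = subst (zev s) x G)"
      by blast
  qed
  from bchoice[OF this] obtain G where G: "\<And>\<alpha>. \<alpha> \<in> ?E \<Longrightarrow> supp (G \<alpha>) \<subseteq> ?E"
    "\<And>\<alpha>. \<alpha> \<in> ?E \<Longrightarrow> mnorm pnorm (G \<alpha>) \<le> ?q * C ^ (n * K + D)"
    "\<And>\<alpha> s x. \<alpha> \<in> ?E \<Longrightarrow> (s, x) \<in> Sol \<Longrightarrow> zsubst x Q * mpow x \<alpha> = subst (zev s) x (G \<alpha>)"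
    by blast
  define A where "A = mat N N (\<lambda>(i, j). coef (G (es ! i)) (es ! j))"
  have A: "A \<in> carrier_mat N N"
    by (simp add: A_def)
  have es_in: "es ! i \<in> ?E" if "i < N" for i
    using that es(1) nth_mem unfolding N_def by blast
  have "pnorm (A $$ (i, j)) \<le> ?q * C ^ (n * K + D)" if "i < N" "j < N" for i j
  proof -
    have "pnorm (coef (G (es ! i)) (es ! j)) \<le> (\<Sum>\<alpha>\<in>?E. pnorm (coef (G (es ! i)) \<alpha>))"
      using es_in[OF that(2)] fin by (intro member_le_sum) auto
    also have "\<dots> = mnorm pnorm (G (es ! i))"
      using G(1)[OF es_in[OF that(1)]] fin by (simp add: pnorm.mnorm_superset)
    finally show ?thesis
      using G(2)[OF es_in[OF that(1)]] that by (simp add: A_def)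
  qed
  then have "poly_norm pnorm (char_poly A) \<le> fact N * B ^ N"
    unfolding B_def by (rule char_poly_norm[OF A])
  also have "\<dots> \<le> real (K ^ n) ^ N * B ^ N"
  proof (rule mult_right_mono)
    have "(fact N :: real) \<le> real N ^ N"
      using fact_le_power[of N] by simp
    also have "\<dots> \<le> real (K ^ n) ^ N"
      by (rule power_mono) (use N in \<open>auto simp flip: of_nat_power\<close>)
    finally show "fact N \<le> real (K ^ n) ^ N" .
  qed (use C in \<open>simp add: B_def ring_norm.mnorm_nonneg[OF ring_norm_int]\<close>)
  also have "\<dots> = (real (K ^ n) * B) ^ N"
    by (simp add: power_mult_distrib)
  also have "\<dots> \<le> (real (K ^ n) * B) ^ (K ^ n)"
  proof (rule power_increasing[OF N])
    have "0 < N"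
      using zero_in es by (auto simp: N_def)
    then have "1 \<le> real (K ^ n)"
      using N by linarith
    moreover have "1 \<le> B"
      using C by (simp add: B_def ring_norm.mnorm_nonneg[OF ring_norm_int])
    ultimately show "1 \<le> real (K ^ n) * B"
      using mult_mono[of 1 "real (K ^ n)" 1 B] by simp
  qed
  finally have "poly_norm pnorm (char_poly A) \<le> (real (K ^ n) * B) ^ (K ^ n)" .
  moreover have "char_poly A \<noteq> 0"
    using degree_monic_char_poly[OF A] by auto
  moreover have "poly (map_poly (zev s) (char_poly A)) (zsubst x Q) = 0" if sx: "(s, x) \<in> Sol" for s x
  proof -
    define v where "v = vec N (\<lambda>j. mpow x (es ! j))"
    define Az where "Az = map_mat (zev s) A"
    have Az: "Az \<in> carrier_mat N N"
      using A by (simp add: Az_def)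
    \<comment> \<open>All \<open>k i\<close> are positive, so the box contains the monomial
      \<open>1\<close>; its value \<open>1\<close> prevents the vector from vanishing.\<close>
    obtain j where j: "j < N" "es ! j = 0"
      using zero_in es(1) by (metis N_def in_set_conv_nth)
    have "v \<noteq> 0\<^sub>v N"
    proof
      assume "v = 0\<^sub>v N"
      then have "vec_index v j = 0"
        using j by simp
      then show False
        using j by (simp add: v_def)
    qed
    moreover have "Az *\<^sub>v v = zsubst x Q \<cdot>\<^sub>v v"
    proof (rule eq_vecI)
      fix i assume "i < dim_vec (zsubst x Q \<cdot>\<^sub>v v)"
      then have i: "i < N"
        by (simp add: v_def)
      have "vec_index (Az *\<^sub>v v) i = (\<Sum>j = 0..<N. zev s (coef (G (es ! i)) (es ! j)) * mpow x (es ! j))"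
        using i by (simp add: Az_def A_def v_def scalar_prod_def)
      also have "\<dots> = (\<Sum>\<alpha>\<in>?E. zev s (coef (G (es ! i)) \<alpha>) * mpow x \<alpha>)"
        unfolding N_def es(1)[symmetric]
        by (rule sum.reindex_bij_betw) (use es(2) in \<open>simp add: bij_betw_nth lessThan_atLeast0\<close>)
      also have "\<dots> = subst (zev s) x (G (es ! i))"
        using fin G(1)[OF es_in[OF i]] by (simp add: comm_semiring_hom.subst_superset[OF comm_semiring_hom_zev])
      also have "\<dots> = vec_index (zsubst x Q \<cdot>\<^sub>v v) i"
        using i G(3)[OF es_in[OF i] sx] by (simp add: v_def)
      finally show "vec_index (Az *\<^sub>v v) i = vec_index (zsubst x Q \<cdot>\<^sub>v v) i" .
    qed (use Az in \<open>auto simp: v_def\<close>)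
    ultimately have "eigenvalue Az (zsubst x Q)"
      using Az unfolding eigenvalue_def eigenvector_def by (intro exI[of _ v]) (auto simp: v_def)
    then have "poly (char_poly Az) (zsubst x Q) = 0"
      using eigenvalue_root_char_poly[OF Az] by simp
    then show ?thesis
      by (simp add: Az_def comm_ring_hom.char_poly_hom[OF comm_ring_hom_zev A])
  qed
  ultimately show ?thesis
    by blast
qed

section \<open>Lower bounds for positive polynomials on cubes\<close>

lemma pnorm_simps [simp]: "pnorm 0 = 0" "pnorm (pCons a p) = \<bar>real_of_int a\<bar> + pnorm p"
  using ring_norm.poly_norm_0[OF ring_norm_int] ring_norm.poly_norm_pCons[OF ring_norm_int] by auto

section \<open>Positive roots of integer polynomials and limits of roots\<close>

lemma abs_coeff_le_pnorm: "\<bar>real_of_int (coeff p e)\<bar> \<le> pnorm p"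
proof (cases "e \<le> Polynomial.degree p")
  case True
  then show ?thesis
    unfolding poly_norm_def by (intro member_le_sum[where f = "\<lambda>i. \<bar>real_of_int (coeff p i)\<bar>"]) auto
qed (simp add: coeff_eq_0)

lemma abs_zev_le: "\<bar>v\<bar> \<le> 1 \<Longrightarrow> \<bar>zev v p\<bar> \<le> pnorm p"
proof (induction p)
  case (pCons a p)
  have "\<bar>v\<bar> * \<bar>zev v p\<bar> \<le> 1 * pnorm p"
    using pCons by (intro mult_mono) auto
  then show ?case
    using abs_triangle_ineq[of "real_of_int a" "v * zev v p"]
    by (simp add: zev_def hom_distribs abs_mult)
qed (simp add: zev_def)

text \<open>Powers of the variable are split off until the constant coefficient \<open>a\<close> is
  a nonzero integer. Then \<open>1 \<le> \<bar>a\<bar>\<close>, and \<open>\<bar>a\<bar>\<close>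
  equals \<open>v\<close> times the absolute value of the remaining part, at most
  \<open>v * pnorm p\<close> if \<open>v \<le> 1\<close>. For \<open>v > 1\<close> it suffices that
  the norm is at least \<open>1\<close>.\<close>

lemma positive_root_lower_bound:
  assumes "c \<noteq> 0" "zev v c = 0" "0 < v"
  shows "1 / pnorm c \<le> v"
  using assms(1,2)
proof (induction c)
  case (pCons a p)
  have eq: "real_of_int a + v * zev v p = 0"
    using pCons.prems(2) by (simp add: zev_def hom_distribs)
  show ?case
  proof (cases "a = 0")
    case True
    then show ?thesis
      using pCons eq assms(3) by auto
  next
    case False
    then have a: "1 \<le> \<bar>real_of_int a\<bar>"
      by linarith
    show ?thesis
    proof (cases "v \<le> 1")
      case True
      have "1 \<le> \<bar>v * zev v p\<bar>"
        using a eq by linarith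
      also have "\<dots> \<le> v * pnorm p"
        using abs_zev_le[of v p] True assms(3) by (simp add: abs_mult)
      also have "\<dots> \<le> v * (\<bar>real_of_int a\<bar> + pnorm p)"
        using assms(3) by (intro mult_left_mono) auto
      finally show ?thesis
        using a pnorm.norm_nonneg[of p] by (simp add: divide_le_eq del: pnorm.norm_nonneg)
    next
      case False
      have "1 / (\<bar>real_of_int a\<bar> + pnorm p) \<le> 1"
        using a pnorm.norm_nonneg[of p] by (simp add: divide_le_eq del: pnorm.norm_nonneg)
      with False show ?thesis
        by simp
    qed
  qed
qed simp

lemma zev_sum:
  assumes "Polynomial.degree p \<le> e"
  shows "zev s p = (\<Sum>k\<le>e. real_of_int (coeff p k) * s ^ k)"
proof -
  have "zev s p = (\<Sum>k\<le>Polynomial.degree p. real_of_int (coeff p k) * s ^ k)"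
    by (simp add: zev_def poly_altdef)
  also have "\<dots> = (\<Sum>k\<le>e. real_of_int (coeff p k) * s ^ k)"
    using assms by (intro sum.mono_neutral_left) (auto simp: coeff_eq_0)
  finally show ?thesis .
qed

lemma zev_tendsto:
  assumes "Polynomial.degree p \<le> e"
  shows "((\<lambda>s. zev s p / s ^ e) \<longlongrightarrow> real_of_int (coeff p e)) at_top"
proof -
  have "((\<lambda>s :: real. s ^ k / s ^ e) \<longlongrightarrow> (if k = e then 1 else 0)) at_top" if "k \<le> e" for k
  proof -
    have "\<forall>\<^sub>F s :: real in at_top. inverse s ^ (e - k) = s ^ k / s ^ e"
      using eventually_gt_at_top[of 0]
      by eventually_elim (use that in \<open>simp add: power_diff power_inverse field_simps\<close>)
    moreover have "((\<lambda>s :: real. inverse s ^ (e - k)) \<longlongrightarrow> 0 ^ (e - k)) at_top"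
      by (intro tendsto_power tendsto_inverse_0_at_top filterlim_ident)
    ultimately have "((\<lambda>s :: real. s ^ k / s ^ e) \<longlongrightarrow> 0 ^ (e - k)) at_top"
      by (rule Lim_transform_eventually[rotated])
    then show ?thesis
      using that by (simp add: power_0_left split: if_splits)
  qed
  then have "((\<lambda>s. \<Sum>k\<le>e. real_of_int (coeff p k) * (s ^ k / s ^ e)) \<longlongrightarrow>
      (\<Sum>k\<le>e. real_of_int (coeff p k) * (if k = e then 1 else 0))) at_top"
    by (intro tendsto_intros) auto
  moreover have "(\<Sum>k\<le>e. real_of_int (coeff p k) * (if k = e then 1 else 0)) = real_of_int (coeff p e)"
    by (subst sum.remove[of _ e]) auto
  ultimately show ?thesis
    by (simp add: zev_sum[OF assms] sum_divide_distrib)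
qed

text \<open>After division by \<open>s ^ e\<close>, with \<open>e\<close> the largest degree in
  \<open>s\<close> among the coefficients of \<open>\<Phi>\<close>, each coefficient converges to
  its own coefficient of \<open>s ^ e\<close>. Some coefficient does attain degree \<open>e\<close>,
  so the limit polynomial is not zero, and selecting coefficients cannot increase the norm.\<close>

lemma limit_root:
  fixes \<Phi> :: "int poly poly"
  assumes "\<Phi> \<noteq> 0" "filterlim s at_top sequentially" "v \<longlonglongrightarrow> v0"
    and root: "\<And>j. poly (map_poly (zev (s j)) \<Phi>) (v j) = 0"
  shows "\<exists>c. c \<noteq> 0 \<and> pnorm c \<le> poly_norm pnorm \<Phi> \<and> zev v0 c = 0"
proof -
  let ?m = "Polynomial.degree \<Phi>" and ?d = "\<lambda>i. Polynomial.degree (coeff \<Phi> i)"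
  define e where "e = Max (?d ` {..?m})"
  have de: "?d i \<le> e" for i
  proof (cases "i \<le> ?m")
    case True
    then show ?thesis
      unfolding e_def by (intro Max_ge) auto
  qed (simp add: coeff_eq_0)
  define c where "c = map_poly (\<lambda>p. coeff p e) \<Phi>"
  have c: "coeff c i = coeff (coeff \<Phi> i) e" for i
    by (simp add: c_def coeff_map_poly)
  have deg_c: "Polynomial.degree c \<le> ?m"
    unfolding c_def by (rule degree_map_poly_le)
  have "c \<noteq> 0"
  \<comment> \<open>The zero polynomial also has degree \<open>0\<close>, so for
    \<open>e = 0\<close> a coefficient of maximal degree might vanish; the leading coefficient of
    \<open>\<Phi>\<close> is taken instead.\<close>
  proof (cases "e = 0")
    case True
    then have "?d ?m = 0" "coeff \<Phi> ?m \<noteq> 0"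
      using de[of ?m] assms(1) by auto
    then have "coeff c ?m \<noteq> 0"
      using True by (simp add: c) (metis leading_coeff_0_iff)
    then show ?thesis
      by auto
  next
    case False
    have "e \<in> ?d ` {..?m}"
      unfolding e_def by (intro Max_in) auto
    then obtain i where i: "e = ?d i"
      by blast
    then have "coeff c i \<noteq> 0"
      using False by (auto simp: c)
    then show ?thesis
      by auto
  qed
  moreover have "pnorm c \<le> poly_norm pnorm \<Phi>"
  proof -
    have "pnorm c = (\<Sum>i\<le>?m. \<bar>real_of_int (coeff c i)\<bar>)"
      by (rule ring_norm.poly_norm_superset[OF ring_norm_int deg_c])
    also have "\<dots> \<le> (\<Sum>i\<le>?m. pnorm (coeff \<Phi> i))"
      by (intro sum_mono) (simp add: c abs_coeff_le_pnorm)
    finally show ?thesis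
      by (simp add: poly_norm_def)
  qed
  moreover have "zev v0 c = 0"
  proof -
    have deg: "Polynomial.degree (map_poly (zev t) \<Phi>) \<le> ?m" for t
      by (rule degree_map_poly_le)
    have "(\<Sum>i\<le>?m. zev (s j) (coeff \<Phi> i) / s j ^ e * v j ^ i) = 0" for j
    proof -
      have "poly (map_poly (zev (s j)) \<Phi>) (v j) =
          (\<Sum>i\<le>Polynomial.degree (map_poly (zev (s j)) \<Phi>). coeff (map_poly (zev (s j)) \<Phi>) i * v j ^ i)"
        by (rule poly_altdef)
      also have "\<dots> = (\<Sum>i\<le>?m. coeff (map_poly (zev (s j)) \<Phi>) i * v j ^ i)"
        using deg by (intro sum.mono_neutral_left) (auto simp: coeff_eq_0)
      also have "\<dots> = (\<Sum>i\<le>?m. zev (s j) (coeff \<Phi> i) * v j ^ i)"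
        by (simp add: coeff_map_poly zev_def)
      finally have "(\<Sum>i\<le>?m. zev (s j) (coeff \<Phi> i) * v j ^ i) / s j ^ e = 0"
        using root by simp
      then show ?thesis
        by (simp add: sum_divide_distrib)
    qed
    moreover have "(\<lambda>j. \<Sum>i\<le>?m. zev (s j) (coeff \<Phi> i) / s j ^ e * v j ^ i) \<longlonglongrightarrow>
        (\<Sum>i\<le>?m. real_of_int (coeff (coeff \<Phi> i) e) * v0 ^ i)"
      by (intro tendsto_intros assms(3) filterlim_compose[OF zev_tendsto[OF de] assms(2)])
    ultimately have "(\<Sum>i\<le>?m. real_of_int (coeff (coeff \<Phi> i) e) * v0 ^ i) = 0"
      by (simp add: LIMSEQ_const_iff)
    then show ?thesis
      by (simp add: zev_sum[OF deg_c] c)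
  qed
  ultimately show ?thesis
    by blast
qed

lemma comm_semiring_hom_real_of_int: "comm_semiring_hom real_of_int"
  by standard simp_all

lemmas subst_real_of_int_simps [simp] =
  comm_semiring_hom.subst_0[OF comm_semiring_hom_real_of_int]
  comm_semiring_hom.subst_single[OF comm_semiring_hom_real_of_int]
  comm_semiring_hom.subst_add[OF comm_semiring_hom_real_of_int]
  comm_semiring_hom.subst_Var[OF comm_semiring_hom_real_of_int]
  comm_semiring_hom.subst_sum[OF comm_semiring_hom_real_of_int]
  comm_semiring_hom.subst_mult[OF comm_semiring_hom_real_of_int]

section \<open>Minimizers of the perturbed polynomial on the cube\<close>

lemma subst_has_derivative:
  "((\<lambda>t. zsubst (x(i := t)) F) has_real_derivative zsubst (x(i := t)) (pd i F)) (at t)"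
proof (induction F rule: mpoly_induct)
  case (var j F)
  have "((\<lambda>t. (x(i := t)) j) has_real_derivative (if i = j then 1 else 0)) (at t)"
    by (cases "i = j") auto
  from DERIV_mult[OF this var] show ?case
    by (auto simp: pd_Var_mult mult.commute[where 'a = real])
qed (auto simp: pd_add intro!: DERIV_add)

lemma continuous_subst: "continuous_on X (\<lambda>x :: nat \<Rightarrow> real. zsubst x F)"
  unfolding subst_def mpow_def
  by (intro continuous_intros continuous_on_subset[OF continuous_on_product_coordinates]) auto

lemma mnorm_pd:
  assumes "deg_le D Q"
  shows "mnorm zabs (pd i Q) \<le> real D * mnorm zabs Q"
proof -
  let ?m = "mnorm zabs"
  have "?m (pd i Q) \<le> (\<Sum>\<alpha>\<in>supp Q. ?m (sgl (\<alpha> - sgl i 1) (of_nat (coef \<alpha> i) * coef Q \<alpha>)))"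
    unfolding pd_def by (rule ring_norm.mnorm_sum[OF ring_norm_int])
  also have "\<dots> \<le> (\<Sum>\<alpha>\<in>supp Q. real D * \<bar>real_of_int (coef Q \<alpha>)\<bar>)"
  proof (rule sum_mono)
    fix \<alpha> assume "\<alpha> \<in> supp Q"
    then have "coef \<alpha> i \<le> D"
      using assms coef_le_mdeg[of \<alpha> i] by (force simp: deg_le_def)
    then show "?m (sgl (\<alpha> - sgl i 1) (of_nat (coef \<alpha> i) * coef Q \<alpha>)) \<le> real D * \<bar>real_of_int (coef Q \<alpha>)\<bar>"
      by (simp add: ring_norm.mnorm_single[OF ring_norm_int] abs_mult mult_right_mono)
  qed
  finally show ?thesis
    by (simp add: mnorm_def sum_distrib_left)
qed

text \<open>Points are functions on all of \<open>nat\<close> that vanish from \<open>n\<close> on.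
  The cube is then a product of intervals and singletons, compact in the product topology, and a
  single coordinate is varied by function update.\<close>

definition icube :: "nat \<Rightarrow> (nat \<Rightarrow> int) \<Rightarrow> int \<Rightarrow> (nat \<Rightarrow> real) set" where
  "icube n a w = {x. (\<forall>i<n. real_of_int (a i) \<le> x i \<and> x i \<le> real_of_int (a i + w)) \<and> (\<forall>i\<ge>n. x i = 0)}"

lemma compact_icube: "compact (icube n a w)"
proof -
  let ?S = "\<lambda>i. if i < n then {real_of_int (a i)..real_of_int (a i + w)} else {0}"
  have "icube n a w = Pi\<^sub>E UNIV ?S"
    by (force simp: icube_def PiE_def Pi_def not_less)
  moreover have "compactin (product_topology (\<lambda>i. euclidean) UNIV) (Pi\<^sub>E UNIV ?S)"
    by (auto simp: compactin_PiE)
  ultimately show ?thesis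
    by (simp add: euclidean_product_topology)
qed

lemma perturbed_minimum:
  assumes Q: "deg_le D Q" "even D" and w: "0 < w" and s: "0 < (s :: real)"
    and x0: "x0 \<in> icube n a w"
  obtains x where "x \<in> icube n a w"
    and "zsubst x Q \<le> zsubst x0 Q + (\<Sum>i<n. x0 i ^ (D + 2)) / s"
    and "\<And>i. i < n \<Longrightarrow> x i \<noteq> real_of_int (a i) \<Longrightarrow> x i \<noteq> real_of_int (a i + w) \<Longrightarrow>
      x i ^ (D + 1) = - s * zsubst x (pd i Q)"
proof -
  define P where "P x = zsubst x Q + (\<Sum>i<n. x i ^ (D + 2)) / (s * real (D + 2))" for x :: "nat \<Rightarrow> real"
  have "continuous_on (icube n a w) P"
    unfolding P_def
    by (intro continuous_intros continuous_subst continuous_on_subset[OF continuous_on_product_coordinates]) (use s in auto)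
  then obtain x where x: "x \<in> icube n a w" and min: "\<And>y. y \<in> icube n a w \<Longrightarrow> P x \<le> P y"
    using continuous_attains_inf[OF compact_icube] x0 by blast
  have pos: "0 \<le> y ^ (D + 2)" for y :: real
    using Q(2) by (intro zero_le_even_power) simp
  show ?thesis
  proof
    show "x \<in> icube n a w"
      by (rule x)
    have "zsubst x Q \<le> P x"
      unfolding P_def using s pos by (simp add: sum_nonneg del: power_Suc)
    also have "\<dots> \<le> P x0"
      by (rule min[OF x0])
    also have "\<dots> \<le> zsubst x0 Q + (\<Sum>i<n. x0 i ^ (D + 2)) / s"
    proof -
      have "(\<Sum>i<n. x0 i ^ (D + 2)) / (s * real (D + 2)) \<le> (\<Sum>i<n. x0 i ^ (D + 2)) / s"
        using s pos by (intro divide_left_mono sum_nonneg) (auto simp: mult_le_cancel_left1)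
      then show ?thesis
        by (simp add: P_def)
    qed
    finally show "zsubst x Q \<le> zsubst x0 Q + (\<Sum>i<n. x0 i ^ (D + 2)) / s" .
    fix i assume i: "i < n" "x i \<noteq> real_of_int (a i)" "x i \<noteq> real_of_int (a i + w)"
    \<comment> \<open>The coordinate lies strictly between two faces, so moving it by less than
      \<open>r\<close> stays in the cube and its one-variable derivative must vanish.\<close>
    define r where "r = min (x i - real_of_int (a i)) (real_of_int (a i + w) - x i)"
    have r: "0 < r"
      using x i by (force simp: r_def icube_def)
    have "x(i := t) \<in> icube n a w" if "\<bar>x i - t\<bar> < r" for t
      using x i(1) that by (auto simp: icube_def r_def)
    then have loc: "\<forall>t. \<bar>x i - t\<bar> < r \<longrightarrow> P (x(i := x i)) \<le> P (x(i := t))"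
      using min by simp
    have P_upd: "P (x(i := t)) = zsubst (x(i := t)) Q +
        (t ^ (D + 2) + (\<Sum>j\<in>{..<n} - {i}. x j ^ (D + 2))) / (s * real (D + 2))" for t
    proof -
      have "(\<Sum>j<n. (x(i := t)) j ^ (D + 2)) = t ^ (D + 2) + (\<Sum>j\<in>{..<n} - {i}. (x(i := t)) j ^ (D + 2))"
        using i(1) by (subst sum.remove[of _ i]) auto
      also have "(\<Sum>j\<in>{..<n} - {i}. (x(i := t)) j ^ (D + 2)) = (\<Sum>j\<in>{..<n} - {i}. x j ^ (D + 2))"
        by (intro sum.cong) auto
      finally show ?thesis
        by (simp only: P_def)
    qed
    have "((\<lambda>t. P (x(i := t))) has_real_derivative
        (zsubst (x(i := x i)) (pd i Q) + real (D + 2) * x i ^ (D + 1) / (s * real (D + 2)))) (at (x i))"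
      unfolding P_upd
      by (rule derivative_eq_intros subst_has_derivative refl)+ (use s in auto)
    from DERIV_local_min[OF this r loc] have "zsubst x (pd i Q) + x i ^ (D + 1) / s = 0"
      by (simp del: power_Suc)
    then show "x i ^ (D + 1) = - s * zsubst x (pd i Q)"
      using s by (simp add: field_simps)
  qed
qed

text \<open>Which coordinates of the minimizer lie on the lower face, on the upper face or in
  between may change with \<open>s\<close>. There are finitely many such patterns, so one of them
  occurs for infinitely many \<open>s\<close>. Along that subsequence a single system of relations
  holds, and \<open>elimination\<close> gives one polynomial for all its members.\<close>

theorem positive_polynomial_lower_bound:
  fixes Q :: "int mpoly" and a :: "nat \<Rightarrow> int"
  assumes Q: "mvars Q \<subseteq> {..<n}" "deg_le D Q" "even D" and w: "0 < w"
    and C: "1 \<le> C" "\<And>i. i < n \<Longrightarrow> \<bar>real_of_int (a i)\<bar> \<le> C" "\<And>i. i < n \<Longrightarrow> \<bar>real_of_int (a i + w)\<bar> \<le> C"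
      "real D * mnorm zabs Q \<le> C"
    and pos: "\<And>x. x \<in> icube n a w \<Longrightarrow> 0 < zsubst x Q" and y: "y \<in> icube n a w"
  defines "B \<equiv> 1 + mnorm zabs Q * C ^ (n * (D + 1) + D)"
  shows "1 / (real ((D + 1) ^ n) * B) ^ ((D + 1) ^ n) \<le> zsubst y Q"
proof -
  let ?ev = "\<lambda>x. zsubst x Q"
  obtain x0 where x0: "x0 \<in> icube n a w" and min: "\<And>x. x \<in> icube n a w \<Longrightarrow> ?ev x0 \<le> ?ev x"
    using continuous_attains_inf[OF compact_icube _ continuous_subst[where F = Q]] y by blast
  define s where "s j = real (Suc j)" for j
  have "\<exists>x. x \<in> icube n a w \<and> ?ev x \<le> ?ev x0 + (\<Sum>i<n. x0 i ^ (D + 2)) / s j \<and>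
      (\<forall>i<n. x i \<noteq> real_of_int (a i) \<longrightarrow> x i \<noteq> real_of_int (a i + w) \<longrightarrow>
        x i ^ (D + 1) = - s j * zsubst x (pd i Q))" for j
    by (rule perturbed_minimum[OF Q(2,3) w _ x0, of "s j"]) (auto simp: s_def)
  then obtain x where x: "\<And>j. x j \<in> icube n a w"
    "\<And>j. ?ev (x j) \<le> ?ev x0 + (\<Sum>i<n. x0 i ^ (D + 2)) / s j"
    "\<And>j i. i < n \<Longrightarrow> x j i \<noteq> real_of_int (a i) \<Longrightarrow> x j i \<noteq> real_of_int (a i + w) \<Longrightarrow>
        x j i ^ (D + 1) = - s j * zsubst (x j) (pd i Q)"
    by metis
  \<comment> \<open>\<open>0\<close> and \<open>1\<close> stand for the lower and the upper face,
    \<open>2\<close> for strictly in between. The default \<open>0\<close> from \<open>n\<close> on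
    keeps the number of patterns finite.\<close>
  define face where "face j i = (if i < n then if x j i = real_of_int (a i) then 0
      else if x j i = real_of_int (a i + w) then 1 else 2 else (0 :: nat))" for j i
  have "face ` UNIV \<subseteq> {\<theta>. \<forall>i. (i \<in> {..<n} \<longrightarrow> \<theta> i \<in> {0, 1, 2}) \<and> (i \<notin> {..<n} \<longrightarrow> \<theta> i = 0)}"
    by (auto simp: face_def split: if_splits)
  then have "finite (face ` UNIV)"
    by (rule finite_subset) (intro finite_set_of_finite_funs, auto)
  then obtain j0 where inf: "infinite {j. face j = face j0}"
    using pigeonhole_infinite[of UNIV face] by auto
  define \<theta> where "\<theta> = face j0"
  obtain r where r: "strict_mono r" "\<And>j :: nat. face (r j) = \<theta>"
    using infinite_enumerate[OF inf] unfolding \<theta>_def by blast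
  define k where "k i = (if \<theta> i = 2 then D + 1 else 1)" for i
  \<comment> \<open>On a face the relation is linear: the coordinate equals a given integer. In
    between, \<open>[:0, - c:]\<close> is the polynomial \<open>- c * s\<close>, so
    \<open>R i\<close> represents \<open>- s\<close> times the partial derivative.\<close>
  define R where "R i = (if \<theta> i = 0 then Cst [:a i:] else if \<theta> i = 1 then Cst [:a i + w:]
      else Poly_Mapping.map (\<lambda>c. [:0, - c:]) (pd i Q))" for i
  define Sol where "Sol = range (\<lambda>j. (s (r j), x (r j)))"
  have coef_map: "coef (Poly_Mapping.map (\<lambda>c. [:0, - c:]) F) \<alpha> = [:0, - coef F \<alpha>:]" for F :: "int mpoly" and \<alpha>
    by (simp add: Poly_Mapping.map.rep_eq when_def)
  have supp_map: "supp (Poly_Mapping.map (\<lambda>c. [:0, - c:]) F) = supp F" for F :: "int mpoly"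
    by (auto simp: in_keys_iff coef_map)
  have \<theta>_cases: "\<theta> i = 0 \<or> \<theta> i = 1 \<or> \<theta> i = 2" for i
    by (auto simp: \<theta>_def face_def)
  have "\<exists>\<Phi>. \<Phi> \<noteq> 0 \<and> poly_norm pnorm \<Phi> \<le> (real ((D + 1) ^ n) * B) ^ ((D + 1) ^ n) \<and>
    (\<forall>(s, x) \<in> Sol. poly (map_poly (zev s) \<Phi>) (zsubst x Q) = 0)"
    unfolding B_def
  proof (rule elimination[where R = R and k = k])
    fix i assume i: "i < n"
    show "mnorm pnorm (R i) \<le> C"
    proof -
      have "mnorm pnorm (Poly_Mapping.map (\<lambda>c. [:0, - c:]) (pd i Q)) = mnorm zabs (pd i Q)"
        unfolding mnorm_def supp_map coef_map by simp
      then show ?thesis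
        using C(2-4) i mnorm_pd[OF Q(2), of i] by (auto simp: R_def)
    qed
    show "0 < k i \<and> k i \<le> D + 1"
      by (simp add: k_def)
    show "supp \<alpha> \<subseteq> {..<n} \<and> mdeg \<alpha> < k i" if "\<alpha> \<in> supp (R i)" for \<alpha>
    proof (cases "\<theta> i = 2")
      case True
      then have "\<alpha> \<in> supp (pd i Q)"
        using that by (simp add: R_def supp_map)
      moreover from this have "mdeg \<alpha> \<le> D - 1"
        using deg_le_pd[OF Q(2), of i] by (simp add: deg_le_def)
      ultimately show ?thesis
        using mvars_pd[of i Q] Q(1) True by (auto simp: mvars_def k_def)
    next
      case False
      then show ?thesis
        using that \<theta>_cases[of i] by (auto simp: R_def k_def split: if_splits)
    qed
    fix t z assume "(t, z) \<in> Sol"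
    then obtain j where j: "t = s (r j)" "z = x (r j)"
      by (auto simp: Sol_def)
    have fc: "\<theta> i = (if z i = real_of_int (a i) then 0 else if z i = real_of_int (a i + w) then 1 else 2)"
      using i by (simp add: r(2)[of j, symmetric] face_def j)
    show "z i ^ k i = subst (zev t) z (R i)"
    proof (cases "\<theta> i = 2")
      case True
      have "subst (zev t) z (R i) = (\<Sum>\<alpha>\<in>supp (pd i Q). - t * (real_of_int (coef (pd i Q) \<alpha>) * mpow z \<alpha>))"
        using True by (simp add: R_def subst_def supp_map coef_map zev_def hom_distribs mult.assoc)
      also have "\<dots> = - t * zsubst z (pd i Q)"
        by (simp only: subst_def sum_distrib_left)
      also have "\<dots> = z i ^ (D + 1)"
        using x(3)[OF i, of "r j"] True fc by (simp add: j split: if_splits)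
      finally show ?thesis
        using True by (simp add: k_def)
    next
      case False
      then show ?thesis
        using fc by (auto simp: R_def k_def zev_subst zev_const split: if_splits)
    qed
  qed (use C Q in auto)
  then obtain \<Phi> where \<Phi>: "\<Phi> \<noteq> 0" "poly_norm pnorm \<Phi> \<le> (real ((D + 1) ^ n) * B) ^ ((D + 1) ^ n)"
    "\<And>j. poly (map_poly (zev (s (r j))) \<Phi>) (?ev (x (r j))) = 0"
    by (auto simp: Sol_def)
  have s_lim: "filterlim (\<lambda>j. s (r j)) at_top sequentially"
  proof -
    have "filterlim s at_top sequentially"
      unfolding s_def by (intro filterlim_compose[OF filterlim_real_sequentially filterlim_Suc])
    then show ?thesis
      by (rule filterlim_compose[OF _ filterlim_subseq[OF r(1)]])
  qed
  have "(\<lambda>j. ?ev (x (r j))) \<longlonglongrightarrow> ?ev x0"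
  proof (rule tendsto_sandwich)
    show "\<forall>\<^sub>F j in sequentially. ?ev x0 \<le> ?ev (x (r j))"
      using min x(1) by simp
    show "\<forall>\<^sub>F j in sequentially. ?ev (x (r j)) \<le> ?ev x0 + (\<Sum>i<n. x0 i ^ (D + 2)) / s (r j)"
      using x(2) by simp
    have "(\<lambda>j. ?ev x0 + (\<Sum>i<n. x0 i ^ (D + 2)) / s (r j)) \<longlonglongrightarrow> ?ev x0 + 0"
      by (intro tendsto_add tendsto_const tendsto_divide_0[OF tendsto_const] filterlim_at_top_imp_at_infinity s_lim)
    then show "(\<lambda>j. ?ev x0 + (\<Sum>i<n. x0 i ^ (D + 2)) / s (r j)) \<longlonglongrightarrow> ?ev x0"
      by simp
  qed auto
  from limit_root[OF \<Phi>(1) s_lim this \<Phi>(3)] obtain c where c: "c \<noteq> 0" "pnorm c \<le> poly_norm pnorm \<Phi>" "zev (?ev x0) c = 0"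
    by blast
  have "0 < pnorm c"
  proof -
    have "coeff c (Polynomial.degree c) \<noteq> 0"
      using c(1) by simp
    then show ?thesis
      using abs_coeff_le_pnorm[of c "Polynomial.degree c"] by linarith
  qed
  moreover have "pnorm c \<le> (real ((D + 1) ^ n) * B) ^ ((D + 1) ^ n)"
    using c(2) \<Phi>(2) by linarith
  ultimately have "1 / (real ((D + 1) ^ n) * B) ^ ((D + 1) ^ n) \<le> 1 / pnorm c"
    by (intro divide_left_mono) auto
  also have "\<dots> \<le> ?ev x0"
    using positive_root_lower_bound[OF c(1,3)] pos[OF x0] by simp
  also have "\<dots> \<le> ?ev y"
    by (rule min[OF y])
  finally show ?thesis .
qed

section \<open>Running time\<close>

text \<open>Exponents are unary and count with their value. The additional \<open>1\<close> absorbs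
  the constant costs of the calls.\<close>

fun dsize :: "dyadic \<Rightarrow> nat" where
  "dsize (Dyadic s xs e) = Suc (length xs + e)"

lemma length_bit_add: "length (bit_add c xs ys) \<le> Suc (max (length xs) (length ys))"
  by (induction c xs ys rule: bit_add.induct) auto

lemma length_bit_sub: "length (bit_sub c xs ys) = length xs"
  by (induction c xs ys rule: bit_sub.induct) auto

lemma length_bit_mult: "length (bit_mult xs ys) \<le> 2 * length xs + length ys"
proof (induction xs)
  case (Cons x xs)
  then show ?case
    using length_bit_add[of False ys "False # bit_mult xs ys"] by auto
qed simp

lemma length_align:
  "align e e' xs ys = (xs', ys', k) \<Longrightarrow>
    length xs' \<le> length xs + e' \<and> length ys' \<le> length ys + e \<and> k \<le> e + e'"
proof (induction e e' xs ys arbitrary: xs' ys' k rule: align.induct)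
  case (2 e' xs ys)
  then show ?case
    by (fastforce split: prod.splits)
next
  case (3 e xs ys)
  then show ?case
    by (fastforce split: prod.splits)
next
  case (4 e e' xs ys)
  then show ?case
    by (fastforce split: prod.splits)
qed simp

lemma T_bit_add_le: "T_bit_add c xs ys \<le> Suc (length xs + length ys)"
  by (induction c xs ys rule: T_bit_add.induct) auto

lemma T_bit_sub_le: "T_bit_sub c xs ys \<le> Suc (length xs + length ys)"
  by (induction c xs ys rule: T_bit_sub.induct) auto

lemma T_bit_less_le: "T_bit_less c xs ys \<le> Suc (length xs + length ys)"
  by (induction c xs ys rule: T_bit_less.induct) auto

lemma T_align_le: "T_align e e' xs ys \<le> Suc (e + e')"
  by (induction e e' xs ys rule: T_align.induct) auto

lemma T_add_exp_le: "T_add_exp e e' \<le> Suc e"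
  by (induction e e' rule: T_add_exp.induct) auto

lemma T_bit_mult_le: "T_bit_mult xs ys \<le> Suc (length xs) * (2 * length xs + 2 * length ys + 3)"
proof (induction xs)
  case (Cons x xs)
  have "T_bit_add False ys (False # bit_mult xs ys) \<le> 2 * length xs + 2 * length ys + 2"
    using T_bit_add_le[of False ys "False # bit_mult xs ys"] length_bit_mult[of xs ys] by simp
  then have "T_bit_mult (x # xs) ys \<le> T_bit_mult xs ys + (2 * length xs + 2 * length ys + 3)"
    by simp
  with Cons show ?case
    by (simp add: algebra_simps)
qed simp

lemma dsize_dy_add: "dsize (dy_add a b) \<le> 2 * (dsize a + dsize b)"
proof (cases a; cases b)
  fix s xs e t ys e' assume ab: "a = Dyadic s xs e" "b = Dyadic t ys e'"
  obtain xs' ys' k where al: "align e e' xs ys = (xs', ys', k)"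
    by (metis prod_cases3)
  show ?thesis
    using length_align[OF al] length_bit_add[of False xs' ys'] by (auto simp: ab al length_bit_sub)
qed

lemma T_dy_add_le: "T_dy_add a b \<le> 4 * (dsize a + dsize b)"
proof (cases a; cases b)
  fix s xs e t ys e' assume ab: "a = Dyadic s xs e" "b = Dyadic t ys e'"
  obtain xs' ys' k where al: "align e e' xs ys = (xs', ys', k)"
    by (metis prod_cases3)
  show ?thesis
    using length_align[OF al] T_align_le[of e e' xs ys] T_bit_add_le[of False xs' ys']
      T_bit_sub_le[of False xs' ys'] T_bit_sub_le[of False ys' xs'] T_bit_less_le[of False xs' ys']
    by (auto simp: ab al)
qed

lemma T_dy_abs_less_le: "T_dy_abs_less a b \<le> 4 * (dsize a + dsize b)"
proof (cases a; cases b)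
  fix s xs e t ys e' assume ab: "a = Dyadic s xs e" "b = Dyadic t ys e'"
  obtain xs' ys' k where al: "align e e' xs ys = (xs', ys', k)"
    by (metis prod_cases3)
  show ?thesis
    using length_align[OF al] T_align_le[of e e' xs ys] T_bit_less_le[of False xs' ys']
    by (auto simp: ab al)
qed

lemma dsize_dy_mult: "dsize (dy_mult a b) \<le> 2 * (dsize a + dsize b)"
proof (cases a; cases b)
  fix s xs e t ys e' assume ab: "a = Dyadic s xs e" "b = Dyadic t ys e'"
  show ?thesis
    using length_bit_mult[of xs ys] by (auto simp: ab add_exp_eq)
qed

lemma T_dy_mult_le: "T_dy_mult a b \<le> 4 * (dsize a + dsize b) ^ 2"
proof (cases a; cases b)
  fix s xs e t ys e' assume ab: "a = Dyadic s xs e" "b = Dyadic t ys e'"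
  define u where "u = dsize a + dsize b"
  have u: "Suc (length xs) \<le> u" "2 * length xs + 2 * length ys + 3 \<le> 2 * u" "Suc e \<le> u" "1 \<le> u"
    by (auto simp: u_def ab)
  have "T_bit_mult xs ys \<le> u * (2 * u)"
    using T_bit_mult_le[of xs ys] mult_mono[OF u(1,2)] by simp
  moreover have "T_add_exp e e' \<le> u"
    using T_add_exp_le[of e e'] u(3) by linarith
  moreover have "u \<le> u * u"
    using u(4) by simp
  moreover have "T_dy_mult a b = T_bit_mult xs ys + T_add_exp e e' + 1"
    by (simp add: ab)
  ultimately have "T_dy_mult a b \<le> 4 * (u * u)"
    using u(4) by linarith
  then show ?thesis
    by (simp add: u_def power2_eq_square)
qed

lemma dsize_exp:
  assumes "dsize a \<le> 2 ^ \<sigma>" "dsize b \<le> 2 ^ \<sigma>"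
  shows "dsize (dy_add a b) \<le> 2 ^ (\<sigma> + 2)" "dsize (dy_mult a b) \<le> 2 ^ (\<sigma> + 2)"
    and "T_dy_add a b \<le> 2 ^ (2 * \<sigma> + 6)" "T_dy_mult a b \<le> 2 ^ (2 * \<sigma> + 6)"
    "T_dy_abs_less a b \<le> 2 ^ (2 * \<sigma> + 6)"
proof -
  have s: "dsize a + dsize b \<le> 2 ^ (\<sigma> + 1)"
    using assms by simp
  then have sq: "(dsize a + dsize b) ^ 2 \<le> 2 ^ (2 * \<sigma> + 2)"
    using power_mono[OF s, of 2] by (simp flip: power_mult add: mult.commute)
  have lin: "dsize a + dsize b \<le> (dsize a + dsize b) ^ 2"
    by (cases "dsize a + dsize b") (auto simp: power2_eq_square)
  have P: "(2 :: nat) ^ (2 * \<sigma> + 6) = 16 * 2 ^ (2 * \<sigma> + 2)"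
    by (simp add: power_add)
  show "T_dy_add a b \<le> 2 ^ (2 * \<sigma> + 6)"
    using order_trans[OF T_dy_add_le mult_left_mono[OF order_trans[OF lin sq]]] unfolding P by simp
  show "T_dy_abs_less a b \<le> 2 ^ (2 * \<sigma> + 6)"
    using order_trans[OF T_dy_abs_less_le mult_left_mono[OF order_trans[OF lin sq]]] unfolding P by simp
  show "T_dy_mult a b \<le> 2 ^ (2 * \<sigma> + 6)"
    using order_trans[OF T_dy_mult_le mult_left_mono[OF sq]] unfolding P by simp
  show "dsize (dy_add a b) \<le> 2 ^ (\<sigma> + 2)" "dsize (dy_mult a b) \<le> 2 ^ (\<sigma> + 2)"
    using s dsize_dy_add[of a b] dsize_dy_mult[of a b] by simp_all
qed

lemma dsize_quadruple:
  assumes "dsize a \<le> 2 ^ \<sigma>" "dsize b \<le> 2 ^ \<sigma>"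
  shows "dsize (dy_add a b) \<le> 4 * 2 ^ \<sigma>" "dsize (dy_mult a b) \<le> 4 * 2 ^ \<sigma>"
  using dsize_exp(1,2)[OF assms] by simp_all

lemma dsize_simps [simp]: "dsize (dy_half a) = Suc (dsize a)" "dsize (dy_abs a) = dsize a"
  by (cases a; simp)+

lemma T_unit [simp]: "T_dy_half a = 1" "T_dy_abs a = 1"
  by (cases a; simp)+

text \<open>
  All sizes and running times are bounded by powers of two, so that estimates become linear in the
  exponents. Every operation on numbers at most quadruples the maximal size, hence the growth along a
  recursion is bounded by its depth.
\<close>

fun leaves_le :: "nat \<Rightarrow> horner \<Rightarrow> bool" where
  "leaves_le \<sigma> (Coeff a) \<longleftrightarrow> dsize a \<le> 2 ^ \<sigma>"
| "leaves_le \<sigma> Zero \<longleftrightarrow> True"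
| "leaves_le \<sigma> (Horner p q) \<longleftrightarrow> leaves_le \<sigma> p \<and> leaves_le \<sigma> q"

fun hdepth :: "horner \<Rightarrow> nat" where
  "hdepth (Coeff a) = 0"
| "hdepth Zero = 0"
| "hdepth (Horner p q) = Suc (max (hdepth p) (hdepth q))"

lemma pow2_mono: "a \<le> (2 :: nat) ^ x \<Longrightarrow> x \<le> y \<Longrightarrow> a \<le> 2 ^ y"
  by (erule order_trans) (rule power_increasing, auto)

lemma leaves_le_mono: "leaves_le \<sigma> p \<Longrightarrow> \<sigma> \<le> \<sigma>' \<Longrightarrow> leaves_le \<sigma>' p"
  by (induction p) (auto intro: pow2_mono)

text \<open>Adding a few costs bounded by the same power of two raises the exponent by
  \<open>2\<close>, or by \<open>3\<close> for six summands. Shorter sums are padded with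
  \<open>0\<close>. Used once per level of a recursion, this turns into a multiple of the
  depth.\<close>

lemma pow2_sum3:
  assumes "a \<le> (2 :: nat) ^ x" "b \<le> 2 ^ x" "c \<le> 2 ^ x" "x + 2 \<le> y"
  shows "a + b + c \<le> 2 ^ y"
  using assms(1-3) by (intro pow2_mono[OF _ assms(4)]) simp

lemma pow2_sum6:
  assumes "a \<le> (2 :: nat) ^ x" "b \<le> 2 ^ x" "c \<le> 2 ^ x" "d \<le> 2 ^ x" "e \<le> 2 ^ x" "f \<le> 2 ^ x" "x + 3 \<le> y"
  shows "a + b + c + d + e + f \<le> 2 ^ y"
  using assms(1-6) by (intro pow2_mono[OF _ assms(7)]) (simp add: power_add)

section \<open>Sizes and costs of operations on Horner terms\<close>

lemma h_add_size:
  "leaves_le \<sigma> p \<Longrightarrow> leaves_le \<sigma> q \<Longrightarrow> leaves_le (\<sigma> + 2) (h_add p q)"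
  "hdepth (h_add p q) \<le> max (hdepth p) (hdepth q)"
  by (induction p q rule: h_add.induct) (auto intro: dsize_quadruple leaves_le_mono pow2_mono)

text \<open>Two calls of smaller depth and one unit step raise the exponent by \<open>2\<close> per
  level; the \<open>8\<close> covers one operation on coefficients.\<close>

lemma T_h_add_le:
  "leaves_le \<sigma> p \<Longrightarrow> leaves_le \<sigma> q \<Longrightarrow> T_h_add p q \<le> 2 ^ (2 * \<sigma> + 8 + 2 * hdepth p)"
proof (induction p q rule: h_add.induct)
  case (2 a b)
  then have "T_dy_add a b \<le> 2 ^ (2 * \<sigma> + 6)"
    by (intro dsize_exp) auto
  then have "T_dy_add a b + 1 + 0 \<le> 2 ^ (2 * \<sigma> + 8)"
    by (rule pow2_sum3) auto
  then show ?case
    by simp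
next
  case (3 p p' q q')
  have "T_h_add p q + T_h_add p' q' + 1 \<le> 2 ^ (2 * \<sigma> + 8 + 2 * hdepth (Horner p p'))"
    using 3 by (intro pow2_sum3[where x = "2 * \<sigma> + 8 + 2 * max (hdepth p) (hdepth p')"])
      (auto intro: pow2_mono)
  then show ?case
    by simp
qed simp_all

lemma h_smult_size:
  assumes "dsize c \<le> 2 ^ \<sigma>"
  shows "leaves_le \<sigma> p \<Longrightarrow> leaves_le (\<sigma> + 2) (h_smult c p)" "hdepth (h_smult c p) = hdepth p"
  using assms by (induction p) (auto intro: dsize_quadruple)

lemma T_h_smult_le:
  assumes "dsize c \<le> 2 ^ \<sigma>"
  shows "leaves_le \<sigma> p \<Longrightarrow> T_h_smult c p \<le> 2 ^ (2 * \<sigma> + 8 + 2 * hdepth p)"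
proof (induction p)
  case (Coeff a)
  then have "T_dy_mult c a \<le> 2 ^ (2 * \<sigma> + 6)"
    using assms by (intro dsize_exp) auto
  then have "T_dy_mult c a + 1 + 0 \<le> 2 ^ (2 * \<sigma> + 8)"
    by (rule pow2_sum3) auto
  then show ?case
    by simp
next
  case (Horner p q)
  have "T_h_smult c p + T_h_smult c q + 1 \<le> 2 ^ (2 * \<sigma> + 8 + 2 * hdepth (Horner p q))"
    using Horner by (intro pow2_sum3[where x = "2 * \<sigma> + 8 + 2 * max (hdepth p) (hdepth q)"])
      (auto intro: pow2_mono)
  then show ?case
    by simp
qed simp

text \<open>Each level applies one scalar multiplication and one addition, and each of them adds
  \<open>2\<close> to the size exponent, hence \<open>4\<close> per unit of depth. The rate
  \<open>14\<close> for the time dominates the cost of these operations on terms that have already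
  grown.\<close>

lemma taylor_shift_size:
  assumes "\<forall>m\<in>set ms. dsize m \<le> 2 ^ \<sigma>" "leaves_le \<sigma> p"
  shows "leaves_le (\<sigma> + 4 * hdepth p) (taylor_shift ms p) \<and> hdepth (taylor_shift ms p) \<le> hdepth p \<and>
    T_taylor_shift ms p \<le> 2 ^ (2 * \<sigma> + 14 * hdepth p + 8)"
  using assms
proof (induction ms p rule: taylor_shift.induct)
  case (4 m ms p q)
  define r where "r = taylor_shift (m # ms) q"
  define M where "M = max (hdepth p) (hdepth q)"
  let ?\<rho> = "\<sigma> + 4 * M" and ?p = "taylor_shift ms p"
  have IHq: "leaves_le (\<sigma> + 4 * hdepth q) r" "hdepth r \<le> hdepth q"
    "T_taylor_shift (m # ms) q \<le> 2 ^ (2 * \<sigma> + 14 * hdepth q + 8)"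
    using 4(1,3,4) by (auto simp: r_def)
  have IHp: "leaves_le (\<sigma> + 4 * hdepth p) ?p" "hdepth ?p \<le> hdepth p"
    "T_taylor_shift ms p \<le> 2 ^ (2 * \<sigma> + 14 * hdepth p + 8)"
    using 4(2)[OF r_def] 4(3,4) by auto
  have r: "leaves_le ?\<rho> r" "hdepth r \<le> M" and p: "leaves_le ?\<rho> ?p" "hdepth ?p \<le> M"
    using IHq(1,2) IHp(1,2) by (auto simp: M_def elim: leaves_le_mono)
  have m: "dsize m \<le> 2 ^ ?\<rho>"
    using 4(3) by (auto intro: pow2_mono)
  have rm: "leaves_le (?\<rho> + 2) (h_smult m r)" "hdepth (h_smult m r) = hdepth r"
    using h_smult_size[OF m] r by auto
  have hr: "leaves_le (?\<rho> + 2) (Horner ?p r)" "hdepth (Horner ?p r) \<le> Suc M"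
    using r p by (auto elim: leaves_le_mono)
  have "leaves_le (\<sigma> + 4 * Suc M) (h_add (Horner ?p r) (h_smult m r))"
    by (rule leaves_le_mono[OF h_add_size(1)[OF hr(1) rm(1)]]) simp
  moreover have "hdepth (h_add (Horner ?p r) (h_smult m r)) \<le> Suc M"
    using h_add_size(2)[of "Horner ?p r" "h_smult m r"] hr(2) rm(2) r(2) by linarith
  moreover have "T_taylor_shift (m # ms) q + T_taylor_shift ms p + T_h_smult m r +
      T_h_add (Horner ?p r) (h_smult m r) + 1 + 0 \<le> 2 ^ (2 * \<sigma> + 14 * Suc M + 8)"
  \<comment> \<open>\<open>2 * \<sigma> + 14 * M + 19\<close> is \<open>3\<close> below the exponent
    claimed for depth \<open>Suc M\<close>. The costliest operation at this level is the addition,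
    with exponent at most \<open>2 * (\<sigma> + 4 * M + 2) + 8 + 2 * Suc M\<close>.\<close>
  proof (rule pow2_sum6[where x = "2 * \<sigma> + 14 * M + 19"])
    show "T_taylor_shift (m # ms) q \<le> 2 ^ (2 * \<sigma> + 14 * M + 19)"
      "T_taylor_shift ms p \<le> 2 ^ (2 * \<sigma> + 14 * M + 19)"
      by (rule pow2_mono[OF IHq(3)] pow2_mono[OF IHp(3)], simp add: M_def)+
    show "T_h_smult m r \<le> 2 ^ (2 * \<sigma> + 14 * M + 19)"
      by (rule pow2_mono[OF T_h_smult_le[OF m r(1)]]) (use r(2) in simp)
    show "T_h_add (Horner ?p r) (h_smult m r) \<le> 2 ^ (2 * \<sigma> + 14 * M + 19)"
      by (rule pow2_mono[OF T_h_add_le[OF hr(1) rm(1)]]) (use hr(2) in \<open>simp del: hdepth.simps\<close>)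
  qed auto
  ultimately show ?case
    by (simp add: Let_def M_def flip: r_def)
qed (auto elim: leaves_le_mono)

lemma h_abs_eval_size:
  assumes "dsize u \<le> 2 ^ \<sigma>" "leaves_le \<sigma> p"
  shows "dsize (h_abs_eval u p) \<le> 2 ^ (\<sigma> + 4 * hdepth p) \<and>
    T_h_abs_eval u p \<le> 2 ^ (2 * \<sigma> + 10 * hdepth p + 8)"
  using assms(2)
proof (induction p)
  case (Coeff a)
  have "(2 :: nat) \<le> 2 ^ (2 * \<sigma> + 8)"
    by (rule pow2_mono[of _ 1]) auto
  then show ?case
    using Coeff by simp
next
  case (Horner p q)
  define M where "M = max (hdepth p) (hdepth q)"
  let ?\<rho> = "\<sigma> + 4 * M" and ?a = "h_abs_eval u p" and ?b = "h_abs_eval u q"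
  have ab: "dsize ?a \<le> 2 ^ ?\<rho>" "dsize ?b \<le> 2 ^ ?\<rho>" "dsize u \<le> 2 ^ ?\<rho>"
    using Horner assms(1) by (auto simp: M_def intro: pow2_mono)
  note ub = dsize_exp[OF ab(3,2)]
  have a: "dsize ?a \<le> 2 ^ (?\<rho> + 2)"
    by (rule pow2_mono[OF ab(1)]) simp
  note s = dsize_exp[OF a ub(2)]
  have "T_h_abs_eval u p + T_h_abs_eval u q + T_dy_mult u ?b + T_dy_add ?a (dy_mult u ?b) + 1 + 0 \<le>
      2 ^ (2 * \<sigma> + 10 * Suc M + 8)"
  proof (rule pow2_sum6[where x = "2 * \<sigma> + 10 * M + 15"])
    show "T_h_abs_eval u p \<le> 2 ^ (2 * \<sigma> + 10 * M + 15)" "T_h_abs_eval u q \<le> 2 ^ (2 * \<sigma> + 10 * M + 15)"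
      using Horner by (auto simp: M_def intro: pow2_mono)
    show "T_dy_mult u ?b \<le> 2 ^ (2 * \<sigma> + 10 * M + 15)"
      by (rule pow2_mono[OF ub(4)]) simp
    show "T_dy_add ?a (dy_mult u ?b) \<le> 2 ^ (2 * \<sigma> + 10 * M + 15)"
      by (rule pow2_mono[OF s(3)]) simp
  qed auto
  moreover have "dsize (dy_add ?a (dy_mult u ?b)) \<le> 2 ^ (\<sigma> + 4 * Suc M)"
    by (rule pow2_mono[OF s(1)]) simp
  ultimately show ?case
    by (simp add: M_def)
qed simp

lemma h_const_size: "leaves_le \<sigma> p \<Longrightarrow> dsize (h_const p) \<le> 2 ^ \<sigma> \<and> T_h_const p \<le> Suc (hdepth p)"
  by (induction p) auto

lemma Suc_le_pow2: "Suc m \<le> 2 ^ m"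
  using less_exp[of m] by (simp add: Suc_le_eq)

lemma T_centered_test_le:
  assumes "dsize u \<le> 2 ^ \<sigma>" "\<forall>m\<in>set ms. dsize m \<le> 2 ^ \<sigma>" "leaves_le \<sigma> p" "hdepth p \<le> D"
  shows "T_centered_test u ms p \<le> 2 ^ (2 * \<sigma> + 18 * D + 13)"
proof -
  define t where "t = taylor_shift ms p"
  define c where "c = h_const t"
  let ?\<rho> = "\<sigma> + 4 * D" and ?x = "2 * \<sigma> + 18 * D + 10"
  have t: "leaves_le ?\<rho> t" "hdepth t \<le> D" "T_taylor_shift ms p \<le> 2 ^ ?x"
    using taylor_shift_size[OF assms(2,3)] assms(4) unfolding t_def
    by (auto elim!: leaves_le_mono pow2_mono)
  have u: "dsize u \<le> 2 ^ ?\<rho>"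
    using assms(1) by (rule pow2_mono) simp
  have c: "dsize c \<le> 2 ^ ?\<rho>" "T_h_const t \<le> 2 ^ ?x"
  proof -
    show "dsize c \<le> 2 ^ ?\<rho>"
      using h_const_size[OF t(1)] by (simp add: c_def)
    have "T_h_const t \<le> 2 ^ hdepth t"
      using h_const_size[OF t(1)] Suc_le_pow2 order_trans by blast
    then show "T_h_const t \<le> 2 ^ ?x"
      by (rule pow2_mono) (use t(2) in simp)
  qed
  have e: "dsize (h_abs_eval u t) \<le> 2 ^ (?\<rho> + 4 * D + 2)" "T_h_abs_eval u t \<le> 2 ^ ?x"
    by (rule pow2_mono[OF conjunct1[OF h_abs_eval_size[OF u t(1)]]], use t(2) in simp,
      rule pow2_mono[OF conjunct2[OF h_abs_eval_size[OF u t(1)]]], use t(2) in simp)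
  have cc: "dsize (dy_add c c) \<le> 2 ^ (?\<rho> + 4 * D + 2)" "T_dy_add c c \<le> 2 ^ ?x"
    by (rule pow2_mono[OF dsize_exp(1)[OF c(1) c(1)]], simp, rule pow2_mono[OF dsize_exp(3)[OF c(1) c(1)]], simp)
  have "T_dy_abs_less (h_abs_eval u t) (dy_add c c) \<le> 2 ^ ?x"
    by (rule pow2_mono[OF dsize_exp(5)[OF e(1) cc(1)]]) simp
  then have "T_taylor_shift ms p + T_h_const t + T_h_abs_eval u t + T_dy_add c c +
      T_dy_abs_less (h_abs_eval u t) (dy_add c c) + 1 \<le> 2 ^ (2 * \<sigma> + 18 * D + 13)"
    by (intro pow2_sum6[where x = ?x] t c e cc) auto
  then show ?thesis
    by (simp add: Let_def c_def t_def)
qed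

section \<open>Cost of testing and subdividing a single cube\<close>

lemma translate_size:
  assumes "dsize h \<le> 2 ^ \<sigma>"
  shows "\<forall>a\<in>set as. dsize a \<le> 2 ^ \<sigma> \<Longrightarrow> (\<forall>a\<in>set (translate h as). dsize a \<le> 2 ^ (\<sigma> + 2)) \<and>
    T_translate h as \<le> 2 ^ (2 * \<sigma> + 6 + 2 * length as)"
proof (induction as)
  case (Cons a as)
  then have a: "dsize a \<le> 2 ^ \<sigma>"
    by simp
  note s = dsize_exp[OF a assms]
  have "T_dy_add a h + T_translate h as + 1 \<le> 2 ^ (2 * \<sigma> + 6 + 2 * length (a # as))"
    using Cons s(3) by (intro pow2_sum3[where x = "2 * \<sigma> + 6 + 2 * length as"]) (auto elim: pow2_mono)
  then show ?case
    using Cons s(1) by simp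
qed simp

lemma T_append_eq [simp]: "T_append xs ys = Suc (length xs)"
  by (induction xs) auto

text \<open>Halving the width and adding it to the corner raise the size exponent from
  \<open>\<sigma>\<close> to \<open>\<sigma> + 3\<close>. With this value
  \<open>T_centered_test_le\<close> gives the constant \<open>19\<close>, and summing up gives
  \<open>22\<close>.\<close>

lemma T_accepted_le:
  assumes "\<forall>a\<in>set as. dsize a \<le> 2 ^ \<sigma>" "dsize w \<le> 2 ^ \<sigma>" "leaves_le \<sigma> p" "leaves_le \<sigma> g"
    and "hdepth p \<le> D" "hdepth g \<le> D"
  shows "T_accepted p g (as, w) \<le> 2 ^ (2 * \<sigma> + 18 * D + 2 * length as + 22)"
proof -
  define h where "h = dy_half w"
  define m where "m = translate h as"
  let ?x = "2 * \<sigma> + 18 * D + 2 * length as + 19"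
  have h: "dsize h \<le> 2 ^ (\<sigma> + 1)"
    using add_mono[OF assms(2) one_le_power[of 2 \<sigma>]] by (simp add: h_def)
  have as: "\<forall>a\<in>set as. dsize a \<le> 2 ^ (\<sigma> + 1)"
    using assms(1) by (auto elim: pow2_mono)
  have m: "\<forall>a\<in>set m. dsize a \<le> 2 ^ (\<sigma> + 3)" "T_translate h as \<le> 2 ^ ?x"
  proof -
    have e: "\<sigma> + 1 + 2 = \<sigma> + 3"
      by simp
    show "\<forall>a\<in>set m. dsize a \<le> 2 ^ (\<sigma> + 3)"
      using translate_size[OF h as] unfolding m_def e by blast
    have "T_translate h as \<le> 2 ^ (2 * (\<sigma> + 1) + 6 + 2 * length as)"
      using translate_size[OF h as] by blast
    then show "T_translate h as \<le> 2 ^ ?x"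
      by (rule pow2_mono) simp
  qed
  have h3: "dsize h \<le> 2 ^ (\<sigma> + 3)"
    using h by (rule pow2_mono) simp
  have ct: "T_centered_test h ms q \<le> 2 ^ ?x"
    if "\<forall>m\<in>set ms. dsize m \<le> 2 ^ (\<sigma> + 3)" "leaves_le \<sigma> q" "hdepth q \<le> D" for ms q
    by (rule pow2_mono[OF T_centered_test_le[OF h3 that(1) leaves_le_mono[OF that(2)] that(3)]]) auto
  have "Suc (length m) \<le> 2 ^ ?x"
    using Suc_le_pow2[of "length as"] by (rule order_trans[rotated, OF pow2_mono]) (auto simp: m_def)
  then have "1 + T_translate h as + T_centered_test h m p + T_append m m + T_centered_test h (m @ m) g + 1
      \<le> 2 ^ (2 * \<sigma> + 18 * D + 2 * length as + 22)"
    by (intro pow2_sum6[where x = ?x] m ct assms) (use m(1) in auto)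
  then show ?thesis
    by (simp add: Let_def h_def m_def)
qed

lemma cons_all_eq [simp]: "cons_all a xss = map ((#) a) xss"
  by (induction xss) auto

lemma T_cons_all_eq [simp]: "T_cons_all a xss = Suc (length xss)"
  by (induction xss) auto

lemma with_width_eq [simp]: "with_width h ass = map (\<lambda>as. (as, h)) ass"
  by (induction ass) auto

lemma T_with_width_eq [simp]: "T_with_width h ass = Suc (length ass)"
  by (induction ass) auto

lemma subcorners_size:
  assumes "dsize h \<le> 2 ^ \<sigma>"
  shows "\<forall>a\<in>set as. dsize a \<le> 2 ^ \<sigma> \<Longrightarrow>
    length (subcorners h as) = 2 ^ length as \<and>
    (\<forall>bs\<in>set (subcorners h as). length bs = length as \<and> (\<forall>b\<in>set bs. dsize b \<le> 2 ^ (\<sigma> + 2))) \<and>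
    T_subcorners h as \<le> 2 ^ (2 * \<sigma> + 8 + 3 * length as)"
proof (induction as)
  case (Cons a as)
  then have a: "dsize a \<le> 2 ^ \<sigma>" "dsize a \<le> 2 ^ (\<sigma> + 2)"
    by (auto intro: pow2_mono[of _ \<sigma>])
  note s = dsize_exp[OF a(1) assms]
  have "Suc (2 ^ length as) \<le> (2 :: nat) ^ (2 * \<sigma> + 8 + 3 * length as)"
    by (rule pow2_mono[where x = "Suc (length as)"]) auto
  moreover have "T_dy_add a h \<le> 2 ^ (2 * \<sigma> + 8 + 3 * length as)"
    by (rule pow2_mono[OF s(3)]) simp
  ultimately have "T_subcorners h as + Suc (2 ^ length as) + T_dy_add a h + Suc (2 ^ length as) +
      Suc (2 ^ length as) + 1 \<le> 2 ^ (2 * \<sigma> + 8 + 3 * length (a # as))"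
    using Cons by (intro pow2_sum6[where x = "2 * \<sigma> + 8 + 3 * length as"]) auto
  then show ?case
    using Cons a(2) s(1) by (auto simp: Let_def)
qed simp

section \<open>Size of the gradient product and of the encoded input\<close>

lemma h_deriv_size:
  "leaves_le \<sigma> p \<Longrightarrow> leaves_le (\<sigma> + 2 * hdepth p) (h_deriv i p) \<and> hdepth (h_deriv i p) \<le> hdepth p \<and>
    T_h_deriv i p \<le> 2 ^ (2 * \<sigma> + 8 * hdepth p + 8)"
proof (induction i p rule: h_deriv.induct)
  case (3 p q)
  define M where "M = max (hdepth p) (hdepth q)"
  let ?\<rho> = "\<sigma> + 2 * M" and ?r = "Horner Zero (h_deriv 0 q)"
  have q: "leaves_le ?\<rho> q" "leaves_le ?\<rho> ?r" "hdepth ?r \<le> Suc M" "hdepth q \<le> M"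
    using 3 by (auto simp: M_def elim: leaves_le_mono)
  have "leaves_le (?\<rho> + 2) (h_add q ?r)"
    by (rule h_add_size(1)[OF q(1,2)])
  moreover have "hdepth (h_add q ?r) \<le> Suc M"
    using h_add_size(2)[of q ?r] q(3,4) by linarith
  moreover have "T_h_deriv 0 q + T_h_add q ?r + 1 \<le> 2 ^ (2 * \<sigma> + 8 * Suc M + 8)"
  proof (rule pow2_sum3[where x = "2 * \<sigma> + 8 * M + 14"])
    show "T_h_deriv 0 q \<le> 2 ^ (2 * \<sigma> + 8 * M + 14)"
      using 3 by (auto simp: M_def elim: pow2_mono)
    show "T_h_add q ?r \<le> 2 ^ (2 * \<sigma> + 8 * M + 14)"
      by (rule pow2_mono[OF T_h_add_le[OF q(1,2)]]) (use q(4) in simp)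
  qed auto
  ultimately show ?case
    by (simp add: M_def)
next
  case (4 i p q)
  define M where "M = max (hdepth p) (hdepth q)"
  have "T_h_deriv i p + T_h_deriv (Suc i) q + 1 \<le> 2 ^ (2 * \<sigma> + 8 * Suc M + 8)"
    by (rule pow2_sum3[where x = "2 * \<sigma> + 8 * M + 14"]) (use 4 in \<open>auto simp: M_def elim: pow2_mono\<close>)
  moreover have "leaves_le (\<sigma> + 2 * Suc M) (h_deriv i p)" "leaves_le (\<sigma> + 2 * Suc M) (h_deriv (Suc i) q)"
    using 4 by (auto simp: M_def elim: leaves_le_mono)
  ultimately show ?case
    using 4 by (auto simp: M_def)
qed simp_all

lemma h_tensor_size:
  assumes "leaves_le \<sigma> q"
  shows "leaves_le \<sigma> p \<Longrightarrow> leaves_le (\<sigma> + 2) (h_tensor p q) \<and> hdepth (h_tensor p q) \<le> hdepth p + hdepth q \<and>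
    T_h_tensor p q \<le> 2 ^ (2 * \<sigma> + 10 + 2 * hdepth q + 2 * hdepth p)"
proof (induction p)
  case (Coeff a)
  then have a: "dsize a \<le> 2 ^ \<sigma>"
    by simp
  have "T_h_smult a q + 1 + 0 \<le> 2 ^ (2 * \<sigma> + 10 + 2 * hdepth q)"
    using T_h_smult_le[OF a assms] by (rule pow2_sum3) auto
  then show ?case
    using h_smult_size[OF a] assms by simp
next
  case (Horner p p')
  have "T_h_tensor p q + T_h_tensor p' q + 1 \<le> 2 ^ (2 * \<sigma> + 10 + 2 * hdepth q + 2 * hdepth (Horner p p'))"
    by (rule pow2_sum3[where x = "2 * \<sigma> + 10 + 2 * hdepth q + 2 * max (hdepth p) (hdepth p')"])
      (use Horner in \<open>auto elim: pow2_mono\<close>)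
  then show ?case
    using Horner by auto
qed simp

text \<open>The size exponent collects \<open>2 * D\<close> from the derivative, \<open>2\<close>
  from the product and \<open>2\<close> from each of the \<open>i\<close> additions. The depth
  doubles because \<open>h_tensor\<close> continues every coefficient of one factor by the other
  factor.\<close>

lemma h_grad_prod_size:
  assumes "leaves_le \<sigma> p"
  defines "D \<equiv> hdepth p"
  shows "leaves_le (\<sigma> + 2 * D + 2 + 2 * i) (h_grad_prod i p) \<and> hdepth (h_grad_prod i p) \<le> 2 * D \<and>
    T_h_grad_prod i p \<le> 2 ^ (2 * \<sigma> + 8 * D + 5 * i + 16)"
proof (induction i)
  case (Suc i)
  define q where "q = h_deriv i p"
  let ?G = "h_grad_prod i p" and ?\<rho> = "\<sigma> + 2 * D + 2 + 2 * i" and ?x = "2 * \<sigma> + 8 * D + 5 * i + 18"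
  have q: "leaves_le (\<sigma> + 2 * D) q" "hdepth q \<le> D" "T_h_deriv i p \<le> 2 ^ (2 * \<sigma> + 8 * D + 8)"
    using h_deriv_size[OF assms(1), of i] by (auto simp: q_def D_def)
  note t = h_tensor_size[OF q(1) q(1)]
  have tq: "leaves_le ?\<rho> (h_tensor q q)" "hdepth (h_tensor q q) \<le> 2 * D"
    using t q(2) by (auto elim: leaves_le_mono)
  have "leaves_le (?\<rho> + 2) (h_add ?G (h_tensor q q))"
    by (rule h_add_size(1)) (use Suc tq in auto)
  moreover have "hdepth (h_add ?G (h_tensor q q)) \<le> 2 * D"
    using h_add_size(2)[of ?G "h_tensor q q"] Suc tq by linarith
  moreover have "T_h_deriv i p + T_h_grad_prod i p + T_h_tensor q q + T_h_add ?G (h_tensor q q) + 1 + 0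
      \<le> 2 ^ (2 * \<sigma> + 8 * D + 5 * Suc i + 16)"
  proof (rule pow2_sum6[where x = ?x])
    show "T_h_deriv i p \<le> 2 ^ ?x"
      by (rule pow2_mono[OF q(3)]) simp
    show "T_h_grad_prod i p \<le> 2 ^ ?x"
      using Suc by (auto elim: pow2_mono)
    have "T_h_tensor q q \<le> 2 ^ (2 * (\<sigma> + 2 * D) + 10 + 2 * hdepth q + 2 * hdepth q)"
      using t by blast
    then show "T_h_tensor q q \<le> 2 ^ ?x"
      by (rule pow2_mono) (use q(2) in simp)
    have "T_h_add ?G (h_tensor q q) \<le> 2 ^ (2 * ?\<rho> + 8 + 2 * hdepth ?G)"
      by (rule T_h_add_le) (use Suc tq in auto)
    then show "T_h_add ?G (h_tensor q q) \<le> 2 ^ ?x"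
      by (rule pow2_mono) (use Suc in simp)
  qed auto
  ultimately show ?case
    by (simp add: Let_def flip: q_def)
qed simp

text \<open>Every variable contributes a chain of at most \<open>d + 1\<close> constructors
  \<open>Horner\<close>.\<close>

lemma hdepth_dense: "hdepth (dense f d \<alpha> is) \<le> length is * Suc d"
proof (induction f d \<alpha> "is" rule: dense.induct)
  case (2 f d \<alpha> i "is")
  have *: "hdepth (foldr Horner ps Zero) \<le> length ps + b" if "\<forall>p\<in>set ps. hdepth p \<le> b" for ps b
    using that by (induction ps) auto
  show ?case
    using *[of "map (\<lambda>j. dense f d (\<alpha> + sgl i j) is) [0..<Suc d]" "length is * Suc d"] 2
    by (simp del: upt_Suc)
qed simp

text \<open>A bound linear in the number, rather than in its logarithm, is enough: sizes are
  measured by their own exponent, so numbers up to \<open>2 ^ t\<close> merely contribute about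
  \<open>t\<close> to that exponent.\<close>

lemma length_bits_of_nat: "length (bits_of_nat k) \<le> k"
proof (induction k rule: bits_of_nat.induct)
  case (1 k)
  then show ?case
    by (subst bits_of_nat.simps) auto
qed

lemma dsize_dy_of_int: "dsize (dy_of_int z) \<le> Suc (nat \<bar>z\<bar>)"
  by (simp add: dy_of_int_def length_bits_of_nat)

lemma leaves_le_dense:
  assumes "\<And>\<alpha>. Suc (nat \<bar>coef f \<alpha>\<bar>) \<le> 2 ^ \<sigma>"
  shows "leaves_le \<sigma> (dense f d \<alpha> is)"
  using assms
proof (induction f d \<alpha> "is" rule: dense.induct)
  case (1 f d \<alpha>)
  then show ?case
    using order_trans[OF dsize_dy_of_int 1(1)] by simp
next
  case (2 f d \<alpha> i "is")
  have *: "leaves_le \<sigma> (foldr Horner ps Zero)" if "\<forall>p\<in>set ps. leaves_le \<sigma> p" for ps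
    using that by (induction ps) auto
  show ?case
    using 2 by (auto intro!: * simp del: upt_Suc)
qed

section \<open>The subdivision loop\<close>

text \<open>Halving only increments the unary exponent of the width, which starts at
  \<open>0\<close>. This exponent is therefore the subdivision depth of a cube.\<close>

fun level :: "dcube \<Rightarrow> nat" where
  "level (as, Dyadic s xs e) = e"

definition hbox :: "cube \<Rightarrow> real list set" where
  "hbox Q = {x. length x = length (fst Q) \<and> (\<forall>i<length x. fst Q ! i \<le> x ! i \<and> x ! i < fst Q ! i + snd Q)}"

lemma corner_in_hbox: "0 < snd Q \<Longrightarrow> fst Q \<in> hbox Q"
  by (simp add: hbox_def)

lemma map_dy_val_subcorners:
  "map dy_val ` set (subcorners h as) =
    {b. length b = length as \<and> (\<forall>i<length as. b ! i \<in> {dy_val (as ! i), dy_val (as ! i) + dy_val h})}"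
proof (induction as)
  case (Cons a as)
  let ?S = "\<lambda>as. {b. length b = length as \<and> (\<forall>i<length as. b ! i \<in> {dy_val (as ! i), dy_val (as ! i) + dy_val h})}"
  have "map dy_val ` set (subcorners h (a # as)) =
      (#) (dy_val a) ` (map dy_val ` set (subcorners h as)) \<union>
      (#) (dy_val a + dy_val h) ` (map dy_val ` set (subcorners h as))"
    by (simp add: Let_def image_Un image_image)
  also have "\<dots> = (#) (dy_val a) ` ?S as \<union> (#) (dy_val a + dy_val h) ` ?S as"
    by (simp only: Cons)
  also have "\<dots> = ?S (a # as)"
  proof (intro Set.set_eqI iffI)
    fix b assume b: "b \<in> ?S (a # as)"
    then obtain c cs where b_eq: "b = c # cs"
      by (cases b) auto
    have all: "b ! i \<in> {dy_val ((a # as) ! i), dy_val ((a # as) ! i) + dy_val h}" if "i < length (a # as)" for i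
      using b that by blast
    have "c \<in> {dy_val a, dy_val a + dy_val h}"
      using all[of 0] by (simp add: b_eq)
    moreover have "cs ! i \<in> {dy_val (as ! i), dy_val (as ! i) + dy_val h}" if "i < length as" for i
      using all[of "Suc i"] that by (simp add: b_eq)
    then have "cs \<in> ?S as"
      using b by (simp add: b_eq)
    ultimately show "b \<in> (#) (dy_val a) ` ?S as \<union> (#) (dy_val a + dy_val h) ` ?S as"
      unfolding b_eq by blast
  qed (auto simp: nth_Cons split: nat.splits)
  finally show ?case .
qed simp

lemma distinct_subcorners:
  "dy_val h \<noteq> 0 \<Longrightarrow> distinct (map (map dy_val) (subcorners h as))"
proof (induction as)
  case (Cons a as)
  have eq: "map (map dy_val) (subcorners h (a # as)) =
      map ((#) (dy_val a)) (map (map dy_val) (subcorners h as)) @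
      map ((#) (dy_val a + dy_val h)) (map (map dy_val) (subcorners h as))"
    by (simp add: Let_def)
  have "distinct (map ((#) c) (map (map dy_val) (subcorners h as)))" for c :: real
    using Cons by (subst distinct_map) (simp add: inj_on_def)
  then show ?case
    unfolding eq distinct_append using Cons.prems by (auto simp del: map_map)
qed simp

lemma sorted_wrt_distinct:
  "distinct xs \<Longrightarrow> (\<And>x y. x \<in> set xs \<Longrightarrow> y \<in> set xs \<Longrightarrow> x \<noteq> y \<Longrightarrow> R x y) \<Longrightarrow> sorted_wrt R xs"
  by (induction xs) auto

lemma bits_val_pos: "0 < w \<Longrightarrow> dy_val (Dyadic False (bits_of_nat (nat w)) e) = real_of_int w / 2 ^ e"
  by (simp add: dy_val_Dyadic bval_bits_of_nat)

text \<open>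
  The program works on lists, \<open>pv_step\<close> on sets. That the half-open boxes in a list are disjoint
  ensures that removing the value of one cube from the set does not remove that of another one.
\<close>

definition disjoint_boxes :: "dcube \<Rightarrow> dcube \<Rightarrow> bool" where
  "disjoint_boxes J K \<longleftrightarrow> hbox (dcube_val J) \<inter> hbox (dcube_val K) = {}"

lemma disjoint_boxes_sym: "disjoint_boxes J K \<Longrightarrow> disjoint_boxes K J"
  by (auto simp: disjoint_boxes_def)

lemma subcubes_eq: "subcubes J = map (\<lambda>bs. (bs, dy_half (snd J))) (subcorners (dy_half (snd J)) (fst J))"
  by (cases J) (simp add: Let_def)

lemma dcube_val_subcubes: "dcube_val ` set (subcubes J) = bisect (dcube_val J)"
proof -
  have "dcube_val ` set (subcubes J) =
      (\<lambda>b. (b, dy_val (snd J) / 2)) ` (map dy_val ` set (subcorners (dy_half (snd J)) (fst J)))"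
    by (simp add: subcubes_eq image_image dcube_val_def)
  also have "\<dots> = bisect (dcube_val J)"
    unfolding map_dy_val_subcorners bisect_def by (auto simp: dcube_val_def)
  finally show ?thesis .
qed

lemma hbox_bisect: "0 \<le> snd Q \<Longrightarrow> Q' \<in> bisect Q \<Longrightarrow> hbox Q' \<subseteq> hbox Q"
  by (fastforce simp: bisect_def hbox_def)

text \<open>The corners of two different subcubes differ in some coordinate, and there by exactly
  their common width, so the half-open intervals in that coordinate are disjoint.\<close>

lemma disjoint_boxes_subcubes:
  assumes "0 < dy_val (snd J)"
  shows "sorted_wrt disjoint_boxes (subcubes J)"
proof -
  let ?h = "dy_half (snd J)"
  have "sorted_wrt (\<lambda>b c. hbox (b, dy_val ?h) \<inter> hbox (c, dy_val ?h) = {}) (map (map dy_val) (subcorners ?h (fst J)))"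
  proof (rule sorted_wrt_distinct)
    show "distinct (map (map dy_val) (subcorners ?h (fst J)))"
      using assms by (intro distinct_subcorners) simp
    fix b c
    assume "b \<in> set (map (map dy_val) (subcorners ?h (fst J)))" "c \<in> set (map (map dy_val) (subcorners ?h (fst J)))" "b \<noteq> c"
    then have bc: "b \<in> map dy_val ` set (subcorners ?h (fst J))" "c \<in> map dy_val ` set (subcorners ?h (fst J))" "b \<noteq> c"
      by auto
    then have len: "length b = length (fst J)" "length c = length (fst J)"
      unfolding map_dy_val_subcorners by auto
    then obtain i where i: "i < length (fst J)" "b ! i \<noteq> c ! i"
      using bc(3) by (metis nth_equalityI)
    have "b ! i \<in> {dy_val (fst J ! i), dy_val (fst J ! i) + dy_val ?h}"
      "c ! i \<in> {dy_val (fst J ! i), dy_val (fst J ! i) + dy_val ?h}"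
      using bc(1,2) i(1) unfolding map_dy_val_subcorners by blast+
    then have "b ! i = c ! i + dy_val ?h \<or> c ! i = b ! i + dy_val ?h"
      using i(2) by auto
    then show "hbox (b, dy_val ?h) \<inter> hbox (c, dy_val ?h) = {}"
      using i(1) len by (fastforce simp: hbox_def)
  qed
  then show ?thesis
    by (simp add: subcubes_eq sorted_wrt_map disjoint_boxes_def dcube_val_def)
qed

lemma corner_bisect:
  assumes "(b, v) \<in> bisect Q" "i < length (fst Q)" "0 \<le> snd Q"
  shows "fst Q ! i \<le> b ! i" "b ! i + v \<le> fst Q ! i + snd Q"
  using assms by (auto simp: bisect_def)

lemma T_subcubes_le:
  assumes "\<forall>c\<in>set (fst J). dsize c \<le> 2 ^ \<sigma>" "dsize (snd J) \<le> 2 ^ \<sigma>"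
  shows "length (subcubes J) = 2 ^ length (fst J)"
    "\<And>K. K \<in> set (subcubes J) \<Longrightarrow> length (fst K) = length (fst J) \<and> (\<forall>c\<in>set (fst K). dsize c \<le> 2 ^ (\<sigma> + 3))"
    "T_subcubes J \<le> 2 ^ (2 * \<sigma> + 13 + 3 * length (fst J))"
proof -
  let ?h = "dy_half (snd J)" and ?x = "2 * \<sigma> + 10 + 3 * length (fst J)"
  have h: "dsize ?h \<le> 2 ^ (\<sigma> + 1)"
    using add_mono[OF assms(2) one_le_power[of 2 \<sigma>]] by simp
  have c: "\<forall>c\<in>set (fst J). dsize c \<le> 2 ^ (\<sigma> + 1)"
    using assms(1) by (auto elim: pow2_mono)
  have e: "\<sigma> + 1 + 2 = \<sigma> + 3"
    by simp
  note s = subcorners_size[OF h c, unfolded e]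
  show "length (subcubes J) = 2 ^ length (fst J)"
    using s by (simp add: subcubes_eq)
  show "length (fst K) = length (fst J) \<and> (\<forall>c\<in>set (fst K). dsize c \<le> 2 ^ (\<sigma> + 3))" if "K \<in> set (subcubes J)" for K
    using s that unfolding subcubes_eq by force
  have "T_subcorners ?h (fst J) \<le> 2 ^ ?x"
    using s by (auto elim: pow2_mono)
  moreover have "Suc (2 ^ length (fst J)) \<le> (2 :: nat) ^ ?x"
    by (rule pow2_mono[where x = "Suc (length (fst J))"]) auto
  ultimately have "1 + T_subcorners ?h (fst J) + Suc (2 ^ length (fst J)) + 1 + 0 + 0 \<le> 2 ^ (2 * \<sigma> + 13 + 3 * length (fst J))"
    by (intro pow2_sum6[where x = ?x]) auto
  then show "T_subcubes J \<le> 2 ^ (2 * \<sigma> + 13 + 3 * length (fst J))"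
    using s by (cases J) (simp add: Let_def)
qed

text \<open>The geometry enters through \<open>small\<close>: every cube of depth \<open>L\<close>
  inside the initial cube passes a test. Here \<open>\<sigma>\<close> bounds the size exponents of
  the input numbers and coefficients, and \<open>D\<close> the depths of the two Horner
  terms.\<close>

locale pv_run =
  fixes n L \<sigma> D :: nat and p g :: horner and a :: "int list" and w :: int
  assumes wf: "hwf n p" "g = h_grad_prod n p" "length a = n" "0 < w"
    and size: "leaves_le \<sigma> p" "leaves_le \<sigma> g" "hdepth p \<le> D" "hdepth g \<le> D"
      "\<forall>z\<in>set a. dsize (dy_of_int z) \<le> 2 ^ \<sigma>" "dsize (dy_of_int w) \<le> 2 ^ \<sigma>"
    and small: "\<And>b. length b = n \<Longrightarrow>
      (\<forall>i<n. real_of_int (a ! i) \<le> b ! i \<and> b ! i + real_of_int w / 2 ^ L \<le> real_of_int (a ! i) + real_of_int w) \<Longrightarrow>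
      C0 (hpoly 0 p) (b, real_of_int w / 2 ^ L) \<or> C1 (hpoly 0 p) (b, real_of_int w / 2 ^ L)"
begin

text \<open>One bisection raises the size exponent of the corner coordinates by at most
  \<open>3\<close>, hence \<open>3 * level J\<close>. The width is fixed as a term, so the level
  determines it.\<close>

definition good :: "dcube \<Rightarrow> bool" where
  "good J \<longleftrightarrow> length (fst J) = n \<and> level J \<le> L \<and>
    snd J = Dyadic False (bits_of_nat (nat w)) (level J) \<and>
    (\<forall>c\<in>set (fst J). dsize c \<le> 2 ^ (\<sigma> + 3 * level J)) \<and>
    (\<forall>i<n. real_of_int (a ! i) \<le> dy_val (fst J ! i) \<and>
      dy_val (fst J ! i) + dy_val (snd J) \<le> real_of_int (a ! i) + real_of_int w)"

lemma good_width:
  assumes "good J"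
  shows "dy_val (snd J) = real_of_int w / 2 ^ level J" "0 < dy_val (snd J)"
    "dsize (snd J) \<le> 2 ^ (\<sigma> + 3 * level J)"
proof -
  have J: "snd J = Dyadic False (bits_of_nat (nat w)) (level J)"
    using assms by (simp add: good_def)
  show "dy_val (snd J) = real_of_int w / 2 ^ level J" "0 < dy_val (snd J)"
    using wf(4) unfolding J by (simp_all only: bits_val_pos) simp_all
  have "dsize (snd J) = dsize (dy_of_int w) + level J"
    unfolding J using wf(4) by (simp add: dy_of_int_def)
  also have "\<dots> \<le> 2 ^ \<sigma> + level J"
    using size(6) by simp
  also have "\<dots> \<le> 2 ^ \<sigma> * Suc (level J)"
    by simp
  also have "\<dots> \<le> 2 ^ \<sigma> * 2 ^ level J"
    using Suc_le_pow2 by (intro mult_left_mono) auto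
  also have "\<dots> \<le> 2 ^ (\<sigma> + 3 * level J)"
    by (simp add: power_increasing flip: power_add)
  finally show "dsize (snd J) \<le> 2 ^ (\<sigma> + 3 * level J)" .
qed

lemma good_initial: "good (map dy_of_int a, dy_of_int w)"
  using wf(3,4) size(5) by (auto simp: good_def dy_of_int_def[of w] bits_val_pos)

lemma good_accepted:
  assumes "good J"
  shows "accepted p g J \<longleftrightarrow> C0 (hpoly 0 p) (dcube_val J) \<or> C1 (hpoly 0 p) (dcube_val J)"
  by (rule accepted_correct) (use wf assms good_width[OF assms] in \<open>auto simp: good_def\<close>)

lemma good_accepted_final:
  assumes "good J" "level J = L"
  shows "accepted p g J"
proof -
  have "dcube_val J = (map dy_val (fst J), real_of_int w / 2 ^ L)"
    using good_width(1)[OF assms(1)] assms(2) by (simp add: dcube_val_def)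
  moreover have "length (map dy_val (fst J)) = n"
    "\<forall>i<n. real_of_int (a ! i) \<le> map dy_val (fst J) ! i \<and>
      map dy_val (fst J) ! i + real_of_int w / 2 ^ L \<le> real_of_int (a ! i) + real_of_int w"
    using assms good_width(1)[OF assms(1)] by (auto simp: good_def)
  ultimately show ?thesis
    unfolding good_accepted[OF assms(1)] by (simp only: small)
qed

lemma good_subcubes:
  assumes "good J" "level J < L" "K \<in> set (subcubes J)"
  shows "good K" "level K = Suc (level J)"
proof -
  have J: "snd J = Dyadic False (bits_of_nat (nat w)) (level J)" "length (fst J) = n"
    "\<forall>c\<in>set (fst J). dsize c \<le> 2 ^ (\<sigma> + 3 * level J)"
    using assms(1) by (auto simp: good_def)
  have K: "snd K = Dyadic False (bits_of_nat (nat w)) (Suc (level J))"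
    using assms(3) J(1) unfolding subcubes_eq by (auto simp del: level.simps)
  then show lev: "level K = Suc (level J)"
    by (cases K) simp
  have len: "length (fst K) = n"
    using T_subcubes_le(2)[OF J(3) good_width(3)[OF assms(1)] assms(3)] J(2) by simp
  have sz: "\<forall>c\<in>set (fst K). dsize c \<le> 2 ^ (\<sigma> + 3 * level J + 3)"
    using T_subcubes_le(2)[OF J(3) good_width(3)[OF assms(1)] assms(3)] by simp
  have "dcube_val K \<in> bisect (dcube_val J)"
    using assms(3) dcube_val_subcubes by blast
  then have "dy_val (fst J ! i) \<le> dy_val (fst K ! i) \<and>
      dy_val (fst K ! i) + dy_val (snd K) \<le> dy_val (fst J ! i) + dy_val (snd J)" if "i < n" for i
    using corner_bisect[of "map dy_val (fst K)" "dy_val (snd K)" "dcube_val J" i] that len J(2) good_width(2)[OF assms(1)]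
    by (auto simp: dcube_val_def)
  then have "\<forall>i<n. real_of_int (a ! i) \<le> dy_val (fst K ! i) \<and>
      dy_val (fst K ! i) + dy_val (snd K) \<le> real_of_int (a ! i) + real_of_int w"
    using assms(1) unfolding good_def by (meson order_trans)
  then show "good K"
    using len K sz assms(2) lev by (simp add: good_def add_ac)
qed

text \<open>Exponent for one call of \<open>pv_process\<close>: the bounds for testing and
  subdividing with \<open>\<sigma> + 3 * L\<close> in place of \<open>\<sigma>\<close>, raised by
  \<open>3\<close> for the summation.\<close>

definition cost :: nat where
  "cost = 2 * \<sigma> + 6 * L + 18 * D + 3 * n + 25"

lemma T_pv_process_le:
  assumes "good J"
  shows "T_pv_process p g (J # todo, fin) \<le> 2 ^ cost"
proof -
  obtain as v where J: "J = (as, v)"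
    by (cases J)
  let ?\<rho> = "\<sigma> + 3 * L" and ?x = "2 * \<sigma> + 6 * L + 18 * D + 3 * n + 22"
  have l: "level J \<le> L" "length as = n"
    using assms by (auto simp: good_def J)
  have as: "\<forall>c\<in>set as. dsize c \<le> 2 ^ ?\<rho>" and v: "dsize v \<le> 2 ^ ?\<rho>"
    using assms good_width(3)[OF assms] l(1) by (auto simp: good_def J elim!: pow2_mono)
  have "T_accepted p g J \<le> 2 ^ ?x"
    unfolding J using T_accepted_le[OF as v leaves_le_mono[OF size(1)] leaves_le_mono[OF size(2)] size(3,4)] l(2)
    by (auto elim!: pow2_mono)
  moreover have "T_subcubes J \<le> 2 ^ ?x"
    using T_subcubes_le(3)[of J ?\<rho>] as v l(2) by (auto simp: J simp del: T_subcubes.simps elim!: pow2_mono)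
  moreover have "length (subcubes J) = 2 ^ n"
    using T_subcubes_le(1)[of J ?\<rho>] as v l(2) by (auto simp: J simp del: subcubes.simps)
  then have "T_append (subcubes J) todo \<le> 2 ^ ?x"
    by (simp add: pow2_mono[where x = "Suc n"])
  ultimately have "T_accepted p g J + T_subcubes J + T_append (subcubes J) todo + 1 + 0 + 0 \<le> 2 ^ cost"
    unfolding cost_def by (intro pow2_sum6[where x = ?x]) (auto simp del: T_append_eq)
  then show ?thesis
    by (simp del: T_append_eq)
qed

text \<open>The weight of a cube exceeds the total weight of its \<open>2\<^sup>n\<close> subcubes.\<close>

definition potential :: "dcube list \<Rightarrow> nat" where
  "potential Js = (\<Sum>J\<leftarrow>Js. 2 ^ ((n + 1) * (L - level J)))"

text \<open>The last conjunct is an amortized time bound. Each call costs at most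
  \<open>2 ^ cost\<close> and lowers the potential by at least \<open>1\<close>, so the time spent
  plus \<open>2 ^ cost\<close> times the potential never grows. The other conjuncts tie the two
  lists to a run of \<open>pv_step\<close>.\<close>

definition run_inv :: "nat \<Rightarrow> (dcube list \<times> dcube list) \<times> nat \<Rightarrow> bool" where
  "run_inv t0 = (\<lambda>((todo, fin), t).
    (\<forall>J\<in>set (todo @ fin). good J) \<and> sorted_wrt disjoint_boxes (todo @ fin) \<and>
    (\<forall>J\<in>set fin. accepted p g J) \<and>
    (pv_step (hpoly 0 p))\<^sup>*\<^sup>* {dcube_val (map dy_of_int a, dy_of_int w)} (dcube_val ` set (todo @ fin)) \<and>
    t + 2 ^ cost * potential todo \<le> t0 + 2 ^ cost * 2 ^ ((n + 1) * L))"

lemma potential_subcubes: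
  assumes "good J" "level J < L"
  shows "Suc (potential (subcubes J @ todo)) \<le> potential (J # todo)"
proof -
  have "potential (subcubes J) = (\<Sum>K\<leftarrow>subcubes J. 2 ^ ((n + 1) * (L - Suc (level J))))"
    unfolding potential_def by (rule arg_cong[where f = sum_list], rule map_cong[OF refl]) (simp add: good_subcubes(2)[OF assms])
  also have "\<dots> = 2 ^ n * 2 ^ ((n + 1) * (L - Suc (level J)))"
    using T_subcubes_le(1)[of J] assms good_width(3)[OF assms(1)] by (auto simp: good_def sum_list_triv)
  finally have "potential (subcubes J) = 2 ^ n * 2 ^ ((n + 1) * (L - Suc (level J)))" .
  \<comment> \<open>One level changes the exponent by \<open>n + 1\<close>, so the
    \<open>2 ^ n\<close> subcubes carry half of the weight of \<open>J\<close>; the other half, at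
    least \<open>1\<close>, pays for the step.\<close>
  moreover have "(n + 1) * (L - level J) = Suc n + (n + 1) * (L - Suc (level J))"
    using assms(2) by (simp add: Suc_diff_Suc[symmetric] algebra_simps)
  then have "2 ^ ((n + 1) * (L - level J)) = 2 * (2 ^ n * (2 :: nat) ^ ((n + 1) * (L - Suc (level J))))"
    by (simp add: power_add)
  moreover have "1 \<le> 2 ^ n * (2 :: nat) ^ ((n + 1) * (L - Suc (level J)))"
    by simp
  ultimately show ?thesis
    by (simp add: potential_def)
qed

lemma run_inv_step:
  assumes inv: "run_inv t0 ((J # todo, fin), t)"
  shows "run_inv t0 (pv_process p g (J # todo, fin), t + T_pv_process p g (J # todo, fin))"
    and "potential (fst (pv_process p g (J # todo, fin))) < potential (J # todo)"
proof -
  have good: "good J" "\<forall>K\<in>set todo \<union> set fin. good K" and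
    disjoint_boxes: "sorted_wrt disjoint_boxes todo" "sorted_wrt disjoint_boxes fin" "\<forall>K\<in>set todo \<union> set fin. disjoint_boxes J K"
      "\<forall>K\<in>set todo. \<forall>K'\<in>set fin. disjoint_boxes K K'" and
    acc: "\<forall>K\<in>set fin. accepted p g K" and
    steps: "(pv_step (hpoly 0 p))\<^sup>*\<^sup>* {dcube_val (map dy_of_int a, dy_of_int w)} (dcube_val ` set (J # todo @ fin))" and
    time: "t + 2 ^ cost * potential (J # todo) \<le> t0 + 2 ^ cost * 2 ^ ((n + 1) * L)"
    using inv by (auto simp: run_inv_def sorted_wrt_append)
  have time': "t + T_pv_process p g (J # todo, fin) + 2 ^ cost * potential xs \<le> t0 + 2 ^ cost * 2 ^ ((n + 1) * L)"
    if "Suc (potential xs) \<le> potential (J # todo)" for xs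
  proof -
    have "2 ^ cost * Suc (potential xs) \<le> 2 ^ cost * potential (J # todo)"
      using that by (intro mult_left_mono) auto
    then show ?thesis
      using T_pv_process_le[OF good(1), of todo fin] time by (simp del: T_pv_process.simps)
  qed
  have "run_inv t0 (pv_process p g (J # todo, fin), t + T_pv_process p g (J # todo, fin)) \<and>
    potential (fst (pv_process p g (J # todo, fin))) < potential (J # todo)"
  proof (cases "accepted p g J")
    case True
    have dec: "Suc (potential todo) \<le> potential (J # todo)"
      by (simp add: potential_def)
    have "dcube_val ` set (J # todo @ fin) = dcube_val ` set (todo @ J # fin)"
      by auto
    then show ?thesis
      using True good disjoint_boxes acc steps time'[OF dec] dec
      by (auto simp: run_inv_def sorted_wrt_append disjoint_boxes_sym simp del: T_pv_process.simps)
  next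
    case False
    \<comment> \<open>By \<open>small\<close> a rejected cube has not reached level
      \<open>L\<close>, so its subcubes still satisfy the level bound.\<close>
    then have lev: "level J < L"
      using good_accepted_final[OF good(1)] good(1) by (force simp: good_def)
    note dec = potential_subcubes[OF good(1) lev, of todo]
    note pos = good_width(2)[OF good(1)]
    have sub: "hbox (dcube_val K) \<subseteq> hbox (dcube_val J)" if "K \<in> set (subcubes J)" for K
      using that dcube_val_subcubes[of J] pos by (intro hbox_bisect) (auto simp: dcube_val_def)
    then have disjoint_boxes_sub: "\<forall>K\<in>set (subcubes J). \<forall>K'\<in>set todo \<union> set fin. disjoint_boxes K K'"
      using disjoint_boxes(3) unfolding disjoint_boxes_def by blast
    have "dcube_val J \<notin> dcube_val ` (set todo \<union> set fin)"
    proof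
      assume "dcube_val J \<in> dcube_val ` (set todo \<union> set fin)"
      then obtain K where "K \<in> set todo \<union> set fin" "dcube_val J = dcube_val K"
        by blast
      then have "hbox (dcube_val J) = {}"
        using disjoint_boxes(3) by (auto simp: disjoint_boxes_def)
      then show False
        using corner_in_hbox[of "dcube_val J"] pos by (simp add: dcube_val_def)
    qed
    then have "dcube_val ` set (subcubes J @ todo @ fin) =
        dcube_val ` set (J # todo @ fin) - {dcube_val J} \<union> bisect (dcube_val J)"
      by (auto simp flip: dcube_val_subcubes)
    moreover have "\<not> C0 (hpoly 0 p) (dcube_val J)" "\<not> C1 (hpoly 0 p) (dcube_val J)"
      using False good_accepted[OF good(1)] by auto
    ultimately have "pv_step (hpoly 0 p) (dcube_val ` set (J # todo @ fin)) (dcube_val ` set (subcubes J @ todo @ fin))"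
      unfolding pv_step_def by (intro bexI[of _ "dcube_val J"]) auto
    with steps have steps': "(pv_step (hpoly 0 p))\<^sup>*\<^sup>* {dcube_val (map dy_of_int a, dy_of_int w)}
        (dcube_val ` set (subcubes J @ todo @ fin))"
      by (rule rtranclp.rtrancl_into_rtrancl)
    have "\<forall>K\<in>set (subcubes J). good K"
      using good_subcubes(1)[OF good(1) lev] by blast
    then show ?thesis
      using False good disjoint_boxes disjoint_boxes_sub disjoint_boxes_subcubes[OF pos] acc steps' time'[OF dec] dec
      by (auto simp: run_inv_def sorted_wrt_append Un_assoc simp del: T_pv_process.simps)
  qed
  then show "run_inv t0 (pv_process p g (J # todo, fin), t + T_pv_process p g (J # todo, fin))"
    "potential (fst (pv_process p g (J # todo, fin))) < potential (J # todo)"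
    by blast+
qed

text \<open>The potential is both the termination measure and the time budget. It starts at
  \<open>2 ^ ((n + 1) * L)\<close>, the weight of the initial cube.\<close>

theorem pv_loop_correct:
  "\<exists>P T. pv_loop n p (map dy_of_int a, dy_of_int w) = Some (P, T) \<and>
    pv_result (hpoly 0 p) (map real_of_int a, real_of_int w) (dcube_val ` set P) \<and>
    T \<le> T_h_grad_prod n p + 2 ^ (cost + (n + 1) * L)"
proof -
  let ?b = "\<lambda>((todo :: dcube list, fin :: dcube list), t :: nat). todo \<noteq> []"
  let ?c = "\<lambda>(s, t). (pv_process p g s, t + T_pv_process p g s)"
  let ?I = "(map dy_of_int a, dy_of_int w)" and ?t0 = "T_h_grad_prod n p"
  let ?s = "(([?I], []), ?t0)"
  have I: "dcube_val ?I = (map real_of_int a, real_of_int w)"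
    by (simp add: dcube_val_def)
  have "level ?I = 0"
    by (simp add: dy_of_int_def)
  then have init: "run_inv ?t0 ?s"
    using good_initial by (auto simp: run_inv_def potential_def)
  have step: "run_inv ?t0 (?c s) \<and> potential (fst (fst (?c s))) < potential (fst (fst s))" if inv: "run_inv ?t0 s" and todo: "?b s" for s
  proof -
    obtain J todo fin t where s: "s = ((J # todo, fin), t)"
      using todo by (auto simp: neq_Nil_conv split: prod.splits)
    then show ?thesis
      using run_inv_step[of ?t0 J todo fin t] inv by (simp del: pv_process.simps T_pv_process.simps)
  qed
  obtain s' where s': "while_option ?b ?c ?s = Some s'"
    using measure_while_option_Some[where P = "run_inv ?t0" and b = ?b and c = ?c and f = "\<lambda>s. potential (fst (fst s))", OF step init]
    by blast
  have "run_inv ?t0 s'"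
    using while_option_rule[where P = "run_inv ?t0", OF _ s' init] step by blast
  moreover obtain fin t where s'_eq: "s' = (([], fin), t)"
    using while_option_stop[OF s'] by (auto split: prod.splits)
  ultimately have res: "\<forall>J\<in>set fin. good J \<and> accepted p g J"
    "(pv_step (hpoly 0 p))\<^sup>*\<^sup>* {dcube_val ?I} (dcube_val ` set fin)"
    "t \<le> ?t0 + 2 ^ (cost + (n + 1) * L)"
    by (auto simp: run_inv_def potential_def power_add)
  have "pv_loop n p ?I = Some (fin, t)"
    using s' unfolding pv_loop_def Let_def wf(2)[symmetric] by (simp add: s'_eq)
  moreover have "pv_result (hpoly 0 p) (map real_of_int a, real_of_int w) (dcube_val ` set fin)"
    using res(1,2) good_accepted unfolding pv_result_def I by auto
  ultimately show ?thesis
    using res(3) by blast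
qed

end

section \<open>Rejected cubes\<close>

lemma ring_norm_abs: "ring_norm (abs :: real \<Rightarrow> real)"
  by standard (auto simp: abs_mult)

context ring_norm
begin

lemma mnorm_mpow:
  assumes "\<And>i. i \<in> supp \<alpha> \<Longrightarrow> mnorm N (y i) \<le> X"
  shows "mnorm N (mpow y \<alpha>) \<le> X ^ mdeg \<alpha>"
  using assms
proof (induction \<alpha> rule: monomial_induct)
  case zero
  then show ?case
    using norm_1 mnorm_single[of 0 1] by simp
next
  case (var i \<alpha>)
  have supp: "supp \<alpha> \<subseteq> supp (\<alpha> + sgl i (Suc 0))" "i \<in> supp (\<alpha> + sgl i (Suc 0))"
    by (auto simp: in_keys_iff lookup_add)
  have "mnorm N (mpow y \<alpha>) \<le> X ^ mdeg \<alpha>"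
    using var supp(1) by blast
  moreover have X: "mnorm N (y i) \<le> X"
    using var(2) supp(2) by simp
  then have "0 \<le> X"
    using mnorm_nonneg order_trans by blast
  ultimately have "mnorm N (mpow y \<alpha>) * mnorm N (y i) \<le> X ^ mdeg \<alpha> * X"
    using X by (intro mult_mono) auto
  then have "mnorm N (mpow y \<alpha> * y i) \<le> X ^ mdeg \<alpha> * X"
    using mnorm_mult order_trans by blast
  then show ?case
    by (simp add: mpow_add mdeg_add mult.commute)
qed

end

text \<open>Each variable is replaced by a polynomial of norm at most
  \<open>1 + \<bar>m i\<bar> \<le> X\<close>, so a monomial of degree at most \<open>D\<close>
  contributes a factor of at most \<open>X ^ D\<close>.\<close>

lemma mnorm_shift:
  assumes X: "1 \<le> X" "\<And>i. i \<in> mvars F \<Longrightarrow> 1 + \<bar>m i\<bar> \<le> X" and D: "deg_le D F"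
  shows "mnorm abs (shift m F) \<le> mnorm abs F * (X :: real) ^ D"
proof -
  interpret ring_norm "abs :: real \<Rightarrow> real"
    by (rule ring_norm_abs)
  have "mnorm abs (shift m F) \<le> (\<Sum>\<alpha>\<in>supp F. mnorm abs (Cst (coef F \<alpha>) * mpow (\<lambda>i. Var i + Cst (m i)) \<alpha>))"
    unfolding shift_def subst_def by (rule mnorm_sum)
  also have "\<dots> \<le> (\<Sum>\<alpha>\<in>supp F. \<bar>coef F \<alpha>\<bar> * X ^ D)"
  proof (rule sum_mono)
    fix \<alpha> assume \<alpha>: "\<alpha> \<in> supp F"
    have "mnorm abs (mpow (\<lambda>i. Var i + Cst (m i)) \<alpha>) \<le> X ^ mdeg \<alpha>"
    proof (rule mnorm_mpow)
      fix i assume "i \<in> supp \<alpha>"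
      then have "1 + \<bar>m i\<bar> \<le> X"
        using X(2) \<alpha> by (auto simp: mvars_def)
      then show "mnorm abs (Var i + Cst (m i)) \<le> X"
        using mnorm_add[of "Var i" "Cst (m i)"] by (simp add: Var_def)
    qed
    also have "\<dots> \<le> X ^ D"
      using D \<alpha> by (intro power_increasing X(1)) (auto simp: deg_le_def)
    finally have "\<bar>coef F \<alpha>\<bar> * mnorm abs (mpow (\<lambda>i. Var i + Cst (m i)) \<alpha>) \<le> \<bar>coef F \<alpha>\<bar> * X ^ D"
      by (intro mult_left_mono) auto
    then show "mnorm abs (Cst (coef F \<alpha>) * mpow (\<lambda>i. Var i + Cst (m i)) \<alpha>) \<le> \<bar>coef F \<alpha>\<bar> * X ^ D"
      using mnorm_single_mult order_trans by blast
  qed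
  finally show ?thesis
    by (simp add: mnorm_def sum_distrib_right)
qed

lemma asum_le:
  assumes "0 \<le> h" "h \<le> 1"
  shows "asum h t \<le> \<bar>coef t 0\<bar> + h * mnorm abs t"
proof -
  have "asum h t \<le> (\<Sum>\<alpha>\<in>supp t. (if \<alpha> = 0 then \<bar>coef t \<alpha>\<bar> else 0) + h * \<bar>coef t \<alpha>\<bar>)"
    unfolding asum_def
  proof (rule sum_mono)
    fix \<alpha>
    have "h ^ mdeg \<alpha> \<le> h" if "\<alpha> \<noteq> 0"
      using that power_decreasing[of 1 "mdeg \<alpha>" h] assms by (simp add: Suc_le_eq flip: neq0_conv)
    then show "\<bar>coef t \<alpha>\<bar> * h ^ mdeg \<alpha> \<le> (if \<alpha> = 0 then \<bar>coef t \<alpha>\<bar> else 0) + h * \<bar>coef t \<alpha>\<bar>"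
      using assms by (auto simp: mult.commute[of h] mult_left_mono)
  qed
  also have "\<dots> = \<bar>coef t 0\<bar> + h * mnorm abs t"
    by (simp add: sum.distrib mnorm_def sum_distrib_left in_keys_iff)
  finally show ?thesis .
qed

text \<open>If \<open>0\<close> lies in the form, twice the absolute value of the constant
  coefficient is at most \<open>asum\<close>. For a half width of at most \<open>1\<close>,
  \<open>asum\<close> exceeds that absolute value by at most half the width times the norm of the
  shifted polynomial. What remains bounds the value at the midpoint linearly in the width.\<close>

lemma centered_form_zero_bound:
  assumes F: "mvars F \<subseteq> {..<length (fst Q)}" "deg_le D F" and Q: "0 \<le> snd Q" "snd Q \<le> 2"
    and X: "1 \<le> X" "\<forall>c\<in>set (midpoint Q). 1 + \<bar>c\<bar> \<le> X" and zero: "0 \<in> centered_form F Q"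
  shows "\<bar>peval F (midpoint Q)\<bar> \<le> snd Q / 2 * (mnorm abs F * X ^ D)"
proof -
  let ?t = "shift (\<lambda>i. midpoint Q ! i) F"
  have "2 * \<bar>coef ?t 0\<bar> \<le> asum (snd Q / 2) ?t"
    using centered_form_iff(1)[OF F(1)] zero by auto
  also have "\<dots> \<le> \<bar>coef ?t 0\<bar> + snd Q / 2 * mnorm abs ?t"
    using Q by (intro asum_le) auto
  finally have "\<bar>peval F (midpoint Q)\<bar> \<le> snd Q / 2 * mnorm abs ?t"
    by (simp add: coef_shift_0)
  also have "\<dots> \<le> snd Q / 2 * (mnorm abs F * X ^ D)"
  proof (intro mult_left_mono mnorm_shift X(1) F(2))
    fix i assume "i \<in> mvars F"
    then have "midpoint Q ! i \<in> set (midpoint Q)"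
      using F(1) by (auto simp: midpoint_def)
    then show "1 + \<bar>midpoint Q ! i\<bar> \<le> X"
      using X(2) by blast
  qed (use Q in auto)
  finally show ?thesis .
qed

section \<open>The gradient product on the diagonal and the sum of squares\<close>

lemma peval_subst_Cst: "peval (subst Cst y G) x = subst (\<lambda>c. c) (\<lambda>i. peval (y i) x) G"
  by (induction G rule: mpoly_induct) (simp_all add: peval_eq_subst)

lemma peval_append: "mvars F \<subseteq> {..<length x} \<Longrightarrow> peval F (x @ y) = peval F x"
  unfolding peval_eq_subst
  by (rule comm_semiring_hom.subst_cong[OF comm_semiring_hom_ident]) (auto simp: nth_append)

lemma peval_grad_prod:
  assumes "mvars F \<subseteq> {..<n}" "length m = n"
  shows "peval (grad_prod n F) (m @ m) = (\<Sum>i<n. (peval (pd i F) m)\<^sup>2)"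
proof -
  have "peval (pd i F) (m @ m) = peval (pd i F) m" for i
    using mvars_pd[of i F] assms by (intro peval_append) auto
  moreover have "peval (shift_vars n G) (m @ m) = peval G m" for G :: "'a mpoly"
    unfolding shift_vars_simps peval_subst_Cst
    by (simp add: peval_eq_subst nth_append assms(2)[symmetric])
  ultimately show ?thesis
    by (simp add: grad_prod_def peval_eq_subst comm_semiring_hom.subst_sum[OF comm_semiring_hom_ident] power2_eq_square)
qed

lemma mnorm_shift_vars: "mnorm abs (shift_vars n (G :: real mpoly)) \<le> mnorm abs G"
  unfolding shift_vars_def
  by (rule order_trans[OF ring_norm.mnorm_sum[OF ring_norm_abs]])
    (simp add: mnorm_def[of abs G] ring_norm.mnorm_single[OF ring_norm_abs])

lemma deg_le_shift_vars: "deg_le D G \<Longrightarrow> deg_le D (shift_vars n (G :: 'a::comm_semiring_1 mpoly))"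
proof (unfold shift_vars_def, rule deg_le_sum)
  fix \<alpha> assume "deg_le D G" "\<alpha> \<in> supp G"
  moreover have "mdeg (\<Sum>i\<in>S. sgl (n + i) (coef \<alpha> i)) = (\<Sum>i\<in>S. coef \<alpha> i)" for S
    by (induction S rule: infinite_finite_induct) (simp_all add: mdeg_add)
  ultimately show "deg_le D (sgl (\<Sum>i\<in>supp \<alpha>. sgl (n + i) (coef \<alpha> i)) (coef G \<alpha>))"
    by (auto simp: deg_le_def mdeg_def[symmetric] split: if_splits)
qed

lemma real_mpoly_pd: "pd i (real_mpoly f) = real_mpoly (pd i f)"
  by (rule poly_mapping_eqI) (simp add: coef_pd)

lemma mnorm_real_mpoly: "mnorm abs (real_mpoly f) = mnorm zabs f"
  by (simp add: mnorm_def)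

lemma deg_le_real_mpoly [simp]: "deg_le D (real_mpoly f) \<longleftrightarrow> deg_le D f"
  by (simp add: deg_le_def)

lemma mvars_real_mpoly [simp]: "mvars (real_mpoly f) = mvars f"
  by (simp add: mvars_def)

lemma peval_real_mpoly:
  assumes "mvars f \<subseteq> {..<n}" "\<And>i. i < n \<Longrightarrow> x i = m ! i"
  shows "peval (real_mpoly f) m = zsubst x f"
proof -
  have "peval (real_mpoly f) m = zsubst (\<lambda>i. m ! i) f"
    by (simp add: peval_eq_subst subst_def)
  also have "\<dots> = zsubst x f"
    by (rule comm_semiring_hom.subst_cong[OF comm_semiring_hom_real_of_int]) (use assms in auto)
  finally show ?thesis .
qed

lemma mnorm_grad_prod:
  assumes "deg_le d f"
  shows "mnorm abs (grad_prod n (real_mpoly f)) \<le> real n * (real d * mnorm zabs f)\<^sup>2"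
proof -
  interpret ring_norm "abs :: real \<Rightarrow> real"
    by (rule ring_norm_abs)
  let ?q = "real d * mnorm zabs f" and ?F = "real_mpoly f"
  have "mnorm abs (grad_prod n ?F) \<le> (\<Sum>i<n. mnorm abs (pd i ?F * shift_vars n (pd i ?F)))"
    unfolding grad_prod_def by (rule mnorm_sum)
  also have "\<dots> \<le> (\<Sum>i<n. ?q\<^sup>2)"
  proof (rule sum_mono)
    fix i
    have "mnorm abs (pd i ?F) \<le> ?q"
      using mnorm_pd[OF assms] by (simp add: real_mpoly_pd mnorm_real_mpoly)
    moreover from this have "mnorm abs (shift_vars n (pd i ?F)) \<le> ?q"
      using mnorm_shift_vars order_trans by blast
    ultimately have "mnorm abs (pd i ?F) * mnorm abs (shift_vars n (pd i ?F)) \<le> ?q * ?q"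
      using ring_norm.mnorm_nonneg[OF ring_norm_int, of f] by (intro mult_mono) auto
    then show "mnorm abs (pd i ?F * shift_vars n (pd i ?F)) \<le> ?q\<^sup>2"
      using mnorm_mult order_trans unfolding power2_eq_square by blast
  qed
  finally show ?thesis
    by simp
qed

lemma deg_le_grad_prod:
  assumes "deg_le d (F :: 'a::comm_semiring_1 mpoly)"
  shows "deg_le (2 * d) (grad_prod n F)"
  unfolding grad_prod_def
proof (rule deg_le_sum)
  fix i
  have "deg_le d (pd i F)"
    by (rule deg_le_mono[OF deg_le_pd[OF assms]]) simp
  then have "deg_le (d + d) (pd i F * shift_vars n (pd i F))"
    by (intro deg_le_intros deg_le_shift_vars)
  then show "deg_le (2 * d) (pd i F * shift_vars n (pd i F))"
    by (simp add: mult_2)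
qed

text \<open>This is \<open>Q\<close>. Its real zeros are the singular points of the real zero set of
  \<open>f\<close>, so smoothness amounts to positivity of an integer polynomial of degree at most
  \<open>2 * d\<close>.\<close>

definition sumsq :: "nat \<Rightarrow> int mpoly \<Rightarrow> int mpoly" where
  "sumsq n f = f * f + (\<Sum>i<n. pd i f * pd i f)"

lemma subst_sumsq:
  "zsubst x (sumsq n f) = (zsubst x f)\<^sup>2 + (\<Sum>i<n. (zsubst x (pd i f))\<^sup>2)"
  by (simp add: sumsq_def power2_eq_square)

lemma mvars_sumsq: "mvars f \<subseteq> {..<n} \<Longrightarrow> mvars (sumsq n f) \<subseteq> {..<n}"
proof -
  assume f: "mvars f \<subseteq> {..<n}"
  have "mvars (pd i f * pd i f) \<subseteq> {..<n}" for i
    using mvars_mult[of "pd i f" "pd i f"] mvars_pd[of i f] f by blast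
  then have "mvars (\<Sum>i<n. pd i f * pd i f) \<subseteq> {..<n}"
    using mvars_sum[of "\<lambda>i. pd i f * pd i f" "{..<n}"] by blast
  then show ?thesis
    unfolding sumsq_def
    using mvars_add[of "f * f" "\<Sum>i<n. pd i f * pd i f"] mvars_mult[of f f] f by blast
qed

lemma deg_le_sumsq: "deg_le d f \<Longrightarrow> deg_le (2 * d) (sumsq n f)"
proof -
  assume f: "deg_le d f"
  have "deg_le (d + d) (pd i f * pd i f)" for i
    by (intro deg_le_intros deg_le_mono[OF deg_le_pd[OF f]]) auto
  then show ?thesis
    unfolding sumsq_def mult_2 by (intro deg_le_intros(3)[OF deg_le_intros(4)[OF f f] deg_le_sum])
qed

lemma mnorm_sumsq:
  fixes d :: nat
  assumes "deg_le d f"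
  defines "q \<equiv> mnorm zabs f"
  shows "mnorm zabs (sumsq n f) \<le> q\<^sup>2 + real n * (real d * q)\<^sup>2"
proof -
  interpret ring_norm zabs
    by (rule ring_norm_int)
  let ?m = "mnorm zabs"
  have "?m (\<Sum>i<n. pd i f * pd i f) \<le> (\<Sum>i<n. ?m (pd i f * pd i f))"
    by (rule mnorm_sum)
  also have "\<dots> \<le> (\<Sum>i<n. (real d * q)\<^sup>2)"
  proof (rule sum_mono)
    fix i
    have "?m (pd i f) * ?m (pd i f) \<le> (real d * q) * (real d * q)"
      using mnorm_pd[OF assms(1), of i] by (intro mult_mono) (auto simp: q_def)
    then show "?m (pd i f * pd i f) \<le> (real d * q)\<^sup>2"
      using mnorm_mult order_trans unfolding power2_eq_square by blast
  qed
  finally have "?m (\<Sum>i<n. pd i f * pd i f) \<le> real n * (real d * q)\<^sup>2"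
    by simp
  then show ?thesis
    using mnorm_add[of "f * f" "\<Sum>i<n. pd i f * pd i f"] mnorm_mult[of f f]
    by (simp add: sumsq_def q_def power2_eq_square)
qed

lemma sumsq_pos:
  assumes f: "mvars f \<subseteq> {..<n}" and smooth: "smooth_real_zero_set n (real_mpoly f)"
  shows "0 < zsubst x (sumsq n f)"
proof -
  let ?m = "map x [0..<n]"
  have ev: "peval (real_mpoly f) ?m = zsubst x f"
    "peval (pd i (real_mpoly f)) ?m = zsubst x (pd i f)" for i
  proof -
    show "peval (real_mpoly f) ?m = zsubst x f"
      using f by (rule peval_real_mpoly) simp
    show "peval (pd i (real_mpoly f)) ?m = zsubst x (pd i f)"
      unfolding real_mpoly_pd using mvars_pd[of i f] f by (intro peval_real_mpoly[of _ n]) auto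
  qed
  have "\<not> (zsubst x f = 0 \<and> (\<forall>i<n. zsubst x (pd i f) = 0))"
    using smooth ev unfolding smooth_real_zero_set_def by (metis diff_zero length_map length_upt)
  then consider "zsubst x f \<noteq> 0" | i where "i < n" "zsubst x (pd i f) \<noteq> 0"
    by blast
  then show ?thesis
  proof cases
    case 1
    then show ?thesis
      unfolding subst_sumsq by (intro add_pos_nonneg sum_nonneg) auto
  next
    case (2 i)
    then have "0 < (\<Sum>i<n. (zsubst x (pd i f))\<^sup>2)"
      by (intro sum_pos2[of _ i]) auto
    then show ?thesis
      unfolding subst_sumsq by (intro add_nonneg_pos) auto
  qed
qed

text \<open>Rejection by \<open>C0\<close> makes \<open>f\<close> small at the midpoint. Rejection
  by \<open>C1\<close> makes \<open>g\<close> small at the doubled midpoint, where \<open>g\<close>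
  is the squared norm of the gradient. Both parts of \<open>sumsq\<close> are thus at most a
  multiple of half the width.\<close>

lemma rejected_sumsq_bound:
  fixes d :: nat
  assumes f: "mvars f \<subseteq> {..<n}" "deg_le d f" and b: "length b = n" and v: "0 \<le> v" "v \<le> 2"
    and X: "1 \<le> X" "\<And>i. i < n \<Longrightarrow> 1 + \<bar>x i\<bar> \<le> X" and x: "\<And>i. i < n \<Longrightarrow> x i = b ! i + v / 2"
    and rej: "\<not> C0 (real_mpoly f) (b, v)" "\<not> C1 (real_mpoly f) (b, v)"
  defines "q \<equiv> mnorm zabs f"
  shows "zsubst x (sumsq n f) \<le> v / 2 * ((q * X ^ d)\<^sup>2 + real n * (real d * q)\<^sup>2 * X ^ (2 * d))"
proof -
  let ?F = "real_mpoly f" and ?m = "midpoint (b, v)" and ?h = "v / 2"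
  have m: "length ?m = n" "\<And>i. i < n \<Longrightarrow> ?m ! i = x i"
    using b x by (auto simp: midpoint_def)
  have mm: "midpoint (b @ b, v) = ?m @ ?m"
    by (simp add: midpoint_def)
  have Xm: "\<forall>c\<in>set ?m. 1 + \<bar>c\<bar> \<le> X"
    using X(2) m by (auto simp: in_set_conv_nth)
  have q: "0 \<le> q"
    by (simp add: q_def ring_norm.mnorm_nonneg[OF ring_norm_int])
  have "\<bar>peval ?F ?m\<bar> \<le> ?h * (q * X ^ d)"
    using centered_form_zero_bound[of ?F "(b, v)" d X] f b v X(1) Xm rej(1)
    by (simp add: C0_def mnorm_real_mpoly q_def)
  moreover have "peval ?F ?m = zsubst x f"
    using f(1) m(2) by (intro peval_real_mpoly[of _ n]) auto
  ultimately have "(zsubst x f)\<^sup>2 \<le> (?h * (q * X ^ d))\<^sup>2"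
    by (metis abs_ge_zero power2_abs power_mono)
  also have "\<dots> = ?h\<^sup>2 * (q * X ^ d)\<^sup>2"
    by (rule power_mult_distrib)
  \<comment> \<open>Squaring the bound for \<open>f\<close> yields \<open>?h\<^sup>2\<close>; one
    factor \<open>?h \<le> 1\<close> is given away so that both parts become linear in the
    width.\<close>
  also have "?h\<^sup>2 \<le> ?h"
    using v mult_left_mono[of ?h 1 ?h] by (simp add: power2_eq_square)
  then have "?h\<^sup>2 * (q * X ^ d)\<^sup>2 \<le> ?h * (q * X ^ d)\<^sup>2"
    by (rule mult_right_mono) simp
  finally have A: "(zsubst x f)\<^sup>2 \<le> ?h * (q * X ^ d)\<^sup>2" .
  \<comment> \<open>The variables of \<open>grad_prod\<close> are read off from its well-formed
    Horner term in \<open>n + n\<close> variables.\<close>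
  define p where "p = dense f (total_degree f) 0 [0..<n]"
  have p: "hwf n p" "hpoly 0 p = ?F"
    using hwf_dense[of "[0..<n]" f "total_degree f" 0] hpoly_dense[OF f(1)] by (auto simp: p_def)
  have vars: "mvars (grad_prod n ?F) \<subseteq> {..<n + n}"
    using mvars_hpoly[OF grad_prod_hpoly(1)[OF p(1)], of 0] grad_prod_hpoly(2)[OF p(1)] p(2) by auto
  have "\<bar>peval (grad_prod n ?F) (?m @ ?m)\<bar> \<le> ?h * (mnorm abs (grad_prod n ?F) * X ^ (2 * d))"
    using centered_form_zero_bound[of "grad_prod n ?F" "(b @ b, v)" "2 * d" X] vars b v X(1) Xm rej(2)
      deg_le_grad_prod[of d ?F n] f(2)
    by (simp add: C1_def mm)
  also have "\<dots> \<le> ?h * (real n * (real d * q)\<^sup>2 * X ^ (2 * d))"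
    using mnorm_grad_prod[OF f(2), of n] v X(1) by (intro mult_left_mono mult_right_mono) (auto simp: q_def)
  finally have "\<bar>peval (grad_prod n ?F) (?m @ ?m)\<bar> \<le> ?h * (real n * (real d * q)\<^sup>2 * X ^ (2 * d))" .
  moreover have "peval (pd i ?F) ?m = zsubst x (pd i f)" for i
    unfolding real_mpoly_pd using mvars_pd[of i f] f(1) m(2) by (intro peval_real_mpoly[of _ n]) auto
  then have "peval (grad_prod n ?F) (?m @ ?m) = (\<Sum>i<n. (zsubst x (pd i f))\<^sup>2)"
    using peval_grad_prod[of ?F n ?m] f(1) m(1) by simp
  ultimately have "(\<Sum>i<n. (zsubst x (pd i f))\<^sup>2) \<le> ?h * (real n * (real d * q)\<^sup>2 * X ^ (2 * d))"
    by linarith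
  with A show ?thesis
    unfolding subst_sumsq by (simp only: distrib_left add_mono)
qed

section \<open>Size estimates\<close>

lemma rpow2_mono: "a \<le> (2 :: real) ^ x \<Longrightarrow> x \<le> y \<Longrightarrow> a \<le> 2 ^ y"
  by (erule order_trans) (rule power_increasing, auto)

lemma rpow2_mult: "0 \<le> b \<Longrightarrow> a \<le> (2 :: real) ^ x \<Longrightarrow> b \<le> 2 ^ y \<Longrightarrow> a * b \<le> 2 ^ (x + y)"
  unfolding power_add by (intro mult_mono) auto

lemma rpow2_add: "a \<le> (2 :: real) ^ x \<Longrightarrow> b \<le> 2 ^ x \<Longrightarrow> a + b \<le> 2 ^ Suc x"
  by simp

lemma rpow2_power: "0 \<le> a \<Longrightarrow> a \<le> (2 :: real) ^ x \<Longrightarrow> a ^ k \<le> 2 ^ (x * k)"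
  unfolding power_mult by (rule power_mono)

lemma of_nat_le_rpow2: "n \<le> x \<Longrightarrow> real n \<le> 2 ^ x"
  using Suc_le_pow2[of x] of_nat_le_iff[where 'a = real, of n "2 ^ x"] by simp

text \<open>At most \<open>(d + 1) ^ n\<close> exponent vectors have all entries at most
  \<open>d\<close>, and each coefficient contributes at most \<open>H\<close>.\<close>

lemma mnorm_le_height:
  assumes f: "mvars f \<subseteq> {..<n}" "deg_le d f" and H: "\<And>\<alpha>. \<bar>real_of_int (coef f \<alpha>)\<bar> \<le> H"
  shows "mnorm zabs f \<le> real ((d + 1) ^ n) * H"
proof -
  have sub: "supp f \<subseteq> expbox n (\<lambda>_. d + 1)"
  proof
    fix \<alpha> assume "\<alpha> \<in> supp f"
    then have "supp \<alpha> \<subseteq> {..<n}" "mdeg \<alpha> \<le> d"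
      using f by (auto simp: mvars_def deg_le_def)
    then show "\<alpha> \<in> expbox n (\<lambda>_. d + 1)"
      using order_trans[OF coef_le_mdeg] by (simp add: expbox_def less_Suc_eq_le)
  qed
  have "card (supp f) \<le> (d + 1) ^ n"
    by (rule order_trans[OF card_mono[OF card_expbox(1) sub] card_expbox(2)]) auto
  then have "real (card (supp f)) \<le> real ((d + 1) ^ n)"
    by (simp only: of_nat_le_iff)
  moreover have "mnorm zabs f \<le> real (card (supp f)) * H"
    unfolding mnorm_def by (rule sum_bounded_above) (rule H)
  moreover have "0 \<le> H"
    using H[of 0] by linarith
  ultimately show ?thesis
    using mult_right_mono[of "real (card (supp f))" "real ((d + 1) ^ n)" H] by linarith
qed

text \<open>At the midpoint of a rejected cube, \<open>Q\<close> would be at least \<open>2\<close>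
  to the power \<open>- 61 * G\<close>, with \<open>G\<close> as defined in the proof, but at most
  \<open>v / 2 * 2 ^ (12 * (n * d * t))\<close>. As \<open>v / 2\<close> is at most
  \<open>2 ^ t / 2 ^ L\<close>, this forces
  \<open>L \<le> 61 * G + t + 12 * (n * d * t) \<le> 74 * G\<close>, against
  \<open>80 * G \<le> L\<close>. Because of \<open>d \<le> t\<close>, the one number
  \<open>t\<close> controls the degree as well as the coefficients and coordinates.\<close>

lemma small_cube_accepted:
  fixes n d t :: nat and f :: "int mpoly" and a :: "int list" and w :: int
  assumes n: "1 \<le> n" and d: "1 \<le> d" "d \<le> t" and f: "mvars f \<subseteq> {..<n}" "deg_le d f"
    and smooth: "smooth_real_zero_set n (real_mpoly f)"
    and w: "0 < w"
    and H: "\<And>\<alpha>. \<bar>real_of_int (coef f \<alpha>)\<bar> \<le> 2 ^ t" "\<And>i. i < n \<Longrightarrow> \<bar>real_of_int (a ! i)\<bar> \<le> 2 ^ t"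
      "\<And>i. i < n \<Longrightarrow> \<bar>real_of_int (a ! i + w)\<bar> \<le> 2 ^ t"
    and b: "length b = n" and v: "v = real_of_int w / 2 ^ L"
    and inside: "\<forall>i<n. real_of_int (a ! i) \<le> b ! i \<and> b ! i + v \<le> real_of_int (a ! i) + real_of_int w"
    and L: "80 * (n ^ 2 * d * (2 * d + 1) ^ n * t) \<le> L"
  shows "C0 (real_mpoly f) (b, v) \<or> C1 (real_mpoly f) (b, v)"
proof (rule ccontr)
  assume rej: "\<not> (C0 (real_mpoly f) (b, v) \<or> C1 (real_mpoly f) (b, v))"
  let ?m = "mnorm zabs"
  define N where "N = (2 * d + 1) ^ n"
  define G where "G = n ^ 2 * d * N * t"
  define q where "q = ?m f"
  define Q where "Q = sumsq n f"
  define x where "x i = (if i < n then b ! i + v / 2 else 0)" for i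
  interpret ring_norm zabs
    by (rule ring_norm_int)
  have t: "1 \<le> t"
    using d by simp
  have N: "1 \<le> N"
    by (simp add: N_def)
  have nt: "t \<le> n * t" "1 \<le> n * t"
    using n t by auto
  have dt: "d * t \<le> n * d * t" "n * t \<le> n * d * t"
    using n d by auto
  have ndt: "n * d * t \<le> n ^ 2 * d * t"
    using n by (simp add: power2_eq_square)
  have nG: "n ^ 2 * d * t \<le> G"
    using N by (simp add: G_def)
  have q0: "0 \<le> q"
    by (simp add: q_def)
  have d1: "real (d + 1) \<le> 2 ^ t"
  proof -
    have "real (d + 1) \<le> 2 ^ d"
      using of_nat_mono[OF Suc_le_pow2[of d], where 'a = real] by simp
    then show ?thesis
      by (rule rpow2_mono) (rule d(2))
  qed
  have dr: "real d \<le> 2 ^ t"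
    using d1 unfolding of_nat_add by linarith
  have q: "q \<le> 2 ^ (2 * (n * t))"
  proof -
    have "real ((d + 1) ^ n) \<le> 2 ^ (t * n)"
      using rpow2_power[OF _ d1, of n] by simp
    then have "real ((d + 1) ^ n) * 2 ^ t \<le> 2 ^ (t * n + t)"
      by (intro rpow2_mult) auto
    then have "q \<le> 2 ^ (t * n + t)"
      using mnorm_le_height[OF f H(1)] unfolding q_def by linarith
    then show ?thesis
      by (rule rpow2_mono) (use nt in \<open>simp add: mult.commute\<close>)
  qed
  have dq: "real d * q \<le> 2 ^ (3 * (n * t))"
  proof -
    have "real d * q \<le> 2 ^ (t + 2 * (n * t))"
      using dr by (intro rpow2_mult q q0)
    then show ?thesis
      by (rule rpow2_mono) (use nt in simp)
  qed
  have rn: "real n \<le> 2 ^ (n * t)"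
    using t by (intro of_nat_le_rpow2) simp
  have dq2: "real n * (real d * q)\<^sup>2 \<le> 2 ^ (7 * (n * t))"
  proof -
    have "(real d * q)\<^sup>2 \<le> 2 ^ (3 * (n * t) * 2)"
      using q0 by (intro rpow2_power dq) auto
    then have "real n * (real d * q)\<^sup>2 \<le> 2 ^ (n * t + 3 * (n * t) * 2)"
      by (intro rpow2_mult rn) auto
    then show ?thesis
      by (rule rpow2_mono) simp
  qed
  have q2: "q\<^sup>2 \<le> 2 ^ (4 * (n * t))"
    using rpow2_power[OF q0 q, of 2] by (simp add: mult.commute)
  have mQ: "?m Q \<le> 2 ^ (8 * (n * t))"
  proof -
    have "q\<^sup>2 + real n * (real d * q)\<^sup>2 \<le> 2 ^ Suc (7 * (n * t))"
      by (rule rpow2_add[OF rpow2_mono[OF q2] dq2]) simp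
    then have "?m Q \<le> 2 ^ Suc (7 * (n * t))"
      using mnorm_sumsq[OF f(2), of n] unfolding Q_def q_def by linarith
    then show ?thesis
      by (rule rpow2_mono) (use nt in simp)
  qed
  \<comment> \<open>\<open>C\<close> has to dominate the coordinates and \<open>2 * d\<close> times
    the norm of \<open>Q\<close>; the latter has exponent at most
    \<open>(t + 1) + 8 * (n * t)\<close>.\<close>
  define C :: real where "C = 2 ^ (10 * (n * t))"
  have C: "1 \<le> C" "2 ^ t \<le> C"
    using nt by (auto simp: C_def)
  have DQ: "real (2 * d) * ?m Q \<le> C"
  proof -
    have "real (2 * d) \<le> 2 ^ Suc t"
      using dr by simp
    then have "real (2 * d) * ?m Q \<le> 2 ^ (Suc t + 8 * (n * t))"
      by (intro rpow2_mult mQ) auto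
    then show ?thesis
      unfolding C_def by (rule rpow2_mono) (use nt in linarith)
  qed
  define B where "B = 1 + ?m Q * C ^ (n * (2 * d + 1) + 2 * d)"
  \<comment> \<open>In units of \<open>n ^ 2 * d * t\<close> the exponent is \<open>10 * 5\<close>
    from the power of \<open>C\<close>, since
    \<open>n * (2 * d + 1) + 2 * d \<le> 5 * (n * d)\<close>, plus \<open>8\<close> from the norm of
    \<open>Q\<close> and \<open>1\<close> for the added \<open>1\<close>.\<close>
  have B: "B \<le> 2 ^ (59 * (n ^ 2 * d * t))"
  proof -
    have "C ^ (n * (2 * d + 1) + 2 * d) \<le> 2 ^ (10 * (n * t) * (n * (2 * d + 1) + 2 * d))"
      using C by (intro rpow2_power) (auto simp: C_def)
    then have "?m Q * C ^ (n * (2 * d + 1) + 2 * d) \<le> 2 ^ (8 * (n * t) + 10 * (n * t) * (n * (2 * d + 1) + 2 * d))"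
      using C by (intro rpow2_mult mQ) auto
    moreover have "n * (2 * d + 1) + 2 * d \<le> 5 * (n * d)"
    proof -
      have "n \<le> n * d" "d \<le> n * d"
        using n d by auto
      moreover have "n * (2 * d + 1) = 2 * (n * d) + n"
        by (simp add: algebra_simps)
      ultimately show ?thesis
        by linarith
    qed
    then have "8 * (n * t) + 10 * (n * t) * (n * (2 * d + 1) + 2 * d) \<le> 8 * (n * t) + 10 * (n * t) * (5 * (n * d))"
      by (intro add_left_mono mult_left_mono) auto
    moreover have "10 * (n * t) * (5 * (n * d)) = 50 * (n ^ 2 * d * t)"
      by (simp add: power2_eq_square)
    ultimately have "?m Q * C ^ (n * (2 * d + 1) + 2 * d) \<le> 2 ^ (58 * (n ^ 2 * d * t))"
      by (elim rpow2_mono) (use dt(2) ndt in linarith)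
    then have "B \<le> 2 ^ Suc (58 * (n ^ 2 * d * t))"
      unfolding B_def by (intro rpow2_add) auto
    then show ?thesis
      by (rule rpow2_mono) (use nt dt ndt in linarith)
  qed
  have B1: "1 \<le> B"
    using C by (simp add: B_def)
  \<comment> \<open>The factor \<open>N \<le> 2 ^ (2 * t * n)\<close> raises \<open>59\<close> to
    \<open>61\<close>, and the outer power \<open>N\<close> turns \<open>n ^ 2 * d * t\<close> into
    \<open>G\<close>.\<close>
  have NB: "(real N * B) ^ N \<le> 2 ^ (61 * G)"
  proof -
    have "real (2 * d + 1) \<le> 2 ^ (2 * t)"
    proof -
      have "real (2 * d + 1) \<le> 2 ^ t * 2 ^ t"
      proof -
        have "real (2 * d + 1) \<le> real (d + 1) * real (d + 1)"
          by (simp add: algebra_simps)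
        also have "\<dots> \<le> 2 ^ t * 2 ^ t"
          using d1 by (intro mult_mono) auto
        finally show ?thesis .
      qed
      then show ?thesis
        by (simp only: mult_2[of t] power_add)
    qed
    then have "real N \<le> 2 ^ (2 * t * n)"
      unfolding N_def of_nat_power by (intro rpow2_power) auto
    then have "real N * B \<le> 2 ^ (2 * t * n + 59 * (n ^ 2 * d * t))"
      using B1 by (intro rpow2_mult B) auto
    then have "real N * B \<le> 2 ^ (61 * (n ^ 2 * d * t))"
    proof (rule rpow2_mono)
      have "2 * t * n = 2 * (n * t)"
        by simp
      then show "2 * t * n + 59 * (n ^ 2 * d * t) \<le> 61 * (n ^ 2 * d * t)"
        using dt(2) ndt by linarith
    qed
    then have "(real N * B) ^ N \<le> 2 ^ (61 * (n ^ 2 * d * t) * N)"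
      using B1 by (intro rpow2_power) auto
    then show ?thesis
      by (simp add: G_def mult_ac)
  qed
  have v0: "0 < v"
    using w by (simp add: v)
  have x_in: "x \<in> icube n (\<lambda>i. a ! i) w"
    using inside v0 by (fastforce simp: icube_def x_def)
  have lower: "1 / (real N * B) ^ N \<le> zsubst x Q"
    unfolding N_def B_def
  proof (rule positive_polynomial_lower_bound[where C = C and w = w and a = "\<lambda>i. a ! i"])
    show "mvars Q \<subseteq> {..<n}" "deg_le (2 * d) Q"
      unfolding Q_def by (rule mvars_sumsq[OF f(1)], rule deg_le_sumsq[OF f(2)])
    show "\<bar>real_of_int (a ! i)\<bar> \<le> C" "\<bar>real_of_int (a ! i + w)\<bar> \<le> C" if "i < n" for i
      using H(2,3)[OF that] C(2) by linarith+
    show "0 < zsubst z Q" for z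
      unfolding Q_def by (rule sumsq_pos[OF f(1) smooth])
  qed (use w C(1) DQ x_in in auto)
  have wt: "real_of_int w \<le> 2 ^ Suc t"
  proof -
    have "real_of_int w \<le> \<bar>real_of_int (a ! 0 + w)\<bar> + \<bar>real_of_int (a ! 0)\<bar>"
      by simp
    then show ?thesis
      using H(2,3)[of 0] n by simp
  qed
  have tG: "t \<le> G" "d * t \<le> G" "n * d * t \<le> G" "n * t \<le> G" "1 \<le> G"
    using nt dt ndt nG by linarith+
  have LG: "80 * G \<le> L"
    using L by (simp add: G_def N_def)
  have v2: "v \<le> 2"
  proof -
    have "(2 :: real) ^ t \<le> 2 ^ L"
      by (rule power_increasing) (use tG LG in linarith, simp)
    then have "real_of_int w \<le> 2 * 2 ^ L"
      using wt unfolding power_Suc by linarith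
    then show ?thesis
      by (simp add: v divide_le_eq)
  qed
  define X :: real where "X = 2 ^ (2 * t)"
  have X: "1 \<le> X" "1 + 2 ^ t \<le> X"
  proof -
    show "1 \<le> X"
      by (simp add: X_def)
    have "(1 :: real) + 2 ^ t \<le> 2 ^ Suc t"
      by simp
    then show "1 + 2 ^ t \<le> X"
      unfolding X_def by (rule rpow2_mono) (use t in simp)
  qed
  have xX: "1 + \<bar>x i\<bar> \<le> X" if "i < n" for i
  proof -
    have "real_of_int (a ! i) \<le> x i" "x i \<le> real_of_int (a ! i + w)"
      using x_in that by (auto simp: icube_def)
    then have "\<bar>x i\<bar> \<le> 2 ^ t"
      using H(2,3)[OF that] by linarith
    then show ?thesis
      using X(2) by linarith
  qed
  \<comment> \<open>The two summands have exponents \<open>4 * (n * t) + 4 * (d * t)\<close> and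
    \<open>7 * (n * t) + 4 * (d * t)\<close>, both at most \<open>11 * (n * d * t)\<close>; adding
    them leads to \<open>12\<close>.\<close>
  have upper: "zsubst x Q \<le> v / 2 * 2 ^ (12 * (n * d * t))"
  proof -
    have Xd: "X ^ d \<le> 2 ^ (2 * (d * t))" "X ^ (2 * d) \<le> 2 ^ (4 * (d * t))"
      unfolding X_def by (simp_all flip: power_mult add: mult_ac)
    have "q * X ^ d \<le> 2 ^ (2 * (n * t) + 2 * (d * t))"
      using X by (intro rpow2_mult q Xd) auto
    then have "(q * X ^ d)\<^sup>2 \<le> 2 ^ ((2 * (n * t) + 2 * (d * t)) * 2)"
      using X q0 by (intro rpow2_power) auto
    moreover have "(2 * (n * t) + 2 * (d * t)) * 2 = 4 * (n * t) + 4 * (d * t)"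
      by simp
    then have "(2 * (n * t) + 2 * (d * t)) * 2 \<le> 11 * (n * d * t)"
      using dt by linarith
    ultimately have 1: "(q * X ^ d)\<^sup>2 \<le> 2 ^ (11 * (n * d * t))"
      by (rule rpow2_mono)
    have "real n * (real d * q)\<^sup>2 * X ^ (2 * d) \<le> 2 ^ (7 * (n * t) + 4 * (d * t))"
      using X by (intro rpow2_mult dq2 Xd) auto
    then have 2: "real n * (real d * q)\<^sup>2 * X ^ (2 * d) \<le> 2 ^ (11 * (n * d * t))"
      by (rule rpow2_mono) (use dt in linarith)
    have "(q * X ^ d)\<^sup>2 + real n * (real d * q)\<^sup>2 * X ^ (2 * d) \<le> 2 ^ Suc (11 * (n * d * t))"
      using 1 2 by (rule rpow2_add)
    then have "(q * X ^ d)\<^sup>2 + real n * (real d * q)\<^sup>2 * X ^ (2 * d) \<le> 2 ^ (12 * (n * d * t))"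
      by (rule rpow2_mono) (use nt dt in linarith)
    then have "v / 2 * ((q * X ^ d)\<^sup>2 + real n * (real d * q)\<^sup>2 * X ^ (2 * d)) \<le> v / 2 * 2 ^ (12 * (n * d * t))"
      using v0 by (intro mult_left_mono) auto
    moreover have "zsubst x Q \<le> v / 2 * ((q * X ^ d)\<^sup>2 + real n * (real d * q)\<^sup>2 * X ^ (2 * d))"
      unfolding Q_def q_def
      by (rule rejected_sumsq_bound[OF f b]) (use v0 v2 X(1) xX rej in \<open>auto simp: x_def\<close>)
    ultimately show ?thesis
      by linarith
  qed
  have "1 \<le> (real N * B) ^ N * (v / 2 * 2 ^ (12 * (n * d * t)))"
  proof -
    have "0 < (real N * B) ^ N"
      using N B1 by simp
    moreover have "1 / (real N * B) ^ N \<le> v / 2 * 2 ^ (12 * (n * d * t))"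
      using lower upper by linarith
    ultimately show ?thesis
      by (simp add: divide_le_eq mult.commute)
  qed
  also have "\<dots> \<le> 2 ^ (61 * G) * (2 ^ t / 2 ^ L * 2 ^ (12 * (n * d * t)))"
  proof (intro mult_mono NB)
    show "v / 2 \<le> 2 ^ t / 2 ^ L"
      using divide_right_mono[of "real_of_int w / 2" "2 ^ t" "2 ^ L"] wt by (simp add: v)
  qed (use v0 in auto)
  finally have "2 ^ L \<le> 2 ^ (61 * G) * (2 ^ t * (2 :: real) ^ (12 * (n * d * t)))"
    by (simp add: field_simps)
  then have "(2 :: real) ^ L \<le> 2 ^ (61 * G + (t + 12 * (n * d * t)))"
    by (simp add: power_add)
  then have "L \<le> 61 * G + (t + 12 * (n * d * t))"
    by (rule power_le_imp_le_exp[rotated]) simp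
  then show False
    using tG LG by linarith
qed

text \<open>Every summand is a multiple of something below \<open>n * G\<close>. In the second sum
  the multiples add up to \<open>762\<close>, of which \<open>480\<close> come from
  \<open>6 * (80 * G)\<close> and \<open>160\<close> from \<open>(n + 1) * (80 * G)\<close>.\<close>

lemma run_time_exponent:
  fixes n d t :: nat
  assumes "1 \<le> n" "1 \<le> d" "1 \<le> t"
  defines "G \<equiv> n ^ 2 * d * (2 * d + 1) ^ n * t"
  defines "\<sigma> \<equiv> t + 2 + 2 * (n * Suc d) + 2 + 2 * n" and "D \<equiv> 2 * (n * Suc d)"
  shows "2 * (t + 2) + 8 * (n * Suc d) + 5 * n + 16 \<le> 800 * (n * G)"
    and "2 * \<sigma> + 6 * (80 * G) + 18 * D + 3 * n + 25 + (n + 1) * (80 * G) \<le> 800 * (n * G)"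
proof -
  have le: "a \<le> a * b" "a \<le> b * a" if "1 \<le> b" for a b :: nat
    using that by auto
  have N: "1 \<le> (2 * d + 1) ^ n"
    by simp
  have "n * d * t \<le> n * (n * d * t)"
    by (rule le(2)) (rule assms(1))
  also have "\<dots> \<le> n * (n * d * t) * (2 * d + 1) ^ n"
    by (rule le(1)) (rule N)
  also have "\<dots> = G"
    by (simp add: G_def power2_eq_square mult_ac)
  finally have ndt: "n * d * t \<le> G" .
  have "n * d \<le> n * d * t" "t \<le> n * d * t" "n \<le> n * d" "1 \<le> n * d"
    using assms(1-3) by (auto intro!: le)
  then have G: "n * d \<le> G" "t \<le> G" "n \<le> G" "1 \<le> G"
    using ndt by linarith+
  have nG: "G \<le> n * G"
    by (rule le(2)) (rule assms(1))
  have nd: "n * Suc d = n * d + n"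
    by simp
  show "2 * (t + 2) + 8 * (n * Suc d) + 5 * n + 16 \<le> 800 * (n * G)"
  proof -
    have "2 * (t + 2) = 2 * t + 4"
      by simp
    then show ?thesis
      using nd G nG by linarith
  qed
  have "(n + 1) * (80 * G) = 80 * (n * G) + 80 * G" "2 * \<sigma> = 2 * t + 8 + 4 * (n * Suc d) + 4 * n"
    "18 * D = 36 * (n * Suc d)" "6 * (80 * G) = 480 * G"
    by (simp_all add: \<sigma>_def D_def)
  then show "2 * \<sigma> + 6 * (80 * G) + 18 * D + 3 * n + 25 + (n + 1) * (80 * G) \<le> 800 * (n * G)"
    using nd G nG by linarith
qed

text \<open>The initial computation of \<open>g\<close> and the loop each take at most
  \<open>2 ^ (800 * (n * G))\<close> steps; their sum accounts for the \<open>+ 1\<close>.\<close>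

lemma modified_pv_correct:
  fixes n d t :: nat and f :: "int mpoly" and a :: "int list" and w :: int
  assumes n: "1 \<le> n" and d: "1 \<le> total_degree f" "total_degree f \<le> t" and f: "mvars f \<subseteq> {..<n}"
    and smooth: "smooth_real_zero_set n (real_mpoly f)"
    and a: "length a = n" and w: "0 < w"
    and H: "\<And>\<alpha>. \<bar>real_of_int (coef f \<alpha>)\<bar> \<le> 2 ^ t" "\<And>i. i < n \<Longrightarrow> \<bar>real_of_int (a ! i)\<bar> \<le> 2 ^ t"
      "\<And>i. i < n \<Longrightarrow> \<bar>real_of_int (a ! i + w)\<bar> \<le> 2 ^ t"
  defines "d \<equiv> total_degree f"
  shows "\<exists>P T. modified_pv n f a w = Some (P, T) \<and>
    pv_result (real_mpoly f) (map real_of_int a, real_of_int w) (dcube_val ` set P) \<and>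
    T \<le> 2 ^ (800 * (n * (n ^ 2 * d * (2 * d + 1) ^ n * t)) + 1)"
proof -
  define G where "G = n ^ 2 * d * (2 * d + 1) ^ n * t"
  define L where "L = 80 * G"
  define p where "p = dense f d 0 [0..<n]"
  define g where "g = h_grad_prod n p"
  define \<sigma> where "\<sigma> = t + 2 + 2 * (n * Suc d) + 2 + 2 * n"
  define D where "D = 2 * (n * Suc d)"
  have p: "hwf n p" "hpoly 0 p = real_mpoly f"
    using hwf_dense[of "[0..<n]" f d 0] hpoly_dense[OF f] by (simp_all add: p_def d_def)
  \<comment> \<open>The width is the difference of two coordinates and may reach
    \<open>2 * 2 ^ t\<close>; together with the successor this is why size exponents start at
    \<open>t + 2\<close>.\<close>
  have nat_le: "Suc (nat \<bar>z\<bar>) \<le> 2 ^ (t + 2)" if "\<bar>real_of_int z\<bar> \<le> 2 * 2 ^ t" for z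
  proof -
    have "real (nat \<bar>z\<bar>) \<le> real (2 * 2 ^ t)"
      using that by simp
    then have "nat \<bar>z\<bar> \<le> 2 * 2 ^ t"
      by (simp only: of_nat_le_iff)
    moreover have "(1 :: nat) \<le> 2 ^ t"
      by simp
    moreover have "(2 :: nat) ^ (t + 2) = 4 * 2 ^ t"
      by (simp add: power_add)
    ultimately show ?thesis
      by linarith
  qed
  have \<sigma>: "t + 2 \<le> \<sigma>" "t + 2 + 2 * hdepth p + 2 + 2 * n \<le> \<sigma>" and
    D: "hdepth p \<le> n * Suc d" "2 * hdepth p \<le> D"
    using hdepth_dense[of f d 0 "[0..<n]"] by (auto simp: \<sigma>_def D_def p_def)
  have leaves: "leaves_le (t + 2) p"
    unfolding p_def
  proof (rule leaves_le_dense)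
    fix \<alpha>
    show "Suc (nat \<bar>coef f \<alpha>\<bar>) \<le> 2 ^ (t + 2)"
      using H(1)[of \<alpha>] by (intro nat_le) simp
  qed
  note gp = h_grad_prod_size[OF leaves, of n]
  have wt: "\<bar>real_of_int w\<bar> \<le> 2 * 2 ^ t"
    using H(2,3)[of 0] n by linarith
  interpret pv_run n L \<sigma> D p g a w
  proof
    show "hwf n p" "g = h_grad_prod n p" "length a = n" "0 < w"
      using p g_def a w by auto
    show "leaves_le \<sigma> p"
      using leaves \<sigma>(1) by (rule leaves_le_mono)
    show "leaves_le \<sigma> g"
      unfolding g_def using gp \<sigma>(2) by (blast intro: leaves_le_mono)
    show "hdepth p \<le> D" "hdepth g \<le> D"
      using D gp by (auto simp: g_def)
    show "\<forall>z\<in>set a. dsize (dy_of_int z) \<le> 2 ^ \<sigma>"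
    proof
      fix z assume "z \<in> set a"
      then obtain i where "i < n" "z = a ! i"
        using a by (auto simp: in_set_conv_nth)
      then have "\<bar>real_of_int z\<bar> \<le> 2 * 2 ^ t"
        using H(2)[of i] by simp
      then show "dsize (dy_of_int z) \<le> 2 ^ \<sigma>"
        by (rule pow2_mono[OF order_trans[OF dsize_dy_of_int nat_le]]) (rule \<sigma>(1))
    qed
    show "dsize (dy_of_int w) \<le> 2 ^ \<sigma>"
      by (rule pow2_mono[OF order_trans[OF dsize_dy_of_int nat_le[OF wt]]]) (rule \<sigma>(1))
    fix b :: "real list"
    assume b: "length b = n" "\<forall>i<n. real_of_int (a ! i) \<le> b ! i \<and>
      b ! i + real_of_int w / 2 ^ L \<le> real_of_int (a ! i) + real_of_int w"
    show "C0 (hpoly 0 p) (b, real_of_int w / 2 ^ L) \<or> C1 (hpoly 0 p) (b, real_of_int w / 2 ^ L)"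
      unfolding p(2)
      by (rule small_cube_accepted[OF n d f deg_le_total_degree smooth w H b(1) refl b(2)])
        (auto simp: L_def G_def d_def)
  qed
  obtain P T where PT: "modified_pv n f a w = Some (P, T)"
    "pv_result (real_mpoly f) (map real_of_int a, real_of_int w) (dcube_val ` set P)"
    "T \<le> T_h_grad_prod n p + 2 ^ (cost + (n + 1) * L)"
    using pv_loop_correct[unfolded p(2)] unfolding modified_pv_def p_def d_def by blast
  have t: "1 \<le> t"
    using d by simp
  note exps = run_time_exponent[OF n d(1) t, folded d_def, folded G_def \<sigma>_def D_def]
  have "T_h_grad_prod n p \<le> 2 ^ (800 * (n * G))"
  proof (rule pow2_mono)
    show "T_h_grad_prod n p \<le> 2 ^ (2 * (t + 2) + 8 * hdepth p + 5 * n + 16)"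
      using gp by blast
    show "2 * (t + 2) + 8 * hdepth p + 5 * n + 16 \<le> 800 * (n * G)"
      using exps(1) D(1) by linarith
  qed
  moreover have "cost + (n + 1) * L \<le> 800 * (n * G)"
    using exps(2) unfolding cost_def unfolding L_def by linarith
  then have "(2 :: nat) ^ (cost + (n + 1) * L) \<le> 2 ^ (800 * (n * G))"
    by (intro power_increasing) simp_all
  ultimately have "T \<le> 2 ^ (800 * (n * G)) + 2 ^ (800 * (n * G))"
    using PT(3) by linarith
  then have "T \<le> 2 ^ (800 * (n * G) + 1)"
    by simp
  with PT(1,2) show ?thesis
    unfolding G_def by blast
qed

theorem theorem27:
  "\<exists>(c::real) (k::nat). \<forall>(n::nat) (f::int mpoly) (a::int list) (w::int).
     mvars f \<subseteq> {..<n} \<longrightarrow> total_degree f \<ge> 1 \<longrightarrow> smooth_real_zero_set n (real_mpoly f) \<longrightarrow>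
     length a = n \<longrightarrow> w > 0 \<longrightarrow>
     (let d = total_degree f;
          \<tau> = log 2 (real_of_int (input_height f a w));
          E = real n ^ 3 * 2 ^ (24 * n) * real d ^ (12 * n + 1) *
                (real d + \<tau> + real n * log 2 (real d));
          M = 2 ^ (26 * n) * real d ^ (14 * n + 2) * (real d + \<tau>)
      in \<exists>P T. modified_pv n f a w = Some (P, T) \<and>
           pv_result (real_mpoly f) (map real_of_int a, real_of_int w) (dcube_val ` set P) \<and>
           real T \<le> 2 powr (c * E) * (c * M * log 2 M ^ k))"
\<comment> \<open>\<open>1601 = 2 * 800 + 1\<close>: the \<open>800\<close> is that of
  \<open>modified_pv_correct\<close>, the \<open>2\<close> comes from
  \<open>real t \<le> 2 * (d + \<tau>)\<close>, and the \<open>1\<close> absorbs the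
  \<open>+ 1\<close> in the exponent because \<open>E\<close> is at least \<open>1\<close>. With
  \<open>k = 0\<close> the second factor is \<open>1601 * M\<close>, which is at least
  \<open>1\<close>.\<close>
proof (rule exI[of _ 1601], rule exI[of _ 0], intro allI impI)
  fix n :: nat and f :: "int mpoly" and a :: "int list" and w :: int
  assume f: "mvars f \<subseteq> {..<n}" and d1: "1 \<le> total_degree f" and smooth: "smooth_real_zero_set n (real_mpoly f)"
    and a: "length a = n" and w: "0 < w"
  define d where "d = total_degree f"
  define H where "H = input_height f a w"
  define \<tau> where "\<tau> = log 2 (real_of_int H)"
  \<comment> \<open>Rounding \<open>\<tau>\<close> up gives a natural exponent with
    \<open>H \<le> 2 ^ t\<close>. Adding \<open>d\<close> provides the required
    \<open>d \<le> t\<close> and keeps \<open>t\<close> within a constant factor of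
    \<open>d + \<tau>\<close>.\<close>
  define t where "t = d + nat \<lceil>\<tau>\<rceil>"
  define E where "E = real n ^ 3 * 2 ^ (24 * n) * real d ^ (12 * n + 1) * (real d + \<tau> + real n * log 2 (real d))"
  define M where "M = 2 ^ (26 * n) * real d ^ (14 * n + 2) * (real d + \<tau>)"
  have d: "1 \<le> d"
    using d1 by (simp add: d_def)
  let ?S = "abs ` (coef f ` supp f \<union> set a \<union> (\<lambda>t. t + w) ` set a)"
  have Max: "\<bar>z\<bar> \<le> H" if "z \<in> coef f ` supp f \<union> set a \<union> (\<lambda>t. t + w) ` set a" for z
    unfolding H_def input_height_def using that by (intro Max_ge) auto
  have "total_degree f \<in> insert 0 (mdeg ` supp f)"
    unfolding total_degree_def by (intro Max_in) auto
  then obtain \<alpha> where \<alpha>: "\<alpha> \<in> supp f" "total_degree f = mdeg \<alpha>"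
    using d1 by auto
  have H1: "1 \<le> H"
    using Max[of "coef f \<alpha>"] \<alpha>(1) by (force simp: in_keys_iff)
  \<comment> \<open>A monomial of positive degree contains a variable, so \<open>n = 0\<close> is
    impossible.\<close>
  have n: "1 \<le> n"
  proof -
    have "supp \<alpha> \<noteq> {}"
      using \<alpha>(2) d1 by (auto simp: mdeg_def)
    then obtain i where "i \<in> supp \<alpha>"
      by blast
    then have "i < n"
      using f \<alpha>(1) unfolding mvars_def by blast
    then show ?thesis
      by simp
  qed
  have \<tau>: "0 \<le> \<tau>"
    using H1 by (simp add: \<tau>_def)
  have Ht: "real_of_int H \<le> 2 ^ t"
  proof -
    have "real_of_int H = 2 powr \<tau>"
      using H1 by (simp add: \<tau>_def)
    also have "\<dots> \<le> 2 powr real t"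
      using real_nat_ceiling_ge[of \<tau>] by (intro powr_mono) (auto simp: t_def)
    finally show ?thesis
      by (simp add: powr_realpow)
  qed
  have bound: "\<bar>real_of_int z\<bar> \<le> 2 ^ t" if "z \<in> coef f ` supp f \<union> set a \<union> (\<lambda>t. t + w) ` set a" for z
    using Max[OF that] Ht by linarith
  have "\<bar>real_of_int (coef f \<gamma>)\<bar> \<le> 2 ^ t" for \<gamma>
    using bound[of "coef f \<gamma>"] by (cases "\<gamma> \<in> supp f") (auto simp: in_keys_iff)
  moreover have "\<bar>real_of_int (a ! i)\<bar> \<le> 2 ^ t" "\<bar>real_of_int (a ! i + w)\<bar> \<le> 2 ^ t" if "i < n" for i
    using that a by (auto intro!: bound simp del: of_int_add)
  ultimately obtain P T where PT: "modified_pv n f a w = Some (P, T)"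
    "pv_result (real_mpoly f) (map real_of_int a, real_of_int w) (dcube_val ` set P)"
    "T \<le> 2 ^ (800 * (n * (n ^ 2 * d * (2 * d + 1) ^ n * t)) + 1)"
    using modified_pv_correct[OF n d1 _ f smooth a w, of t] unfolding d_def[symmetric] t_def by auto
  define X where "X = n * (n ^ 2 * d * (2 * d + 1) ^ n * t)"
  let ?e = "800 * X + 1"
  define U where "U = real n ^ 3 * 2 ^ (24 * n) * real d ^ (12 * n + 1)"
  have U: "1 \<le> U"
  proof -
    have "1 * 1 * 1 \<le> U"
      unfolding U_def using n d by (intro mult_mono one_le_power) auto
    then show ?thesis
      by simp
  qed
  \<comment> \<open>For \<open>d \<ge> 1\<close> the base is at most \<open>4 * d\<close>, and the
    resulting exponents \<open>2 * n\<close> and \<open>n\<close> are below those granted by the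
    theorem.\<close>
  have N: "real ((2 * d + 1) ^ n) \<le> 2 ^ (24 * n) * real d ^ (12 * n)"
  proof -
    have "real ((2 * d + 1) ^ n) \<le> (4 * real d) ^ n"
      unfolding of_nat_power using d by (intro power_mono) auto
    also have "\<dots> = 2 ^ (2 * n) * real d ^ n"
      by (simp add: power_mult_distrib power_mult)
    also have "\<dots> \<le> 2 ^ (24 * n) * real d ^ (12 * n)"
      using d by (intro mult_mono power_increasing) auto
    finally show ?thesis .
  qed
  have t: "real t \<le> 2 * (real d + \<tau>)"
  proof -
    have "real t \<le> real d + (\<tau> + 1)"
      unfolding t_def of_nat_add using \<tau> of_int_ceiling_le_add_one[of \<tau>] by (intro add_left_mono) simp
    moreover have "1 \<le> real d"
      using d by simp
    ultimately show ?thesis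
      using \<tau> by argo
  qed
  have dE: "real d + \<tau> \<le> real d + \<tau> + real n * log 2 (real d)"
    using d by simp
  have UE: "U * (real d + \<tau>) \<le> E"
    unfolding E_def U_def[symmetric] using U by (intro mult_left_mono dE) auto
  have "real ?e \<le> 800 * (2 * E) + 1"
  proof -
    have "real X = real n ^ 3 * real d * real ((2 * d + 1) ^ n) * real t"
      by (simp add: X_def power2_eq_square power3_eq_cube)
    also have "\<dots> \<le> real n ^ 3 * real d * (2 ^ (24 * n) * real d ^ (12 * n)) * (2 * (real d + \<tau>))"
      using \<tau> by (intro mult_mono mult_left_mono N t) auto
    also have "\<dots> = 2 * (U * (real d + \<tau>))"
      by (simp add: U_def)
    finally show ?thesis
      using UE by simp
  qed
  also have "\<dots> \<le> 1601 * E"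
  proof -
    have "1 * 1 \<le> U * (real d + \<tau>)"
      using U d \<tau> by (intro mult_mono) auto
    then show ?thesis
      using UE by linarith
  qed
  finally have e: "real ?e \<le> 1601 * E" .
  have "1 * 1 * 1 \<le> M"
    unfolding M_def using d \<tau> by (intro mult_mono one_le_power) auto
  then have M: "1 \<le> 1601 * M"
    by simp
  have "real T \<le> real (2 ^ ?e)"
    using PT(3) unfolding X_def by (simp only: of_nat_le_iff)
  also have "\<dots> = 2 powr real ?e"
    by (subst powr_realpow) auto
  also have "\<dots> \<le> 2 powr (1601 * E) * 1"
    using e by (simp add: powr_mono)
  also have "\<dots> \<le> 2 powr (1601 * E) * (1601 * M * log 2 M ^ 0)"
    using M by (intro mult_left_mono) auto
  finally show "let d = total_degree f; \<tau> = log 2 (real_of_int (input_height f a w));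
          E = real n ^ 3 * 2 ^ (24 * n) * real d ^ (12 * n + 1) *
                (real d + \<tau> + real n * log 2 (real d));
          M = 2 ^ (26 * n) * real d ^ (14 * n + 2) * (real d + \<tau>)
      in \<exists>P T. modified_pv n f a w = Some (P, T) \<and>
           pv_result (real_mpoly f) (map real_of_int a, real_of_int w) (dcube_val ` set P) \<and>
           real T \<le> 2 powr (1601 * E) * (1601 * M * log 2 M ^ 0)"
    using PT(1,2) unfolding Let_def E_def M_def \<tau>_def H_def d_def by blast
qed

end
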